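(* For any integers $s,t,k\geq 2$ there exists a constant $C=C(s,t,k)>0$ such that for all $n$, $\mathrm{ex}(n,K_{s,t}^k)\leq C\,n^{1+\frac{s-1}{sk}}$.
   Context: $\mathrm{ex}(n,H)$ denotes the maximum number of edges in a graph on $n$ vertices not containing $H$ as a subgraph. For a graph $F$, the $k$-subdivision $F^k$ is the graph obtained by replacing each edge of $F$ by a path of length $k$, these paths being internally vertex-disjoint. $K_{s,t}$ is the complete bipartite graph with parts of sizes $s$ and $t$. *)

theory Defs
  imports Complex_Main
begin

type_synonym 'a graph = "'a set \<times> 'a set set"

abbreviation verts :: "'a graph \<Rightarrow> 'a set" where "verts \<equiv> fst"
abbreviation edges :: "'a graph \<Rightarrow> 'a set set" where "edges \<equiv> snd"

definition simple_graph :: "'a graph \<Rightarrow> bool" where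
  "simple_graph G \<longleftrightarrow> finite (verts G) \<and> (\<forall>e\<in>edges G. e \<subseteq> verts G \<and> card e = 2)"

text \<open>Subgraph containment is up to isomorphism and not necessarily induced.\<close>

definition contains_copy :: "'a graph \<Rightarrow> 'b graph \<Rightarrow> bool" where
  "contains_copy G H \<longleftrightarrow>
     (\<exists>f. inj_on f (verts H) \<and> f ` verts H \<subseteq> verts G \<and> (\<forall>e\<in>edges H. f ` e \<in> edges G))"

text \<open>
  Every finite graph is isomorphic to one with vertices in \<^typ>\<open>nat\<close>, so restricting the host
  graphs to this type loses nothing. The set below is finite, and it is nonempty as soon as
  \<open>H\<close> has an edge (lemma \<open>ex_attained\<close>), so \<^const>\<open>Max\<close> is a genuine maximum.
\<close>

definition ex :: "nat \<Rightarrow> 'b graph \<Rightarrow> nat" where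
  "ex n H = Max {card (edges G) | G :: nat graph.
                   simple_graph G \<and> card (verts G) = n \<and> \<not> contains_copy G H}"

definition complete_bipartite :: "nat \<Rightarrow> nat \<Rightarrow> nat graph" where
  "complete_bipartite s t = ({..<s + t}, {{i, j} | i j. i < s \<and> s \<le> j \<and> j < s + t})"

datatype 'a subdivision_vertex = Branch 'a | Inner "'a set" nat

text \<open>
  The \<open>i\<close>-th vertex (\<open>0 \<le> i \<le> k\<close>) of the path of length \<open>k\<close> replacing the edge \<open>e\<close>.
  The linear order is only used to choose a direction in which to number that path; a different
  choice gives an isomorphic graph.
\<close>

definition path_vertex :: "nat \<Rightarrow> 'a::linorder set \<Rightarrow> nat \<Rightarrow> 'a subdivision_vertex" where
  "path_vertex k e i =
     (if i = 0 then Branch (Min e) else if i = k then Branch (Max e) else Inner e i)"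

text \<open>Meaningful for \<open>k \<ge> 1\<close>.\<close>

definition subdivide :: "nat \<Rightarrow> 'a::linorder graph \<Rightarrow> 'a subdivision_vertex graph" where
  "subdivide k F =
     (Branch ` verts F \<union> {Inner e i | e i. e \<in> edges F \<and> 0 < i \<and> i < k},
      {{path_vertex k e i, path_vertex k e (Suc i)} | e i. e \<in> edges F \<and> i < k})"

lemma simple_graph_complete_bipartite: "simple_graph (complete_bipartite s t)"
  by (auto simp: simple_graph_def complete_bipartite_def card_insert_if)

lemma simple_graph_subdivide:
  assumes "simple_graph F" "k \<ge> 1"
  shows "simple_graph (subdivide k F)"
proof -
  have sub: "edges F \<subseteq> Pow (verts F)" and fin: "finite (verts F)"
    using assms(1) by (auto simp: simple_graph_def)
  have "finite (edges F)"
    using sub fin by (meson finite_Pow_iff finite_subset)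
  moreover have "{Inner e i | e i. e \<in> edges F \<and> 0 < i \<and> i < k}
                   \<subseteq> (\<lambda>(e, i). Inner e i) ` (edges F \<times> {..<k})"
    by auto
  ultimately have "finite {Inner e i | e i. e \<in> edges F \<and> 0 < i \<and> i < k}"
    by (meson finite_SigmaI finite_imageI finite_lessThan finite_subset)
  then have "finite (verts (subdivide k F))"
    using fin by (simp add: subdivide_def)
  moreover have "{path_vertex k e i, path_vertex k e (Suc i)} \<subseteq> verts (subdivide k F)
      \<and> card {path_vertex k e i, path_vertex k e (Suc i)} = 2"
    if e: "e \<in> edges F" and i: "i < k" for e i
  proof -
    from e assms(1) have e': "finite e" "e \<noteq> {}" "e \<subseteq> verts F" "card e = 2"
      using fin by (auto simp: simple_graph_def intro: finite_subset)
    then have mem: "Min e \<in> verts F" "Max e \<in> verts F"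
      using Min_in Max_in by blast+
    from e'(4) obtain x y where "e = {x, y}" "x \<noteq> y"
      by (auto simp: card_2_iff)
    then have "Min e \<noteq> Max e"
      by (auto simp: min_def max_def)
    with mem e i show ?thesis
      by (auto simp: path_vertex_def subdivide_def card_insert_if)
  qed
  ultimately show ?thesis
    by (auto simp: simple_graph_def subdivide_def)
qed

lemma ex_attained:
  assumes "edges H \<noteq> {}"
  obtains G :: "nat graph" where "simple_graph G" "card (verts G) = n" "\<not> contains_copy G H"
    "card (edges G) = ex n H"
    "\<And>G' :: nat graph. simple_graph G' \<Longrightarrow> card (verts G') = n \<Longrightarrow> \<not> contains_copy G' H
       \<Longrightarrow> card (edges G') \<le> ex n H"
proof -
  define S where "S = {card (edges G) | G :: nat graph.
                   simple_graph G \<and> card (verts G) = n \<and> \<not> contains_copy G H}"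
  have "card (edges G) \<le> 2 ^ n" if "simple_graph G" "card (verts G) = n" for G :: "nat graph"
  proof -
    have "edges G \<subseteq> Pow (verts G)" "finite (verts G)"
      using that(1) by (auto simp: simple_graph_def)
    then show ?thesis
      using card_mono[of "Pow (verts G)" "edges G"] that(2) by (simp add: card_Pow)
  qed
  then have "S \<subseteq> {..2 ^ n}"
    by (auto simp: S_def)
  then have fin: "finite S"
    by (rule finite_subset) simp
  have "simple_graph ({..<n}, {} :: nat set set)" "\<not> contains_copy ({..<n}, {} :: nat set set) H"
    using assms by (auto simp: simple_graph_def contains_copy_def)
  then have "card (edges ({..<n}, {} :: nat set set)) \<in> S"
    unfolding S_def by (intro CollectI exI[of _ "({..<n}, {} :: nat set set)"]) simp
  then have "Max S \<in> S"
    using fin by (intro Max_in) auto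
  moreover have "Max S = ex n H"
    by (simp add: S_def ex_def)
  moreover have "card (edges G') \<le> Max S"
    if "simple_graph G'" "card (verts G') = n" "\<not> contains_copy G' H" for G' :: "nat graph"
    using that by (intro Max_ge[OF fin]) (unfold S_def, blast)
  ultimately show ?thesis
    using that by (auto simp: S_def)
qed

end

theory Submission
  imports Defs "HOL-Library.FuncSet"
begin

text \<open>
  After passing to an almost regular subgraph with degrees between \<open>d\<close> and \<open>K d\<close>, one counts
  embeddings of the spider with \<open>s\<close> legs of length \<open>k\<close>; there are about \<open>n d^(s k)\<close> of them, and this
  exceeds \<open>n^s\<close> by a large factor. Call a tuple of prescribed leaf images rich for a smaller piece
  (a spider with shorter legs, or a path of length at most \<open>k\<close>) if many embeddings of that piece
  with these leaves have pairwise disjoint interiors and contain no smaller rich piece. If the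
  leaves are not rich, boundedly many vertices meet all such embeddings, and cutting the piece at
  these vertices bounds the number of embeddings by a constant. Hence, if few embeddings of the
  full spider contained a rich piece, some \<open>s\<close> leaves would carry too many spiders.

  So for some piece a positive proportion of its embeddings are rich. Cleaning these yields a core
  in which any leaf can be moved: a rich tuple offers many choices for the neighbour of the leaf
  (many different embeddings have these leaves), and from that neighbour there are many ways to
  step to a new leaf that is again part of a rich tuple. Zigzagging in this way lengthens each leg
  by any even number of edges while avoiding any bounded set; odd lengths require a
  suitable initial configuration. Reconnecting the final leaves by richness gives the
  subdivision.
\<close>

section \<open>Embeddings of tree patterns\<close>

text \<open>The count is tight up to a constant: with \<open>d\<close> about
  \<open>C * n powr ((s - 1) / (s * k))\<close>, the number \<open>n * d ^ (s * k)\<close> exceeds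
  \<open>n ^ s\<close> only by a constant factor. No power of \<open>n\<close> is ever to spare, so
  richness, avoidance and walks all run on constant budgets.

  The obstacle is that many spiders on the same feet may all pass through a few vertices. Cutting
  there yields smaller pieces with prescribed leaves, so the family of pieces has to be closed under
  cutting. That the witnesses of richness contain no smaller rich piece has a second purpose: with
  the leaves fixed, only boundedly many of them send a given inner vertex to a given place, so many
  embeddings mean many different vertices next to a leaf. Hence the order of the constants: the
  demand \<open>L m\<close> is chosen after the bound \<open>F (m - 1)\<close>, and
  \<open>F m\<close> after \<open>L m\<close>.

  A rich path, unlike a rich spider, provides no common centre. There a dense relation between the
  first and last vertices of core paths around one vertex is used to fix all centres and feet before
  any leg is built.\<close>

lemma clean_cells:
  fixes c :: "'i \<Rightarrow> 'b set" and \<tau> :: "'i \<Rightarrow> real"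
  assumes "finite B" "finite I" "\<And>i. i \<in> I \<Longrightarrow> \<tau> i \<ge> 0"
  shows "\<exists>B'\<subseteq>B. (\<forall>i\<in>I. B' \<inter> c i = {} \<or> \<tau> i \<le> real (card (B' \<inter> c i))) \<and>
           real (card B) \<le> real (card B') + (\<Sum>i\<in>I. \<tau> i)"
proof -
  \<comment> \<open>A cell is removed only once it is down to fewer than \<open>\<tau> i\<close>
    elements, so removing it costs at most its threshold. A maximal index set for which this
    accounting holds replaces the iterated removal.\<close>
  define \<J> where "\<J> = {J. J \<subseteq> I \<and> real (card B) \<le> real (card (B - (\<Union>i\<in>J. c i))) + (\<Sum>i\<in>J. \<tau> i)}"
  have fin: "finite \<J>"
    using assms(2) by (auto simp: \<J>_def)
  have "{} \<in> \<J>"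
    by (simp add: \<J>_def)
  then obtain J where J: "J \<in> \<J>" and mx: "\<And>J'. J' \<in> \<J> \<Longrightarrow> J \<subseteq> J' \<Longrightarrow> J = J'"
    using finite_has_maximal2[OF fin] by metis
  define B' where "B' = B - (\<Union>i\<in>J. c i)"
  have JI: "J \<subseteq> I" and J2: "real (card B) \<le> real (card B') + (\<Sum>i\<in>J. \<tau> i)"
    using J by (auto simp: \<J>_def B'_def)
  have finB': "finite B'"
    using assms(1) by (simp add: B'_def)
  have ok: "B' \<inter> c i = {} \<or> \<tau> i \<le> real (card (B' \<inter> c i))" if i: "i \<in> I" for i
  proof (rule ccontr)
    assume neg: "\<not> ?thesis"
    then have iJ: "i \<notin> J"
      by (auto simp: B'_def)
    have eq: "B - (\<Union>i\<in>insert i J. c i) = B' - (B' \<inter> c i)"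
      by (auto simp: B'_def)
    have "card (B' - (B' \<inter> c i)) = card B' - card (B' \<inter> c i)"
      using finB' by (intro card_Diff_subset) auto
    moreover have "card (B' \<inter> c i) \<le> card B'"
      using finB' by (intro card_mono) auto
    ultimately have "real (card (B - (\<Union>i\<in>insert i J. c i))) = real (card B') - real (card (B' \<inter> c i))"
      unfolding eq by linarith
    moreover have "(\<Sum>j\<in>insert i J. \<tau> j) = \<tau> i + (\<Sum>j\<in>J. \<tau> j)"
      using iJ finite_subset[OF JI assms(2)] by simp
    ultimately have "insert i J \<in> \<J>"
      using neg J2 JI i unfolding \<J>_def by auto
    from mx[OF this] iJ show False by auto
  qed
  have "(\<Sum>i\<in>J. \<tau> i) \<le> (\<Sum>i\<in>I. \<tau> i)"
    using JI assms(2,3) by (intro sum_mono2) auto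
  then show ?thesis
    using ok J2 by (intro exI[of _ B'] conjI) (auto simp: B'_def)
qed

section \<open>Almost regular hosts and pattern embeddings\<close>

locale host =
  fixes V :: "'a set" and adj :: "'a \<Rightarrow> 'a \<Rightarrow> bool" and d K :: nat
  assumes finV: "finite V"
    and adj_V: "adj x y \<Longrightarrow> x \<in> V \<and> y \<in> V"
    and adj_sym: "adj x y \<Longrightarrow> adj y x"
    and adj_irrefl: "\<not> adj x x"
    and deg_ge: "v \<in> V \<Longrightarrow> d \<le> card {w. adj v w}"
    and deg_le: "v \<in> V \<Longrightarrow> card {w. adj v w} \<le> K * d"
begin

lemma fin_nb: "finite {w. adj v w}"
  using adj_V by (intro finite_subset[OF _ finV]) auto

end

locale host_pattern = host V adj d K
  for V :: "'a set" and adj :: "'a \<Rightarrow> 'a \<Rightarrow> bool" and d K :: nat +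
  fixes padj :: "'p \<Rightarrow> 'p \<Rightarrow> bool"
  assumes padj_sym: "padj p q \<Longrightarrow> padj q p" and padj_irrefl: "\<not> padj p p"
begin

definition Emb :: "'p set \<Rightarrow> ('p \<Rightarrow> 'a) set" where
  "Emb D = {\<phi> \<in> D \<rightarrow>\<^sub>E V. inj_on \<phi> D \<and> (\<forall>p\<in>D. \<forall>q\<in>D. padj p q \<longrightarrow> adj (\<phi> p) (\<phi> q))}"

lemma EmbI:
  assumes "\<And>p. p \<in> D \<Longrightarrow> \<phi> p \<in> V" "\<And>p. p \<notin> D \<Longrightarrow> \<phi> p = undefined" "inj_on \<phi> D"
    "\<And>p q. p \<in> D \<Longrightarrow> q \<in> D \<Longrightarrow> padj p q \<Longrightarrow> adj (\<phi> p) (\<phi> q)"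
  shows "\<phi> \<in> Emb D"
  using assms by (auto simp: Emb_def PiE_iff extensional_def)

lemma finite_Emb: "finite D \<Longrightarrow> finite (Emb D)"
  unfolding Emb_def using finV by (intro finite_subset[OF _ finite_PiE[of D "\<lambda>_. V"]]) auto

lemma Emb_restrict: "\<phi> \<in> Emb D \<Longrightarrow> D' \<subseteq> D \<Longrightarrow> restrict \<phi> D' \<in> Emb D'"
  by (rule EmbI) (simp_all add: Emb_def inj_on_def subset_iff PiE_iff)

lemma Emb_V: "\<phi> \<in> Emb D \<Longrightarrow> p \<in> D \<Longrightarrow> \<phi> p \<in> V"
  by (auto simp: Emb_def)

lemma Emb_inj: "\<phi> \<in> Emb D \<Longrightarrow> p \<in> D \<Longrightarrow> q \<in> D \<Longrightarrow> \<phi> p = \<phi> q \<longleftrightarrow> p = q"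
  unfolding Emb_def inj_on_def by blast

lemma Emb_inj_on: "\<phi> \<in> Emb D \<Longrightarrow> inj_on \<phi> D"
  by (auto simp: Emb_def)

lemma Emb_adj: "\<phi> \<in> Emb D \<Longrightarrow> p \<in> D \<Longrightarrow> q \<in> D \<Longrightarrow> padj p q \<Longrightarrow> adj (\<phi> p) (\<phi> q)"
  unfolding Emb_def by blast

lemma Emb_ext: "\<phi> \<in> Emb D \<Longrightarrow> restrict \<phi> D = \<phi>"
  by (auto simp: Emb_def PiE_restrict)

lemma Emb_eqI: "\<phi> \<in> Emb D \<Longrightarrow> \<psi> \<in> Emb D \<Longrightarrow> (\<And>p. p \<in> D \<Longrightarrow> \<phi> p = \<psi> p) \<Longrightarrow> \<phi> = \<psi>"
  unfolding Emb_def by (intro extensionalityI[of _ D]) (auto simp: PiE_iff)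

text \<open>Connectedness in cut form; it hands \<open>card_extend\<close> the next vertex to place
  directly, without any mention of paths.\<close>

definition conn :: "'p set \<Rightarrow> bool" where
  "conn D \<longleftrightarrow> (\<forall>U\<subseteq>D. U \<noteq> {} \<longrightarrow> U \<noteq> D \<longrightarrow> (\<exists>x\<in>U. \<exists>y\<in>D - U. padj x y))"

lemma card_extend_one:
  assumes "p \<notin> D" "q \<in> D" "padj q p" "\<A> \<subseteq> Emb D" "finite D"
  shows "card {\<phi> \<in> Emb (insert p D). restrict \<phi> D \<in> \<A>} \<le> card \<A> * (K * d)"
proof -
  let ?X = "{\<phi> \<in> Emb (insert p D). restrict \<phi> D \<in> \<A>}"
  have finA: "finite \<A>"
    using finite_Emb[OF assms(5)] assms(4) finite_subset by blast
  let ?f = "\<lambda>\<phi>. (restrict \<phi> D, \<phi> p)"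
  let ?Y = "SIGMA \<psi>:\<A>. {w. adj (\<psi> q) w}"
  have "inj_on ?f ?X"
  proof (rule inj_onI)
    fix \<phi> \<psi> assume a: "\<phi> \<in> ?X" "\<psi> \<in> ?X" "?f \<phi> = ?f \<psi>"
    show "\<phi> = \<psi>"
    proof (rule Emb_eqI[of _ "insert p D"])
      fix r assume r: "r \<in> insert p D"
      have e: "restrict \<phi> D = restrict \<psi> D" "\<phi> p = \<psi> p"
        using a(3) by blast+
      show "\<phi> r = \<psi> r"
      proof (cases "r = p")
        case False
        then show ?thesis
          using r fun_cong[OF e(1), of r] by simp
      qed (use e in simp)
    qed (use a in blast)+
  qed
  moreover have "?f ` ?X \<subseteq> ?Y"
  proof
    fix z assume "z \<in> ?f ` ?X"
    then obtain \<phi> where \<phi>: "\<phi> \<in> Emb (insert p D)" "restrict \<phi> D \<in> \<A>" "z = ?f \<phi>"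
      by blast
    have "adj (\<phi> q) (\<phi> p)"
      using \<phi>(1) assms(2,3) by (intro Emb_adj[of \<phi> "insert p D"]) auto
    then show "z \<in> ?Y"
      using \<phi> assms(2) by simp
  qed
  moreover have "finite ?Y"
    using finA fin_nb by auto
  ultimately have "card ?X \<le> card ?Y"
    by (rule card_inj_on_le)
  also have "card ?Y = (\<Sum>\<psi>\<in>\<A>. card {w. adj (\<psi> q) w})"
    using finA fin_nb by simp
  also have "\<dots> \<le> (\<Sum>\<psi>\<in>\<A>. K * d)"
  proof (intro sum_mono deg_le)
    fix \<psi> assume "\<psi> \<in> \<A>"
    then show "\<psi> q \<in> V"
      using assms(2,4) by (intro Emb_V[of \<psi> D]) auto
  qed
  finally show ?thesis by simp
qed

text \<open>Connectedness always offers a vertex adjacent to the part already placed, and its image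
  is one of at most \<open>K * d\<close> neighbours. Further pattern edges can only lower the count,
  so the bound is not restricted to trees.\<close>

lemma card_extend:
  assumes "finite D'" "conn D'" "D \<subseteq> D'" "D \<noteq> {}" "\<A> \<subseteq> Emb D"
  shows "card {\<phi> \<in> Emb D'. restrict \<phi> D \<in> \<A>} \<le> card \<A> * (K * d) ^ (card D' - card D)"
  using assms(3-)
proof (induction "card D' - card D" arbitrary: D \<A>)
  case 0
  then have "D = D'"
    using assms(1) by (metis card_seteq diff_is_0_eq)
  moreover have "{\<phi> \<in> Emb D'. restrict \<phi> D' \<in> \<A>} \<subseteq> \<A>"
    using Emb_ext by fastforce
  moreover have "finite \<A>"
    using 0(4) finite_Emb finite_subset assms(1) calculation(1) by blast
  ultimately show ?case
    using card_mono[of \<A> "{\<phi> \<in> Emb D'. restrict \<phi> D' \<in> \<A>}"] by (simp del: restrict_apply)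
next
  case (Suc m)
  have finD: "finite D"
    using Suc(3) assms(1) finite_subset by blast
  have "D \<noteq> D'"
    using Suc(2) by auto
  then obtain q p where qp: "q \<in> D" "p \<in> D' - D" "padj q p"
    using assms(2) Suc(3,4) unfolding conn_def by blast
  define \<A>1 where "\<A>1 = {\<phi> \<in> Emb (insert p D). restrict \<phi> D \<in> \<A>}"
  have c: "card (insert p D) = Suc (card D)"
    using qp finD by simp
  have A1: "card \<A>1 \<le> card \<A> * (K * d)"
    unfolding \<A>1_def using qp finD Suc(5) by (intro card_extend_one[of p D q]) auto
  have IH: "card {\<phi> \<in> Emb D'. restrict \<phi> (insert p D) \<in> \<A>1} \<le> card \<A>1 * (K * d) ^ (card D' - card (insert p D))"
    using Suc(2,3) qp c by (intro Suc(1)) (auto simp: \<A>1_def)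
  have "{\<phi> \<in> Emb D'. restrict \<phi> D \<in> \<A>} \<subseteq> {\<phi> \<in> Emb D'. restrict \<phi> (insert p D) \<in> \<A>1}"
    unfolding \<A>1_def using qp Suc(3) by (auto intro!: Emb_restrict simp: Int_absorb1 Int_absorb2 subset_insertI)
  then have "card {\<phi> \<in> Emb D'. restrict \<phi> D \<in> \<A>} \<le> card {\<phi> \<in> Emb D'. restrict \<phi> (insert p D) \<in> \<A>1}"
    using finite_Emb[OF assms(1)] by (intro card_mono) auto
  also have "\<dots> \<le> card \<A>1 * (K * d) ^ (card D' - card (insert p D))"
    by (rule IH)
  also have "\<dots> \<le> (card \<A> * (K * d)) * (K * d) ^ (card D' - card (insert p D))"
    using A1 by simp
  also have "\<dots> = card \<A> * (K * d) ^ (card D' - card D)"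
  proof -
    have e: "card D' - card D = Suc (card D' - card (insert p D))"
      using Suc(2) c by simp
    show ?thesis
      unfolding e by (simp add: mult.assoc)
  qed
  finally show ?case .
qed

lemma card_rooted:
  assumes "finite D" "conn D" "r \<in> D"
  shows "card {\<phi> \<in> Emb D. \<phi> r = z} \<le> (K * d) ^ (card D - 1)"
proof -
  let ?A = "{\<psi> \<in> Emb {r}. \<psi> r = z}"
  have "?A \<subseteq> {restrict (\<lambda>_. z) {r}}"
    by (auto simp: Emb_def PiE_iff extensional_def fun_eq_iff restrict_def)
  then have "card ?A \<le> 1"
    using card_mono[of "{restrict (\<lambda>_. z) {r}}" ?A] by simp
  have "{\<phi> \<in> Emb D. \<phi> r = z} \<subseteq> {\<phi> \<in> Emb D. restrict \<phi> {r} \<in> ?A}"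
    using assms(3) by (auto intro!: Emb_restrict)
  then have "card {\<phi> \<in> Emb D. \<phi> r = z} \<le> card {\<phi> \<in> Emb D. restrict \<phi> {r} \<in> ?A}"
    using finite_Emb[OF assms(1)] by (intro card_mono) auto
  also have "\<dots> \<le> card ?A * (K * d) ^ (card D - card {r})"
    using assms by (intro card_extend) auto
  also have "\<dots> \<le> 1 * (K * d) ^ (card D - 1)"
    using mult_right_mono[OF \<open>card ?A \<le> 1\<close>, of "(K * d) ^ (card D - 1)"] by simp
  finally show ?thesis by simp
qed

lemma card_Emb_le:
  assumes "finite D" "conn D" "r \<in> D"
  shows "card (Emb D) \<le> card V * (K * d) ^ (card D - 1)"
proof -
  have "(\<Union>z\<in>V. {\<phi> \<in> Emb D. \<phi> r = z}) = Emb D"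
    using assms(3) Emb_V by blast
  then have "card (Emb D) \<le> (\<Sum>z\<in>V. card {\<phi> \<in> Emb D. \<phi> r = z})"
    using card_UN_le[OF finV, of "\<lambda>z. {\<phi> \<in> Emb D. \<phi> r = z}"] by simp
  also have "\<dots> \<le> (\<Sum>z\<in>V. (K * d) ^ (card D - 1))"
    using card_rooted[OF assms] by (intro sum_mono)
  finally show ?thesis by simp
qed

lemma conn_single: "conn {x}"
  by (auto simp: conn_def subset_singleton_iff)

lemma conn_insert:
  assumes "conn D" "q \<in> D" "padj q p"
  shows "conn (insert p D)"
proof (cases "p \<in> D")
  case False
  show ?thesis
    unfolding conn_def
  proof (intro allI impI)
    fix U assume U: "U \<subseteq> insert p D" "U \<noteq> {}" "U \<noteq> insert p D"
    show "\<exists>x\<in>U. \<exists>y\<in>insert p D - U. padj x y"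
    proof (cases "U \<inter> D = {} \<or> U \<inter> D = D")
      case True
      then show ?thesis
        using U assms(2,3) padj_sym by blast
    next
      case F: False
      then have "\<exists>x\<in>U \<inter> D. \<exists>y\<in>D - (U \<inter> D). padj x y"
        using assms(1) unfolding conn_def by blast
      then show ?thesis by blast
    qed
  qed
qed (use assms in \<open>simp add: insert_absorb\<close>)

lemma conn_UN:
  assumes "\<And>i. i \<in> I \<Longrightarrow> conn (A i)" "\<And>i. i \<in> I \<Longrightarrow> c \<in> A i"
  shows "conn (\<Union>i\<in>I. A i)"
  unfolding conn_def
proof (intro allI impI)
  fix U assume U: "U \<subseteq> (\<Union>i\<in>I. A i)" "U \<noteq> {}" "U \<noteq> (\<Union>i\<in>I. A i)"
  have "\<exists>i\<in>I. U \<inter> A i \<noteq> {} \<and> U \<inter> A i \<noteq> A i"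
  proof (rule ccontr)
    assume "\<not> ?thesis"
    then have all: "U \<inter> A i = {} \<or> A i \<subseteq> U" if "i \<in> I" for i
      using that by blast
    obtain x i where "x \<in> U" "i \<in> I" "x \<in> A i"
      using U by blast
    then have "c \<in> U"
      using all[of i] assms(2) by blast
    then have "A j \<subseteq> U" if "j \<in> I" for j
      using all[OF that] assms(2)[OF that] by blast
    then show False
      using U by blast
  qed
  then obtain i where "i \<in> I" "U \<inter> A i \<noteq> {}" "U \<inter> A i \<noteq> A i" by blast
  then have "\<exists>x\<in>U \<inter> A i. \<exists>y\<in>A i - (U \<inter> A i). padj x y"
    using assms(1) unfolding conn_def by blast
  then show "\<exists>x\<in>U. \<exists>y\<in>(\<Union>i\<in>I. A i) - U. padj x y"
    using \<open>i \<in> I\<close> by blast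
qed

end

section \<open>Rich leaf tuples\<close>

text \<open>
  \<open>Fam\<close> holds pairs of a piece and its leaf set. \<open>L\<close> gives the number of disjoint embeddings demanded
  of a rich leaf tuple and \<open>F\<close> bounds the number of embeddings without rich pieces, both as
  functions of the size of the piece; the last assumption is the recursion that arises from
  cutting pieces at an inner vertex, as described by \<open>fam_split\<close>.
\<close>

locale host_family = host_pattern V adj d K padj
  for V :: "'a set" and adj :: "'a \<Rightarrow> 'a \<Rightarrow> bool" and d K :: nat and padj :: "'p \<Rightarrow> 'p \<Rightarrow> bool" +
  fixes S :: "'p set" and Fam :: "('p set \<times> 'p set) set" and L F :: "nat \<Rightarrow> nat"
  assumes finS: "finite S" and conn_S: "conn S"
    and fam_sub: "(D, B) \<in> Fam \<Longrightarrow> B \<subseteq> D \<and> D \<subseteq> S \<and> D - B \<noteq> {}"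
    and fam_split: "(D, B) \<in> Fam \<Longrightarrow> p \<in> D - B \<Longrightarrow>
      \<exists>C\<subseteq>Fam. D \<subseteq> insert p B \<union> \<Union>(fst ` C) \<and> (\<forall>(D', B')\<in>C. D' \<subset> D \<and> B' \<subseteq> insert p B)"
    and fam_leaf: "(D, B) \<in> Fam \<Longrightarrow> a \<in> B \<Longrightarrow> \<exists>a'\<in>D - B. padj a a'"
    and fam_conn: "(D, B) \<in> Fam \<Longrightarrow> a \<in> B \<Longrightarrow> conn (D - {a})"
    and F_pos: "1 \<le> F m" and F_mono: "mono F"
    and F_rec: "1 \<le> m \<Longrightarrow> L m * card S * card S * F (m - 1) ^ card Fam \<le> F m"
begin

lemma fin_fam: "finite Fam"
proof (rule finite_subset)
  show "Fam \<subseteq> Pow S \<times> Pow S"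
    using fam_sub by fast
qed (use finS in simp)

lemma fam_fin: "(D, B) \<in> Fam \<Longrightarrow> finite D"
  using fam_sub finS finite_subset by metis

text \<open>The witnesses avoid smaller rich pieces, hence the recursion on the piece. Infinite
  \<open>D\<close> is sent to \<open>False\<close> so that \<open>card D\<close> is a valid
  termination measure.\<close>

function rich :: "'p set \<Rightarrow> 'p set \<Rightarrow> ('p \<Rightarrow> 'a) \<Rightarrow> bool" where
  "rich D B x = (if infinite D then False else
     (\<exists>\<Phi>. finite \<Phi> \<and> card \<Phi> = L (card D) \<and>
       (\<forall>\<phi>\<in>\<Phi>. \<phi> \<in> Emb D \<and> (\<forall>b\<in>B. \<phi> b = x b) \<and>
          (\<forall>D' B'. (D', B') \<in> Fam \<longrightarrow> D' \<subset> D \<longrightarrow> \<not> rich D' B' \<phi>)) \<and>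
       (\<forall>\<phi>\<in>\<Phi>. \<forall>\<psi>\<in>\<Phi>. \<phi> \<noteq> \<psi> \<longrightarrow> \<phi> ` (D - B) \<inter> \<psi> ` (D - B) = {})))"
  by pat_completeness auto
termination
  by (relation "measure (\<lambda>(D, B, x). card D)") (auto intro: psubset_card_mono)

declare rich.simps [simp del]

definition Adm :: "'p set \<Rightarrow> ('p \<Rightarrow> 'a) set" where
  "Adm D = {\<phi> \<in> Emb D. \<forall>D' B'. (D', B') \<in> Fam \<longrightarrow> D' \<subset> D \<longrightarrow> \<not> rich D' B' \<phi>}"

definition Good :: "'p set \<Rightarrow> ('p \<Rightarrow> 'a) set" where
  "Good D = {\<phi> \<in> Emb D. \<forall>D' B'. (D', B') \<in> Fam \<longrightarrow> D' \<subseteq> D \<longrightarrow> \<not> rich D' B' \<phi>}"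

text \<open>Embeddings for which \<open>(D, B)\<close> is a minimal rich piece. Minimality keeps the
  counting bound of \<open>card_Adm_through\<close> available for them.\<close>

definition bad :: "'p set \<Rightarrow> 'p set \<Rightarrow> ('p \<Rightarrow> 'a) set" where
  "bad D B = {\<phi> \<in> Adm D. rich D B \<phi>}"

lemma Adm_Emb: "\<phi> \<in> Adm D \<Longrightarrow> \<phi> \<in> Emb D"
  by (simp add: Adm_def)

lemma Good_Adm: "Good D \<subseteq> Adm D"
  unfolding Good_def Adm_def by blast

lemma bad_Adm: "bad D B \<subseteq> Adm D"
  by (auto simp: bad_def)

lemma finite_Adm: "finite D \<Longrightarrow> finite (Adm D)"
  using finite_Emb by (auto simp: Adm_def)

lemma rich_iff:
  assumes "finite D"
  shows "rich D B x \<longleftrightarrow> (\<exists>\<Phi>. finite \<Phi> \<and> card \<Phi> = L (card D) \<and> \<Phi> \<subseteq> {\<phi> \<in> Adm D. \<forall>b\<in>B. \<phi> b = x b} \<and>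
       (\<forall>\<phi>\<in>\<Phi>. \<forall>\<psi>\<in>\<Phi>. \<phi> \<noteq> \<psi> \<longrightarrow> \<phi> ` (D - B) \<inter> \<psi> ` (D - B) = {}))"
proof -
  have eq: "(\<forall>\<phi>\<in>\<Phi>. \<phi> \<in> Emb D \<and> (\<forall>b\<in>B. \<phi> b = x b) \<and>
      (\<forall>D' B'. (D', B') \<in> Fam \<longrightarrow> D' \<subset> D \<longrightarrow> \<not> rich D' B' \<phi>)) \<longleftrightarrow>
      \<Phi> \<subseteq> {\<phi> \<in> Adm D. \<forall>b\<in>B. \<phi> b = x b}" for \<Phi>
    unfolding Adm_def subset_eq mem_Collect_eq by (intro ball_cong refl) (simp only: conj_ac)
  show ?thesis
    unfolding rich.simps[of D B x] eq using assms by simp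
qed

lemma rich_cong:
  assumes "\<And>b. b \<in> B \<Longrightarrow> x b = y b"
  shows "rich D B x = rich D B y"
  unfolding rich.simps[of D B x] rich.simps[of D B y] using assms by (simp cong: ball_cong)

lemma rich_restrict:
  assumes "(D', B') \<in> Fam" "D' \<subseteq> D"
  shows "rich D' B' (restrict \<phi> D) = rich D' B' \<phi>"
  using fam_sub[OF assms(1)] assms(2) by (intro rich_cong) auto

lemma Adm_restrict_Good:
  assumes "\<phi> \<in> Adm D" "D' \<subset> D"
  shows "restrict \<phi> D' \<in> Good D'"
  unfolding Good_def
proof (intro CollectI conjI allI impI)
  show "restrict \<phi> D' \<in> Emb D'"
    using assms Adm_Emb Emb_restrict by blast
next
  fix D'' B'' assume a: "(D'', B'') \<in> Fam" "D'' \<subseteq> D'"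
  then have "\<not> rich D'' B'' \<phi>"
    using assms unfolding Adm_def by blast
  then show "\<not> rich D'' B'' (restrict \<phi> D')"
    using rich_restrict a by simp
qed

text \<open>Fixing the image of an inner vertex makes it one more prescribed leaf, and
  \<open>fam_split\<close> then covers \<open>D\<close> by strictly smaller pieces all of whose
  leaves are prescribed. An admissible embedding restricts to good ones there and is determined by
  these restrictions, so the count is at most a product of smaller bounds. The bounds appear as a
  hypothesis because they are the induction hypothesis of \<open>card_Good_le\<close>.\<close>

lemma card_Adm_through_aux:
  assumes fam: "(D, B) \<in> Fam" and p: "p \<in> D - B"
    and IH: "\<And>D' B' y. (D', B') \<in> Fam \<Longrightarrow> D' \<subset> D \<Longrightarrow>
      card {\<psi> \<in> Good D'. \<forall>b\<in>B'. \<psi> b = y b} \<le> F (card D')"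
  shows "card {\<phi> \<in> Adm D. (\<forall>b\<in>B. \<phi> b = x b) \<and> \<phi> p = z} \<le> F (card D - 1) ^ card Fam"
proof -
  obtain C where C: "C \<subseteq> Fam" "D \<subseteq> insert p B \<union> \<Union>(fst ` C)"
    "\<And>D' B'. (D', B') \<in> C \<Longrightarrow> D' \<subset> D \<and> B' \<subseteq> insert p B"
    using fam_split[OF fam p] by (metis (no_types, lifting) case_prodD)
  have finD: "finite D" and finC: "finite C"
    using fam fam_fin C(1) fin_fam finite_subset by blast+
  define y where "y = x(p := z)"
  let ?X = "{\<phi> \<in> Adm D. (\<forall>b\<in>B. \<phi> b = x b) \<and> \<phi> p = z}"
  let ?f = "\<lambda>\<phi>. \<lambda>c\<in>C. restrict \<phi> (fst c)"
  let ?T = "\<lambda>c. {\<psi> \<in> Good (fst c). \<forall>b\<in>snd c. \<psi> b = y b}"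
  have inj: "inj_on ?f ?X"
  proof (rule inj_onI)
    fix \<phi> \<psi> assume a: "\<phi> \<in> ?X" "\<psi> \<in> ?X" "?f \<phi> = ?f \<psi>"
    show "\<phi> = \<psi>"
    proof (rule Emb_eqI[of _ D])
      fix r assume r: "r \<in> D"
      consider "r = p" | "r \<in> B" | c where "c \<in> C" "r \<in> fst c"
        using C(2) r by blast
      then show "\<phi> r = \<psi> r"
      proof cases
        case 3
        then have "restrict \<phi> (fst c) = restrict \<psi> (fst c)"
          using fun_cong[OF a(3), of c] by simp
        from fun_cong[OF this, of r] 3 show ?thesis by simp
      qed (use a(1,2) in auto)
    qed (use a Adm_Emb in blast)+
  qed
  have "?f ` ?X \<subseteq> Pi\<^sub>E C ?T"
  proof (intro image_subsetI PiE_I)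
    fix \<phi> c assume \<phi>: "\<phi> \<in> ?X" and c: "c \<in> C"
    obtain D' B' where c': "c = (D', B')" by (cases c)
    have sub: "D' \<subset> D" "B' \<subseteq> insert p B" "B' \<subseteq> D'"
      using C c c' fam_sub[of D' B'] by blast+
    have "restrict \<phi> D' \<in> Good D'"
      using \<phi> sub Adm_restrict_Good by blast
    moreover have "\<forall>b\<in>B'. restrict \<phi> D' b = y b"
      using sub \<phi> by (auto simp: y_def)
    ultimately show "?f \<phi> c \<in> ?T c"
      using c c' by simp
  qed auto
  moreover have "finite (Pi\<^sub>E C ?T)"
  proof (intro finite_PiE finC)
    fix c assume "c \<in> C"
    then have "finite (fst c)"
      using C(1) fam_fin by (metis prod.collapse subsetD)
    then show "finite (?T c)"
      using finite_Adm Good_Adm finite_subset by (metis (no_types, lifting) mem_Collect_eq subsetI)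
  qed
  ultimately have "card ?X \<le> card (Pi\<^sub>E C ?T)"
    using inj by (intro card_inj_on_le)
  also have "\<dots> = (\<Prod>c\<in>C. card (?T c))"
    using finC by (rule card_PiE)
  also have "\<dots> \<le> (\<Prod>c\<in>C. F (card D - 1))"
  proof (intro prod_mono conjI)
    fix c assume c: "c \<in> C"
    obtain D' B' where c': "c = (D', B')" by (cases c)
    have sub: "(D', B') \<in> Fam" "D' \<subset> D"
      using C c c' by blast+
    have "card (?T c) \<le> F (card D')"
      using IH[OF sub, of y] c' by simp
    also have "\<dots> \<le> F (card D - 1)"
      using psubset_card_mono[OF finD sub(2)] by (intro monoD[OF F_mono]) simp
    finally show "card (?T c) \<le> F (card D - 1)" .
  qed simp
  also have "\<dots> = F (card D - 1) ^ card C"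
    by simp
  also have "\<dots> \<le> F (card D - 1) ^ card Fam"
    using C(1) fin_fam F_pos by (intro power_increasing card_mono)
  finally show ?thesis .
qed

text \<open>If the leaf tuple is rich there is nothing to count. Otherwise a maximal family with
  disjoint interiors has at most \<open>L (card D)\<close> members, and by maximality its interiors
  meet the interior of every embedding. The inner vertex and the point at which they meet can be
  chosen in boundedly many ways, each handled by \<open>card_Adm_through_aux\<close>;
  \<open>F_rec\<close> is exactly the resulting recursion.\<close>

lemma card_Good_le:
  assumes "(D, B) \<in> Fam"
  shows "card {\<phi> \<in> Good D. \<forall>b\<in>B. \<phi> b = x b} \<le> F (card D)"
  using assms
proof (induction "card D" arbitrary: D B x rule: less_induct)
  case less
  note fam = less.prems
  have finD: "finite D"
    using fam fam_fin by blast
  have DS: "card D \<le> card S"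
    using fam_sub[OF fam] finS card_mono by blast
  have through: "card {\<phi> \<in> Adm D. (\<forall>b\<in>B. \<phi> b = x b) \<and> \<phi> p = z} \<le> F (card D - 1) ^ card Fam"
    if "p \<in> D - B" for p z
    using less.hyps psubset_card_mono[OF finD] that by (intro card_Adm_through_aux[OF fam]) auto
  define A where "A = {\<phi> \<in> Adm D. \<forall>b\<in>B. \<phi> b = x b}"
  have finA: "finite A"
    using finite_Adm[OF finD] by (simp add: A_def)
  let ?disj = "\<lambda>\<Phi>. \<forall>\<phi>\<in>\<Phi>. \<forall>\<psi>\<in>\<Phi>. \<phi> \<noteq> \<psi> \<longrightarrow> \<phi> ` (D - B) \<inter> \<psi> ` (D - B) = {}"
  define \<F> where "\<F> = {\<Phi>. \<Phi> \<subseteq> A \<and> ?disj \<Phi>}"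
  show ?case
  proof (cases "rich D B x")
    case True
    have e: "{\<phi> \<in> Good D. \<forall>b\<in>B. \<phi> b = x b} = {}"
    proof (rule ccontr)
      assume "\<not> ?thesis"
      then obtain \<phi> where "\<phi> \<in> Good D" "\<And>b. b \<in> B \<Longrightarrow> \<phi> b = x b" by blast
      then have "\<not> rich D B \<phi>" "rich D B \<phi>"
        using fam True rich_cong[of B \<phi> x D] unfolding Good_def by blast+
      then show False by simp
    qed
    show ?thesis unfolding e by simp
  next
    case False
    have "finite \<F>" "{} \<in> \<F>"
      using finA by (auto simp: \<F>_def)
    then obtain \<Phi> where \<Phi>: "\<Phi> \<in> \<F>" and mx: "\<And>\<Phi>'. \<Phi>' \<in> \<F> \<Longrightarrow> \<Phi> \<subseteq> \<Phi>' \<Longrightarrow> \<Phi> = \<Phi>'"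
      using finite_has_maximal2 by metis
    have fin\<Phi>: "finite \<Phi>"
      using \<Phi> finA finite_subset unfolding \<F>_def by blast
    have c\<Phi>: "card \<Phi> \<le> L (card D)"
    proof (rule ccontr)
      assume "\<not> ?thesis"
      then obtain \<Phi>' where "\<Phi>' \<subseteq> \<Phi>" "card \<Phi>' = L (card D)" "finite \<Phi>'"
        using obtain_subset_with_card_n[of "L (card D)" \<Phi>] by (metis nat_le_linear)
      moreover have "\<Phi> \<subseteq> {\<phi> \<in> Adm D. \<forall>b\<in>B. \<phi> b = x b}" "?disj \<Phi>"
        using \<Phi> unfolding \<F>_def A_def by simp_all
      ultimately have "rich D B x"
        unfolding rich_iff[OF finD] by (intro exI[of _ \<Phi>'] conjI) (assumption | blast)+
      then show False using False by simp
    qed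
    define W where "W = (\<Union>\<psi>\<in>\<Phi>. \<psi> ` (D - B))"
    have finW: "finite W"
      using fin\<Phi> finD by (auto simp: W_def)
    have cW: "card W \<le> L (card D) * card S"
    proof -
      have "card W \<le> (\<Sum>\<psi>\<in>\<Phi>. card (\<psi> ` (D - B)))"
        unfolding W_def by (rule card_UN_le[OF fin\<Phi>])
      also have "\<dots> \<le> (\<Sum>\<psi>\<in>\<Phi>. card S)"
      proof (rule sum_mono)
        fix \<psi>
        have "card (\<psi> ` (D - B)) \<le> card (D - B)"
          using finD by (intro card_image_le) auto
        also have "\<dots> \<le> card D"
          using finD by (intro card_mono) auto
        finally show "card (\<psi> ` (D - B)) \<le> card S"
          using DS by simp
      qed
      finally show ?thesis
        using c\<Phi> by (simp add: order_trans)
    qed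
    have "{\<phi> \<in> Good D. \<forall>b\<in>B. \<phi> b = x b} \<subseteq> 
      (\<Union>(p, z)\<in>(D - B) \<times> W. {\<phi> \<in> Adm D. (\<forall>b\<in>B. \<phi> b = x b) \<and> \<phi> p = z})"
    proof
      fix \<phi> assume "\<phi> \<in> {\<phi> \<in> Good D. \<forall>b\<in>B. \<phi> b = x b}"
      then have \<phi>: "\<phi> \<in> A"
        using Good_Adm unfolding A_def by blast
      have "\<phi> ` (D - B) \<inter> W \<noteq> {}"
      proof (cases "\<phi> \<in> \<Phi>")
        case True
        then show ?thesis
          using fam_sub[OF fam] unfolding W_def by blast
      next
        case F: False
        show ?thesis
        proof
          assume e: "\<phi> ` (D - B) \<inter> W = {}"
          have "insert \<phi> \<Phi> \<in> \<F>"
            unfolding \<F>_def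
          proof (intro CollectI conjI ballI impI)
            show "insert \<phi> \<Phi> \<subseteq> A"
              using \<phi> \<Phi> unfolding \<F>_def by blast
          next
            fix \<alpha> \<beta> assume "\<alpha> \<in> insert \<phi> \<Phi>" "\<beta> \<in> insert \<phi> \<Phi>" "\<alpha> \<noteq> \<beta>"
            then consider "\<alpha> \<in> \<Phi>" "\<beta> \<in> \<Phi>" | "\<alpha> = \<phi>" "\<beta> \<in> \<Phi>" | "\<beta> = \<phi>" "\<alpha> \<in> \<Phi>"
              by blast
            then show "\<alpha> ` (D - B) \<inter> \<beta> ` (D - B) = {}"
            proof cases
              case 1
              then show ?thesis
                using \<Phi> \<open>\<alpha> \<noteq> \<beta>\<close> unfolding \<F>_def by blast
            next
              case 2
              then have "\<beta> ` (D - B) \<subseteq> W" by (auto simp: W_def)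
              then show ?thesis using e 2 by blast
            next
              case 3
              then have "\<alpha> ` (D - B) \<subseteq> W" by (auto simp: W_def)
              then show ?thesis using e 3 by blast
            qed
          qed
          from mx[OF this] F show False by blast
        qed
      qed
      then obtain p where "p \<in> D - B" "\<phi> p \<in> W" by blast
      then show "\<phi> \<in> (\<Union>(p, z)\<in>(D - B) \<times> W. {\<phi> \<in> Adm D. (\<forall>b\<in>B. \<phi> b = x b) \<and> \<phi> p = z})"
        using \<phi> unfolding A_def by (intro UN_I[of "(p, \<phi> p)"]) auto
    qed
    then have "card {\<phi> \<in> Good D. \<forall>b\<in>B. \<phi> b = x b} \<le>
        card (\<Union>(p, z)\<in>(D - B) \<times> W. {\<phi> \<in> Adm D. (\<forall>b\<in>B. \<phi> b = x b) \<and> \<phi> p = z})"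
      using finD finW finite_Adm[OF finD] by (intro card_mono) auto
    also have "\<dots> \<le> (\<Sum>(p, z)\<in>(D - B) \<times> W. card {\<phi> \<in> Adm D. (\<forall>b\<in>B. \<phi> b = x b) \<and> \<phi> p = z})"
      using finD finW card_UN_le[of "(D - B) \<times> W" "\<lambda>(p, z). {\<phi> \<in> Adm D. (\<forall>b\<in>B. \<phi> b = x b) \<and> \<phi> p = z}"]
      by (simp add: case_prod_beta')
    also have "\<dots> \<le> (\<Sum>(p, z)\<in>(D - B) \<times> W. F (card D - 1) ^ card Fam)"
      using through by (intro sum_mono) auto
    also have "\<dots> = card (D - B) * card W * F (card D - 1) ^ card Fam"
      by (simp add: case_prod_beta' card_cartesian_product)
    also have "\<dots> \<le> card S * (L (card D) * card S) * F (card D - 1) ^ card Fam"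
    proof (intro mult_right_mono mult_mono cW)
      show "card (D - B) \<le> card S"
        using card_mono[OF finD, of "D - B"] DS by auto
    qed auto
    also have "\<dots> = L (card D) * card S * card S * F (card D - 1) ^ card Fam"
      by simp
    also have "\<dots> \<le> F (card D)"
    proof (rule F_rec)
      show "1 \<le> card D"
        using fam_sub[OF fam] finD by (metis Diff_empty One_nat_def Suc_leI card_gt_0_iff empty_Diff)
    qed
    finally show ?thesis .
  qed
qed

lemma card_Adm_through:
  assumes "(D, B) \<in> Fam" "p \<in> D - B"
  shows "card {\<phi> \<in> Adm D. (\<forall>b\<in>B. \<phi> b = x b) \<and> \<phi> p = z} \<le> F (card D - 1) ^ card Fam"
  using card_Adm_through_aux[OF assms] card_Good_le by blast

text \<open>The \<open>L (card D)\<close> interiors are disjoint, so if all of them met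
  \<open>Z\<close>, picking a common point for each would map the witnesses injectively into
  \<open>Z\<close>.\<close>

lemma rich_avoid:
  assumes "rich D B x" "finite Z" "card Z < L (card D)"
  obtains \<tau> where "\<tau> \<in> Adm D" "\<And>b. b \<in> B \<Longrightarrow> \<tau> b = x b" "\<tau> ` (D - B) \<inter> Z = {}"
proof -
  have finD: "finite D"
  proof (rule ccontr)
    assume "infinite D"
    then have "\<not> rich D B x"
      by (subst rich.simps) simp
    with assms(1) show False by simp
  qed
  from iffD1[OF rich_iff[OF finD] assms(1)] obtain \<Phi> where \<Phi>: "finite \<Phi>" "card \<Phi> = L (card D)"
    "\<Phi> \<subseteq> {\<phi> \<in> Adm D. \<forall>b\<in>B. \<phi> b = x b}"
    and dj: "\<forall>\<phi>\<in>\<Phi>. \<forall>\<psi>\<in>\<Phi>. \<phi> \<noteq> \<psi> \<longrightarrow> \<phi> ` (D - B) \<inter> \<psi> ` (D - B) = {}"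
    by (elim exE conjE)
  have "\<exists>\<tau>\<in>\<Phi>. \<tau> ` (D - B) \<inter> Z = {}"
  proof (rule ccontr)
    assume neg: "\<not> ?thesis"
    have "\<forall>\<tau>\<in>\<Phi>. \<exists>z. z \<in> \<tau> ` (D - B) \<inter> Z"
    proof
      fix \<tau> assume "\<tau> \<in> \<Phi>"
      with neg have "\<tau> ` (D - B) \<inter> Z \<noteq> {}" by simp
      then show "\<exists>z. z \<in> \<tau> ` (D - B) \<inter> Z" by (simp only: ex_in_conv simp_thms)
    qed
    from bchoice[OF this] obtain f where f: "\<forall>\<tau>\<in>\<Phi>. f \<tau> \<in> \<tau> ` (D - B) \<inter> Z" ..
    have "inj_on f \<Phi>"
    proof (rule inj_onI, rule ccontr)
      fix \<alpha> \<beta> assume a: "\<alpha> \<in> \<Phi>" "\<beta> \<in> \<Phi>" "f \<alpha> = f \<beta>" "\<alpha> \<noteq> \<beta>"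
      have "f \<alpha> \<in> \<alpha> ` (D - B)" "f \<alpha> \<in> \<beta> ` (D - B)"
        using bspec[OF f a(1)] bspec[OF f a(2)] a(3) by simp_all
      moreover have "\<alpha> ` (D - B) \<inter> \<beta> ` (D - B) = {}"
        using dj a by simp
      ultimately show False by blast
    qed
    moreover have "f ` \<Phi> \<subseteq> Z"
      using f by blast
    ultimately have "card \<Phi> \<le> card Z"
      using assms(2) by (rule card_inj_on_le)
    then show False
      using \<Phi>(2) assms(3) by simp
  qed
  then obtain \<tau> where \<tau>: "\<tau> \<in> \<Phi>" "\<tau> ` (D - B) \<inter> Z = {}" ..
  have "\<tau> \<in> Adm D" "\<And>b. b \<in> B \<Longrightarrow> \<tau> b = x b"
    using subsetD[OF \<Phi>(3) \<tau>(1)] by simp_all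
  then show ?thesis
    using \<tau>(2) by (rule that)
qed

end

section \<open>Cores of rich embeddings\<close>

context host_family
begin

text \<open>
  To move a leaf, the last condition supplies many vertices next to it in embeddings with the same
  leaves, and the middle one many new positions of the leaf next to the vertex chosen.
\<close>

definition core :: "'p set \<Rightarrow> 'p set \<Rightarrow> nat \<Rightarrow> ('p \<Rightarrow> 'a) set \<Rightarrow> bool" where
  "core D B h X \<longleftrightarrow> X \<subseteq> bad D B \<and> (\<forall>\<phi>\<in>X. \<forall>a\<in>B. h \<le> card {w. \<phi>(a := w) \<in> X}) \<and>
     (\<forall>\<phi>\<in>X. \<forall>p\<in>D - B. h \<le> card {\<psi> p |\<psi>. \<psi> \<in> X \<and> (\<forall>b\<in>B. \<psi> b = \<phi> b)})"

lemma fam_leaves: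
  assumes "(D, B) \<in> Fam"
  shows "finite B" "card B \<le> card S"
proof -
  have "B \<subseteq> S"
    using fam_sub[OF assms] by blast
  then show "finite B" "card B \<le> card S"
    using finS by (auto intro: finite_subset card_mono)
qed

text \<open>The embeddings witnessing richness are admissible with the same leaves, hence bad
  themselves: each leaf tuple that occurs at all occurs at least \<open>L (card D)\<close>
  times.\<close>

lemma card_bad_leaf_tuples:
  assumes "(D, B) \<in> Fam"
  shows "card ((\<lambda>\<phi>. restrict \<phi> B) ` bad D B) * L (card D) \<le> card (bad D B)"
proof -
  have finD: "finite D"
    using assms fam_fin by blast
  have fin: "finite (bad D B)"
    using finite_Adm[OF finD] bad_Adm finite_subset by blast
  have "L (card D) \<le> card {\<psi> \<in> bad D B. restrict \<psi> B = \<chi>}" if "\<chi> \<in> (\<lambda>\<phi>. restrict \<phi> B) ` bad D B" for \<chi>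
  proof -
    obtain \<phi> where \<phi>: "\<phi> \<in> bad D B" "\<chi> = restrict \<phi> B"
      using \<open>\<chi> \<in> _\<close> by blast
    then have "rich D B \<phi>"
      by (simp add: bad_def)
    then obtain \<Phi> where \<Phi>: "card \<Phi> = L (card D)" "\<Phi> \<subseteq> {\<psi> \<in> Adm D. \<forall>b\<in>B. \<psi> b = \<phi> b}"
      unfolding rich_iff[OF finD] by blast
    have "\<Phi> \<subseteq> {\<psi> \<in> bad D B. restrict \<psi> B = \<chi>}"
    proof
      fix \<psi> assume "\<psi> \<in> \<Phi>"
      then have \<psi>: "\<psi> \<in> Adm D" "\<And>b. b \<in> B \<Longrightarrow> \<psi> b = \<phi> b"
        using \<Phi>(2) by auto
      then have "rich D B \<psi>"
        using \<open>rich D B \<phi>\<close> rich_cong by metis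
      then show "\<psi> \<in> {\<psi> \<in> bad D B. restrict \<psi> B = \<chi>}"
        using \<psi> \<phi>(2) by (auto simp: bad_def)
    qed
    then have "card \<Phi> \<le> card {\<psi> \<in> bad D B. restrict \<psi> B = \<chi>}"
      using fin by (intro card_mono) auto
    then show ?thesis
      using \<Phi>(1) by simp
  qed
  then have "(\<Sum>\<chi>\<in>(\<lambda>\<phi>. restrict \<phi> B) ` bad D B. L (card D)) \<le>
      (\<Sum>\<chi>\<in>(\<lambda>\<phi>. restrict \<phi> B) ` bad D B. card {\<psi> \<in> bad D B. restrict \<psi> B = \<chi>})"
    by (rule sum_mono)
  also have "\<dots> = card (bad D B)"
    using sum.image_gen[OF fin, of "\<lambda>_. 1::nat" "\<lambda>\<phi>. restrict \<phi> B"] by simp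
  finally show ?thesis by simp
qed

text \<open>Deleting a leaf leaves a connected pattern with one vertex fewer. Against the order of
  \<open>n * d ^ (card D - 1)\<close> bad embeddings available in \<open>bad_core\<close> this saves
  a factor \<open>d\<close>, so thin fibres hold few of them.\<close>

lemma card_bad_fibres:
  assumes fam: "(D, B) \<in> Fam" and a: "a \<in> B"
  shows "card ((\<lambda>\<phi>. restrict \<phi> (D - {a})) ` bad D B) \<le> card V * (K * d) ^ (card D - 2)"
proof -
  have finD: "finite D"
    using fam fam_fin by blast
  obtain p where p: "p \<in> D - B"
    using fam_sub[OF fam] by blast
  have aD: "a \<in> D"
    using fam_sub[OF fam] a by blast
  have "(\<lambda>\<phi>. restrict \<phi> (D - {a})) ` bad D B \<subseteq> Emb (D - {a})"
    using bad_Adm Adm_Emb by (blast intro: Emb_restrict)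
  then have "card ((\<lambda>\<phi>. restrict \<phi> (D - {a})) ` bad D B) \<le> card (Emb (D - {a}))"
    using finite_Emb finD by (intro card_mono) auto
  also have "\<dots> \<le> card V * (K * d) ^ (card (D - {a}) - 1)"
    using finD fam_conn[OF fam a] p a by (intro card_Emb_le[of _ p]) auto
  also have "card (D - {a}) - 1 = card D - 2"
    using aD finD by (simp add: card_Diff_singleton)
  finally show ?thesis .
qed

text \<open>Two kinds of cells are cleaned: \<open>Inl\<close> cells consist of embeddings with the
  same leaves and get the threshold \<open>L (card D) / 4\<close>, \<open>Inr\<close> cells of
  embeddings that differ in one leaf only and get the threshold \<open>h\<close>. By
  \<open>card_bad_leaf_tuples\<close> and \<open>h1\<close> each kind costs at most a quarter of the
  bad embeddings.\<close>

lemma core_exists: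
  assumes fam: "(D, B) \<in> Fam"
    and h1: "4 * card S * h * (card V * (K * d) ^ (card D - 2)) \<le> card (bad D B)"
    and h2: "4 * h * F (card D - 1) ^ card Fam \<le> L (card D)"
  obtains X where "core D B h X" "card (bad D B) \<le> 2 * card X"
proof -
  have finD: "finite D"
    using fam fam_fin by blast
  have finB: "finite B" and cB: "card B \<le> card S"
    using fam_leaves[OF fam] by blast+
  have fin: "finite (bad D B)"
    using finite_Adm[OF finD] bad_Adm finite_subset by blast
  define R1 where "R1 = (\<lambda>\<phi>. restrict \<phi> B) ` bad D B"
  define R2 where "R2 = (SIGMA a:B. (\<lambda>\<phi>. restrict \<phi> (D - {a})) ` bad D B)"
  define c where "c = (\<lambda>i. case i of Inl \<chi> \<Rightarrow> {\<phi>. restrict \<phi> B = \<chi>}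
      | Inr (a, \<chi>) \<Rightarrow> {\<phi>::'p \<Rightarrow> 'a. restrict \<phi> (D - {a}) = \<chi>})"
  define \<tau> where "\<tau> = (\<lambda>i :: ('p \<Rightarrow> 'a) + ('p \<times> ('p \<Rightarrow> 'a)). case i of Inl _ \<Rightarrow> real (L (card D)) / 4 | Inr _ \<Rightarrow> real h)"
  have finR: "finite R1" "finite R2"
    using fin finB by (auto simp: R1_def R2_def)
  then have finI: "finite (Inl ` R1 \<union> Inr ` R2)"
    by simp
  have \<tau>0: "0 \<le> \<tau> i" for i
    by (simp add: \<tau>_def split: sum.splits)
  from clean_cells[OF fin finI, of \<tau> c, OF \<tau>0] obtain X where X1: "X \<subseteq> bad D B"
    and X2: "\<forall>i\<in>Inl ` R1 \<union> Inr ` R2. X \<inter> c i = {} \<or> \<tau> i \<le> real (card (X \<inter> c i))"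
    and X3: "real (card (bad D B)) \<le> real (card X) + (\<Sum>i\<in>Inl ` R1 \<union> Inr ` R2. \<tau> i)"
    by (elim exE conjE)
  note X = X1 bspec[OF X2] X3
  have finX: "finite X"
    using X(1) fin finite_subset by blast
  have "(\<Sum>i\<in>Inl ` R1 \<union> Inr ` R2. \<tau> i) = (\<Sum>i\<in>Inl ` R1. \<tau> i) + (\<Sum>i\<in>Inr ` R2. \<tau> i)"
    using finR by (intro sum.union_disjoint) auto
  also have "\<dots> = card R1 * (real (L (card D)) / 4) + card R2 * real h"
    by (simp add: sum.reindex \<tau>_def)
  also have "\<dots> \<le> card (bad D B) / 4 + card (bad D B) / 4"
  proof (rule add_mono)
    have "real (card R1 * L (card D)) \<le> real (card (bad D B))"
      using card_bad_leaf_tuples[OF fam] unfolding R1_def by (simp only: of_nat_le_iff)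
    then show "card R1 * (real (L (card D)) / 4) \<le> card (bad D B) / 4"
      by simp
    have "card R2 = (\<Sum>a\<in>B. card ((\<lambda>\<phi>. restrict \<phi> (D - {a})) ` bad D B))"
      unfolding R2_def using finB fin by (intro card_SigmaI) auto
    also have "\<dots> \<le> (\<Sum>a\<in>B. card V * (K * d) ^ (card D - 2))"
      using card_bad_fibres[OF fam] by (intro sum_mono)
    also have "\<dots> \<le> card S * (card V * (K * d) ^ (card D - 2))"
      using cB by simp
    finally have "4 * (card R2 * h) \<le> 4 * (card S * (card V * (K * d) ^ (card D - 2)) * h)"
      by simp
    also have "\<dots> = 4 * card S * h * (card V * (K * d) ^ (card D - 2))"
      by (simp add: mult_ac)
    also have "\<dots> \<le> card (bad D B)"
      by (rule h1)
    finally have "real (4 * (card R2 * h)) \<le> real (card (bad D B))"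
      by (simp only: of_nat_le_iff)
    then show "card R2 * real h \<le> card (bad D B) / 4"
      by simp
  qed
  finally have "real (card (bad D B)) \<le> 2 * real (card X)"
    using X(3) by simp
  then have big: "card (bad D B) \<le> 2 * card X"
    by linarith
  have "core D B h X"
    unfolding core_def
  proof (intro conjI ballI X(1))
    fix \<phi> a assume \<phi>: "\<phi> \<in> X" and a: "a \<in> B"
    let ?C = "X \<inter> {\<psi>. restrict \<psi> (D - {a}) = restrict \<phi> (D - {a})}"
    have "Inr (a, restrict \<phi> (D - {a})) \<in> Inl ` R1 \<union> Inr ` R2"
      using \<phi> a X(1) by (auto simp: R2_def)
    from X(2)[OF this] have "real h \<le> real (card ?C)"
      using \<phi> by (auto simp: c_def \<tau>_def)
    moreover have "card ?C \<le> card {w. \<phi>(a := w) \<in> X}"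
    proof (rule card_inj_on_le)
      have eq: "\<psi> = \<phi>(a := \<psi> a)" if "\<psi> \<in> ?C" for \<psi>
      proof
        fix r
        have E: "\<psi> \<in> Emb D" "\<phi> \<in> Emb D"
          using that \<phi> X(1) bad_Adm Adm_Emb by blast+
        show "\<psi> r = (\<phi>(a := \<psi> a)) r"
        proof (cases "r \<in> D")
          case True
          have e: "restrict \<psi> (D - {a}) r = restrict \<phi> (D - {a}) r"
            using that by simp
          then show ?thesis
            using True by (cases "r = a") auto
        next
          case False
          then show ?thesis
            using E fam_sub[OF fam] a by (auto simp: Emb_def PiE_iff extensional_def)
        qed
      qed
      show "(\<lambda>\<psi>. \<psi> a) ` ?C \<subseteq> {w. \<phi>(a := w) \<in> X}"
        using eq by force
      show "inj_on (\<lambda>\<psi>. \<psi> a) ?C"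
        using eq by (intro inj_onI) metis
      have "{w. \<phi>(a := w) \<in> X} \<subseteq> V"
      proof
        fix w assume "w \<in> {w. \<phi>(a := w) \<in> X}"
        then have "\<phi>(a := w) \<in> Emb D"
          using X(1) bad_Adm Adm_Emb by blast
        from Emb_V[OF this, of a] show "w \<in> V"
          using a fam_sub[OF fam] by auto
      qed
      then show "finite {w. \<phi>(a := w) \<in> X}"
        using finV finite_subset by blast
    qed
    ultimately show "h \<le> card {w. \<phi>(a := w) \<in> X}"
      by linarith
  next
    \<comment> \<open>Many embeddings with these leaves become many images of \<open>p\<close>: by
      \<open>card_Adm_through\<close> at most \<open>?F\<close> of them share an image, and
      \<open>h2\<close> makes the threshold \<open>L (card D) / 4\<close> at least
      \<open>h * ?F\<close>.\<close>
    fix \<phi> p assume \<phi>: "\<phi> \<in> X" and p: "p \<in> D - B"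
    let ?C = "X \<inter> {\<psi>. restrict \<psi> B = restrict \<phi> B}"
    let ?T = "{\<psi> p |\<psi>. \<psi> \<in> X \<and> (\<forall>b\<in>B. \<psi> b = \<phi> b)}"
    let ?F = "F (card D - 1) ^ card Fam"
    have finT: "finite ?T"
      using finX by simp
    have "Inl (restrict \<phi> B) \<in> Inl ` R1 \<union> Inr ` R2"
      using \<phi> X(1) by (auto simp: R1_def)
    from X(2)[OF this] have "real (L (card D)) / 4 \<le> real (card ?C)"
      using \<phi> by (auto simp: c_def \<tau>_def)
    then have LC: "L (card D) \<le> 4 * card ?C"
      by linarith
    have agree: "\<psi> b = \<phi> b" if "restrict \<psi> B = restrict \<phi> B" "b \<in> B" for \<psi> b
      using fun_cong[OF that(1), of b] that(2) by simp
    have "?C \<subseteq> (\<Union>z\<in>?T. {\<psi> \<in> Adm D. (\<forall>b\<in>B. \<psi> b = \<phi> b) \<and> \<psi> p = z})"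
    proof
      fix \<psi> assume \<psi>: "\<psi> \<in> ?C"
      have *: "\<psi> \<in> X" "\<forall>b\<in>B. \<psi> b = \<phi> b"
        using IntD1[OF \<psi>] agree[OF CollectD[OF IntD2[OF \<psi>]]] by blast+
      then have "\<psi> p \<in> ?T"
        by blast
      moreover have "\<psi> \<in> Adm D"
        using *(1) X(1) bad_Adm by blast
      ultimately show "\<psi> \<in> (\<Union>z\<in>?T. {\<psi> \<in> Adm D. (\<forall>b\<in>B. \<psi> b = \<phi> b) \<and> \<psi> p = z})"
        using *(2) by (intro UN_I[of "\<psi> p"]) (assumption, simp)
    qed
    then have "card ?C \<le> card (\<Union>z\<in>?T. {\<psi> \<in> Adm D. (\<forall>b\<in>B. \<psi> b = \<phi> b) \<and> \<psi> p = z})"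
      using finT finite_Adm[OF finD] by (intro card_mono) auto
    also have "\<dots> \<le> (\<Sum>z\<in>?T. card {\<psi> \<in> Adm D. (\<forall>b\<in>B. \<psi> b = \<phi> b) \<and> \<psi> p = z})"
      by (rule card_UN_le[OF finT])
    also have "\<dots> \<le> (\<Sum>z\<in>?T. ?F)"
      using card_Adm_through[OF fam p] by (intro sum_mono)
    finally have "card ?C \<le> card ?T * ?F"
      by simp
    then have "h * ?F \<le> card ?T * ?F"
      using LC h2 by linarith
    moreover have "0 < ?F"
      using F_pos[of "card D - 1"] by simp
    ultimately show "h \<le> card ?T"
      by (rule mult_right_le_imp_le)
  qed
  then show ?thesis
    using that big by blast
qed

lemma core_bad: "core D B h X \<Longrightarrow> \<phi> \<in> X \<Longrightarrow> \<phi> \<in> Emb D \<and> rich D B \<phi>"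
  unfolding core_def bad_def Adm_def by blast

lemma core_branch:
  assumes "core D B h X" "\<phi> \<in> X" "p \<in> D - B"
  shows "h \<le> card {\<psi> p |\<psi>. \<psi> \<in> X \<and> (\<forall>b\<in>B. \<psi> b = \<phi> b)}"
proof -
  have "\<forall>\<phi>\<in>X. \<forall>p\<in>D - B. h \<le> card {\<psi> p |\<psi>. \<psi> \<in> X \<and> (\<forall>b\<in>B. \<psi> b = \<phi> b)}"
    using assms(1) unfolding core_def by (elim conjE)
  from bspec[OF bspec[OF this assms(2)] assms(3)] show ?thesis .
qed

lemma exists_not_in:
  fixes A Z :: "'c set"
  assumes "finite Z" "card Z < card A"
  obtains w where "w \<in> A" "w \<notin> Z"
  using assms by (meson card_mono leD subsetI)

lemma core_vary:
  assumes "core D B h X" "\<phi> \<in> X" "a \<in> B" "finite Z" "card Z < h"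
  obtains w where "w \<notin> Z" "\<phi>(a := w) \<in> X"
proof -
  have "card Z < card {w. \<phi>(a := w) \<in> X}"
    using assms unfolding core_def by (meson less_le_trans)
  from exists_not_in[OF assms(4) this] that show ?thesis by blast
qed

text \<open>One zigzag of two edges. Changing the embedding while keeping all leaves makes the
  neighbour \<open>v\<close> of the leaf new; then the leaf alone is moved to another neighbour of
  \<open>v\<close>.\<close>

lemma core_step:
  assumes fam: "(D, B) \<in> Fam" and "core D B h X" "\<phi> \<in> X" "a \<in> B" "finite Z" "card Z < h"
  obtains v \<psi> where "\<psi> \<in> X" "\<And>b. b \<in> B - {a} \<Longrightarrow> \<psi> b = \<phi> b" "adj (\<phi> a) v" "adj v (\<psi> a)"
    "v \<notin> Z" "\<psi> a \<notin> Z"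
proof -
  obtain a' where a': "a' \<in> D - B" "padj a a'"
    using fam_leaf[OF fam assms(4)] by blast
  have aD: "a \<in> D"
    using fam_sub[OF fam] assms(4) by blast
  have "card Z < card {\<psi> a' |\<psi>. \<psi> \<in> X \<and> (\<forall>b\<in>B. \<psi> b = \<phi> b)}"
    using assms(6) core_branch[OF assms(2,3) a'(1)] by (rule less_le_trans)
  then obtain v where v: "v \<in> {\<psi> a' |\<psi>. \<psi> \<in> X \<and> (\<forall>b\<in>B. \<psi> b = \<phi> b)}" "v \<notin> Z"
    using exists_not_in[OF assms(5)] by blast
  then obtain \<psi> where "\<psi> \<in> X" "\<forall>b\<in>B. \<psi> b = \<phi> b" "\<psi> a' = v"
    by blast
  then have \<psi>: "\<psi> \<in> X" "\<And>b. b \<in> B \<Longrightarrow> \<psi> b = \<phi> b" "\<psi> a' \<notin> Z"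
    using v(2) by blast+
  obtain w where w: "w \<notin> Z" "\<psi>(a := w) \<in> X"
    using core_vary[OF assms(2) \<psi>(1) assms(4-6)] by blast
  have E: "\<psi> \<in> Emb D" "\<psi>(a := w) \<in> Emb D"
    using core_bad[OF assms(2)] \<psi> w by blast+
  have "a' \<noteq> a"
    using a' assms(4) by blast
  then have "adj (\<phi> a) (\<psi> a')" "adj w (\<psi> a')"
    using Emb_adj[OF E(1) aD, of a'] Emb_adj[OF E(2) aD, of a'] a' \<psi>(2)[OF assms(4)] by auto
  then show ?thesis
    using that[of "\<psi>(a := w)" "\<psi> a'"] w \<psi> adj_sym by auto
qed

definition walk :: "(nat \<Rightarrow> 'a) \<Rightarrow> nat \<Rightarrow> bool" where
  "walk q m \<longleftrightarrow> inj_on q {..m} \<and> (\<forall>j<m. adj (q j) (q (Suc j)))"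

text \<open>Zigzags are chained, each adding two edges and avoiding the walk so far; the summand
  \<open>2 * m\<close> in the budget pays for those vertices.\<close>

lemma core_walk:
  assumes fam: "(D, B) \<in> Fam" and co: "core D B h X" and "\<phi> \<in> X" and a: "a \<in> B" and Z: "finite Z"
    and "card Z + 2 * m < h"
  shows "\<exists>q \<psi>. \<psi> \<in> X \<and> (\<forall>b\<in>B - {a}. \<psi> b = \<phi> b) \<and> q 0 = \<phi> a \<and> q (2 * m) = \<psi> a \<and>
           walk q (2 * m) \<and> q ` {1..2 * m} \<inter> Z = {}"
  using assms(6)
proof (induction m)
  case 0
  then show ?case
    using assms(3) by (intro exI[of _ "\<lambda>_. \<phi> a"] exI[of _ \<phi>]) (auto simp: walk_def)
next
  case (Suc m)
  then obtain q \<psi> where q: "\<psi> \<in> X" "\<And>b. b \<in> B - {a} \<Longrightarrow> \<psi> b = \<phi> b" "q 0 = \<phi> a" "q (2 * m) = \<psi> a"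
    "walk q (2 * m)" "q ` {1..2 * m} \<inter> Z = {}"
    by auto
  have "card (Z \<union> q ` {..2 * m}) \<le> card Z + card {..2 * m}"
    using card_Un_le[of Z "q ` {..2 * m}"] card_image_le[of "{..2 * m}" q] by simp
  then have "card (Z \<union> q ` {..2 * m}) < h"
    using Suc.prems by simp
  moreover have finZ': "finite (Z \<union> q ` {..2 * m})"
    using Z by simp
  ultimately obtain v \<psi>' where s: "\<psi>' \<in> X" "\<And>b. b \<in> B - {a} \<Longrightarrow> \<psi>' b = \<psi> b" "adj (\<psi> a) v" "adj v (\<psi>' a)"
    "v \<notin> Z \<union> q ` {..2 * m}" "\<psi>' a \<notin> Z \<union> q ` {..2 * m}"
    using core_step[OF fam co q(1) a finZ'] by metis
  have vw: "v \<noteq> \<psi>' a"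
    using s(4) adj_irrefl by metis
  define q' where "q' = q(Suc (2 * m) := v, Suc (Suc (2 * m)) := \<psi>' a)"
  have old: "q' j = q j" if "j \<le> 2 * m" for j
    using that by (auto simp: q'_def)
  have new: "q' (Suc (2 * m)) = v" "q' (Suc (Suc (2 * m))) = \<psi>' a"
    by (auto simp: q'_def)
  have im: "q' ` {..2 * m} = q ` {..2 * m}" "q' ` {1..2 * m} = q ` {1..2 * m}"
    using old by (auto intro!: image_cong)
  have "inj_on q' {..2 * m}"
    using q(5) inj_on_cong[of "{..2 * m}" q' q] old unfolding walk_def by simp
  then have "inj_on q' {..Suc (Suc (2 * m))}"
    using s(5,6) vw new im by (simp add: atMost_Suc)
  moreover have "adj (q' j) (q' (Suc j))" if "j < Suc (Suc (2 * m))" for j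
  proof -
    consider "j < 2 * m" | "j = 2 * m" | "j = Suc (2 * m)"
      using \<open>j < _\<close> by linarith
    then show ?thesis
    proof cases
      case 1
      then show ?thesis
        using q(5) old[of j] old[of "Suc j"] unfolding walk_def by simp
    next
      case 2
      then show ?thesis
        using s(3) old[of j] q(4) new by simp
    next
      case 3
      then show ?thesis
        using s(4) new by simp
    qed
  qed
  moreover have "q' ` {1..Suc (Suc (2 * m))} \<inter> Z = {}"
  proof -
    have "{1..Suc (Suc (2 * m))} = insert (Suc (Suc (2 * m))) (insert (Suc (2 * m)) {1..2 * m})"
      by auto
    then show ?thesis
      using q(6) s(5,6) new im(2) by auto
  qed
  ultimately show ?case
    using s(1,2) q(2,3) old[of 0] new
    by (intro exI[of _ q'] exI[of _ \<psi>']) (auto simp: walk_def)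
qed

lemma disjoint_insert_subset:
  "P = insert x P' \<Longrightarrow> P' \<inter> Z = {} \<Longrightarrow> Q \<subseteq> Z \<Longrightarrow> x \<notin> Q \<Longrightarrow> P \<inter> Q = {}"
  by blast

lemma core_walks:
  fixes m :: "'p \<Rightarrow> nat"
  assumes fam: "(D, B) \<in> Fam" and co: "core D B h X" and \<phi>: "\<phi> \<in> X" and Z: "finite Z"
    and m: "\<forall>a\<in>B. 2 * m a \<le> k"
    and h: "card Z + card S * (k + 2) < h" and "A \<subseteq> B"
  shows "\<exists>\<psi>\<in>X. \<exists>q. (\<forall>b\<in>B - A. \<psi> b = \<phi> b) \<and>
    (\<forall>a\<in>A. q a 0 = \<phi> a \<and> q a (2 * m a) = \<psi> a \<and> walk (q a) (2 * m a) \<and> q a ` {1..2 * m a} \<inter> (Z \<union> \<phi> ` B) = {}) \<and>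
    (\<forall>a\<in>A. \<forall>a'\<in>A. a \<noteq> a' \<longrightarrow> q a ` {..2 * m a} \<inter> q a' ` {..2 * m a'} = {})"
proof -
  have finD: "finite D" and finB: "finite B" and cB: "card B \<le> card S" and BD: "B \<subseteq> D"
    using fam_leaves[OF fam] fam_fin[OF fam] fam_sub[OF fam] by blast+
  have E: "\<phi> \<in> Emb D"
    using core_bad[OF co \<phi>] by blast
  have "finite A"
    using finB assms(7) finite_subset by blast
  then show ?thesis
    using assms(7)
  proof (induction A)
    case empty
    then show ?case
      using \<phi> by auto
  next
    case (insert a A)
    have aB: "a \<in> B" and AB: "A \<subseteq> B"
      using insert.prems by auto
    from insert.IH[OF AB] obtain \<psi> q where q1: "\<psi> \<in> X" and q2: "\<forall>b\<in>B - A. \<psi> b = \<phi> b" and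
      q3: "\<forall>a\<in>A. q a 0 = \<phi> a \<and> q a (2 * m a) = \<psi> a \<and> walk (q a) (2 * m a) \<and> q a ` {1..2 * m a} \<inter> (Z \<union> \<phi> ` B) = {}"
      and q4: "\<forall>a\<in>A. \<forall>a'\<in>A. a \<noteq> a' \<longrightarrow> q a ` {..2 * m a} \<inter> q a' ` {..2 * m a'} = {}"
      by (elim bexE exE conjE)
    have q: "\<psi> \<in> X" "\<And>b. b \<in> B - A \<Longrightarrow> \<psi> b = \<phi> b"
      "\<And>a. a \<in> A \<Longrightarrow> q a 0 = \<phi> a" "\<And>a. a \<in> A \<Longrightarrow> q a (2 * m a) = \<psi> a" "\<And>a. a \<in> A \<Longrightarrow> walk (q a) (2 * m a)"
      "\<And>a. a \<in> A \<Longrightarrow> q a ` {1..2 * m a} \<inter> (Z \<union> \<phi> ` B) = {}"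
      "\<And>a a'. a \<in> A \<Longrightarrow> a' \<in> A \<Longrightarrow> a \<noteq> a' \<Longrightarrow> q a ` {..2 * m a} \<inter> q a' ` {..2 * m a'} = {}"
      using q1 q2 q3 q4 by blast+
    define Z' where "Z' = Z \<union> \<phi> ` B \<union> (\<Union>a\<in>A. q a ` {..2 * m a})"
    have finZ': "finite Z'"
      using Z finB insert.hyps by (auto simp: Z'_def)
    have "card (\<Union>a\<in>A. q a ` {..2 * m a}) \<le> (\<Sum>a\<in>A. card (q a ` {..2 * m a}))"
      using insert.hyps by (intro card_UN_le)
    also have "\<dots> \<le> (\<Sum>a\<in>A. k + 1)"
    proof (rule sum_mono)
      fix x assume "x \<in> A"
      then have "2 * m x \<le> k" using m AB by blast
      then show "card (q x ` {..2 * m x}) \<le> k + 1"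
        using card_image_le[of "{..2 * m x}" "q x"] by simp
    qed
    finally have c1: "card (\<Union>a\<in>A. q a ` {..2 * m a}) \<le> card A * (k + 1)"
      by simp
    have "Suc (card A) \<le> card B"
      using insert card_mono[OF finB insert.prems] by simp
    then have "(card A + 1) * (k + 1) \<le> card S * (k + 1)"
      using cB by (intro mult_right_mono) auto
    moreover have "card Z' \<le> card Z + card S + card A * (k + 1)"
    proof -
      have "card Z' \<le> card Z + card (\<phi> ` B) + card (\<Union>a\<in>A. q a ` {..2 * m a})"
        unfolding Z'_def by (meson card_Un_le add_right_mono order_trans)
      then show ?thesis
        using c1 card_image_le[OF finB, of \<phi>] cB by linarith
    qed
    moreover have "2 * m a \<le> k"
      using m aB by blast
    ultimately have "card Z' + 2 * m a < h"
      using h by (simp add: algebra_simps)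
    from core_walk[OF fam co q(1) aB finZ' this] obtain p \<psi>' where p1: "\<psi>' \<in> X"
      and p2: "\<forall>b\<in>B - {a}. \<psi>' b = \<psi> b" and p3: "p 0 = \<psi> a" "p (2 * m a) = \<psi>' a"
        "walk p (2 * m a)" "p ` {1..2 * m a} \<inter> Z' = {}"
      by (elim exE conjE)
    note p = p1 bspec[OF p2] p3
    have p0: "p 0 = \<phi> a"
      using p(3) q(2) aB insert.hyps by auto
    have dis: "p ` {..2 * m a} \<inter> q a' ` {..2 * m a'} = {}" if a': "a' \<in> A" for a'
    proof -
      have "\<phi> a \<notin> q a' ` {..2 * m a'}"
      proof
        assume "\<phi> a \<in> q a' ` {..2 * m a'}"
        then obtain j where j: "j \<le> 2 * m a'" "\<phi> a = q a' j" by auto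
        show False
        proof (cases "j = 0")
          case True
          then have "\<phi> a = \<phi> a'" using j q(3)[OF a'] by simp
          then have "a = a'"
            using Emb_inj[OF E] aB AB BD a' by blast
          then show False using insert.hyps a' by simp
        next
          case False
          then have "\<phi> a \<in> q a' ` {1..2 * m a'}" using j by auto
          then show False using q(6)[OF a'] aB by blast
        qed
      qed
      moreover have "p ` {..2 * m a} = insert (\<phi> a) (p ` {1..2 * m a})"
      proof -
        have "{..2 * m a} = insert 0 {1..2 * m a}" by auto
        then show ?thesis using p0 by simp
      qed
      moreover have "q a' ` {..2 * m a'} \<subseteq> Z'" using a' by (auto simp: Z'_def)
      ultimately show ?thesis
        using p(6) by (intro disjoint_insert_subset[of "p ` {..2 * m a}" "\<phi> a" "p ` {1..2 * m a}" Z'])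
    qed
    let ?q = "q(a := p)"
    have ne: "a' \<noteq> a" if "a' \<in> A" for a' using that insert.hyps by blast
    show ?case
    proof (intro bexI[of _ \<psi>'] exI[of _ ?q] conjI ballI impI)
      fix b assume "b \<in> B - insert a A"
      then show "\<psi>' b = \<phi> b" using p(2) q(2) by auto
    next
      fix a' assume "a' \<in> insert a A"
      then show "?q a' 0 = \<phi> a'" using p0 q(3) ne by auto
    next
      fix a' assume a': "a' \<in> insert a A"
      show "?q a' (2 * m a') = \<psi>' a'"
      proof (cases "a' = a")
        case False
        then have "a' \<in> A" "\<psi>' a' = \<psi> a'" using a' p(2) AB by auto
        then show ?thesis using False q(4) by simp
      qed (use p(4) in simp)
    next
      fix a' assume "a' \<in> insert a A"
      then show "walk (?q a') (2 * m a')" using p(5) q(5) ne by auto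
    next
      fix a' assume a': "a' \<in> insert a A"
      show "?q a' ` {1..2 * m a'} \<inter> (Z \<union> \<phi> ` B) = {}"
      proof (cases "a' = a")
        case True
        have "Z \<union> \<phi> ` B \<subseteq> Z'" unfolding Z'_def by (rule Un_upper1)
        then have "p ` {1..2 * m a} \<inter> (Z \<union> \<phi> ` B) = {}"
          using p(6) by (simp only: disjoint_iff subset_iff) metis
        then show ?thesis using True by simp
      next
        case False
        then show ?thesis using q(6)[of a'] a' by simp
      qed
    next
      fix a1 a2 assume "a1 \<in> insert a A" "a2 \<in> insert a A" "a1 \<noteq> a2"
      then consider "a1 = a" "a2 \<in> A" | "a2 = a" "a1 \<in> A" | "a1 \<in> A" "a2 \<in> A" by blast
      then show "?q a1 ` {..2 * m a1} \<inter> ?q a2 ` {..2 * m a2} = {}"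
      proof cases
        case 1
        then show ?thesis using dis[of a2] ne[of a2] by simp
      next
        case 2
        then show ?thesis using dis[of a1] ne[of a1] by (simp add: Int_commute)
      next
        case 3
        then show ?thesis using q(7)[OF 3 \<open>a1 \<noteq> a2\<close>] ne[of a1] ne[of a2] by simp
      qed
    qed (rule p(1))
  qed
qed

text \<open>After the walks the leaves are still those of a core embedding, hence rich, and
  \<open>rich_avoid\<close> supplies an interior that misses everything built so far. The core
  embeddings passed on the way serve to certify the leaves; the interior is fresh.\<close>

lemma core_realize:
  fixes m :: "'p \<Rightarrow> nat"
  assumes fam: "(D, B) \<in> Fam" and co: "core D B h X" and \<phi>: "\<phi> \<in> X" and Z: "finite Z"
    and m: "\<forall>a\<in>B. 2 * m a \<le> k"
    and h: "card Z + card S * (k + 2) < h" and hL: "h \<le> L (card D)"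
  shows "\<exists>\<tau> q. \<tau> \<in> Emb D \<and> (\<forall>a\<in>B. q a 0 = \<phi> a) \<and> (\<forall>a\<in>B. q a (2 * m a) = \<tau> a) \<and>
    (\<forall>a\<in>B. walk (q a) (2 * m a)) \<and> (\<forall>a\<in>B. q a ` {1..2 * m a} \<inter> (Z \<union> \<phi> ` B) = {}) \<and>
    (\<forall>a\<in>B. \<forall>a'\<in>B. a \<noteq> a' \<longrightarrow> q a ` {..2 * m a} \<inter> q a' ` {..2 * m a'} = {}) \<and>
    \<tau> ` (D - B) \<inter> (Z \<union> (\<Union>a\<in>B. q a ` {..2 * m a})) = {}"
proof -
  have finB: "finite B" and cB: "card B \<le> card S"
    using fam_leaves[OF fam] by blast+
  from core_walks[where A = B and k = k and m = m, OF fam co \<phi> Z m h subset_refl] obtain \<psi> q where q1: "\<psi> \<in> X" and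
      q3: "\<forall>a\<in>B. q a 0 = \<phi> a \<and> q a (2 * m a) = \<psi> a \<and> walk (q a) (2 * m a) \<and> q a ` {1..2 * m a} \<inter> (Z \<union> \<phi> ` B) = {}"
      and q4: "\<forall>a\<in>B. \<forall>a'\<in>B. a \<noteq> a' \<longrightarrow> q a ` {..2 * m a} \<inter> q a' ` {..2 * m a'} = {}"
    by (elim bexE exE conjE)
  have q: "\<psi> \<in> X" 
      "\<And>a. a \<in> B \<Longrightarrow> q a 0 = \<phi> a" "\<And>a. a \<in> B \<Longrightarrow> q a (2 * m a) = \<psi> a" "\<And>a. a \<in> B \<Longrightarrow> walk (q a) (2 * m a)"
      "\<And>a. a \<in> B \<Longrightarrow> q a ` {1..2 * m a} \<inter> (Z \<union> \<phi> ` B) = {}"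
      "\<And>a a'. a \<in> B \<Longrightarrow> a' \<in> B \<Longrightarrow> a \<noteq> a' \<Longrightarrow> q a ` {..2 * m a} \<inter> q a' ` {..2 * m a'} = {}"
    using q1 q3 q4 by blast+
  let ?Z = "Z \<union> (\<Union>a\<in>B. q a ` {..2 * m a})"
  have "card (\<Union>a\<in>B. q a ` {..2 * m a}) \<le> (\<Sum>a\<in>B. card (q a ` {..2 * m a}))"
    using finB by (intro card_UN_le)
  also have "\<dots> \<le> (\<Sum>a\<in>B. k + 2)"
  proof (rule sum_mono)
    fix x assume "x \<in> B"
    then have "2 * m x \<le> k" using m by blast
    then show "card (q x ` {..2 * m x}) \<le> k + 2"
      using card_image_le[of "{..2 * m x}" "q x"] by simp
  qed
  also have "\<dots> = card B * (k + 2)"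
    by simp
  also have "\<dots> \<le> card S * (k + 2)"
    by (rule mult_le_mono1[OF cB])
  finally have "card ?Z < L (card D)"
    using h hL card_Un_le[of Z "\<Union>a\<in>B. q a ` {..2 * m a}"] by linarith
  moreover have "finite ?Z"
    using Z finB by auto
  moreover have "rich D B \<psi>"
    using core_bad[OF co q(1)] by blast
  ultimately obtain \<tau> where \<tau>: "\<tau> \<in> Adm D" "\<And>b. b \<in> B \<Longrightarrow> \<tau> b = \<psi> b" "\<tau> ` (D - B) \<inter> ?Z = {}"
    using rich_avoid[of D B \<psi> ?Z] by blast
  show ?thesis
  proof (intro exI[of _ \<tau>] exI[of _ q] conjI ballI impI)
    show "\<tau> \<in> Emb D"
      using \<tau>(1) by (rule Adm_Emb)
    show "q a (2 * m a) = \<tau> a" if "a \<in> B" for a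
      using q(3)[OF that] \<tau>(2)[OF that] by simp
  qed (use q(2,4-6) \<tau>(3) in \<open>assumption | blast\<close>)+
qed

end

section \<open>Existence of a piece with many rich embeddings\<close>

context host_pattern
begin

lemma card_extend_lower:
  assumes "finite D" "p \<notin> D" "q \<in> D" and uniq: "\<And>r. r \<in> D \<Longrightarrow> padj r p \<Longrightarrow> r = q"
  shows "card (Emb D) * (d - card D) \<le> card (Emb (insert p D))"
proof -
  let ?X = "SIGMA \<phi>:Emb D. {w. adj (\<phi> q) w} - \<phi> ` D"
  let ?f = "\<lambda>(\<phi>, w). \<phi>(p := w)"
  have "card (Emb D) * (d - card D) = (\<Sum>\<phi>\<in>Emb D. d - card D)"
    by simp
  also have "\<dots> \<le> (\<Sum>\<phi>\<in>Emb D. card ({w. adj (\<phi> q) w} - \<phi> ` D))"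
  proof (rule sum_mono)
    fix \<phi> assume \<phi>: "\<phi> \<in> Emb D"
    have "d \<le> card {w. adj (\<phi> q) w}"
      using Emb_V[OF \<phi> assms(3)] by (rule deg_ge)
    moreover have "card (\<phi> ` D) \<le> card D"
      using assms(1) by (rule card_image_le)
    moreover have "card {w. adj (\<phi> q) w} - card (\<phi> ` D) \<le> card ({w. adj (\<phi> q) w} - \<phi> ` D)"
      using assms(1) by (intro diff_card_le_card_Diff) simp
    ultimately show "d - card D \<le> card ({w. adj (\<phi> q) w} - \<phi> ` D)"
      by linarith
  qed
  also have "\<dots> = card ?X"
    using finite_Emb[OF assms(1)] fin_nb by simp
  also have "\<dots> \<le> card (Emb (insert p D))"
  proof (rule card_inj_on_le[of ?f])
    show "inj_on ?f ?X"
    proof (rule inj_onI)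
      fix x y assume a: "x \<in> ?X" "y \<in> ?X" "?f x = ?f y"
      obtain \<phi> w \<psi> v where xy: "x = (\<phi>, w)" "y = (\<psi>, v)"
        by (cases x; cases y)
      have e: "\<phi>(p := w) = \<psi>(p := v)"
        using a(3) xy by simp
      have E: "\<phi> \<in> Emb D" "\<psi> \<in> Emb D"
        using a xy by simp_all
      have "\<phi> = \<psi>"
      proof (rule Emb_eqI[OF E])
        fix r assume "r \<in> D"
        then show "\<phi> r = \<psi> r"
          using fun_cong[OF e, of r] assms(2) by (cases "r = p") simp_all
      qed
      moreover have "w = v"
        using fun_cong[OF e, of p] by simp
      ultimately show "x = y"
        using xy by simp
    qed
    show "?f ` ?X \<subseteq> Emb (insert p D)"
    proof (rule image_subsetI)
      fix x assume "x \<in> ?X"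
      then obtain \<phi> w where x: "x = (\<phi>, w)" and \<phi>: "\<phi> \<in> Emb D" and w: "adj (\<phi> q) w" "w \<notin> \<phi> ` D"
        by blast
      have "\<phi>(p := w) \<in> Emb (insert p D)"
      proof (rule EmbI)
        fix r assume "r \<in> insert p D"
        then show "(\<phi>(p := w)) r \<in> V"
          using Emb_V[OF \<phi>, of r] adj_V[OF w(1)] by (cases "r = p") simp_all
      next
        fix r assume "r \<notin> insert p D"
        then show "(\<phi>(p := w)) r = undefined"
          using \<phi> by (simp add: Emb_def PiE_iff extensional_def)
      next
        have "inj_on (\<phi>(p := w)) D"
          using Emb_inj_on[OF \<phi>] inj_on_cong[of D "\<phi>(p := w)" \<phi>] assms(2) by (metis fun_upd_other)
        moreover have "(\<phi>(p := w)) ` D = \<phi> ` D"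
          using assms(2) by (intro image_cong) auto
        ultimately show "inj_on (\<phi>(p := w)) (insert p D)"
          using w(2) assms(2) by simp
      next
        fix r r' assume r: "r \<in> insert p D" "r' \<in> insert p D" "padj r r'"
        then have "r \<noteq> r'"
          using padj_irrefl by blast
        then consider "r = p" "r' \<in> D" | "r' = p" "r \<in> D" | "r \<in> D" "r' \<in> D" "r \<noteq> p" "r' \<noteq> p"
          using r by blast
        then show "adj ((\<phi>(p := w)) r) ((\<phi>(p := w)) r')"
        proof cases
          case 1
          then have "r' = q"
            using uniq padj_sym[OF r(3)] by blast
          then show ?thesis
            using 1 w adj_sym assms(2) by auto
        next
          case 2
          then have "r = q"
            using uniq r(3) by blast
          then show ?thesis
            using 2 w assms(2) by auto
        next
          case 3
          then show ?thesis
            using Emb_adj[OF \<phi> 3(1,2) r(3)] by simp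
        qed
      qed
      then show "?f x \<in> Emb (insert p D)"
        using x by simp
    qed
    show "finite (Emb (insert p D))"
      using assms(1) by (simp add: finite_Emb)
  qed
  finally show ?thesis .
qed

end

context host_family
begin

text \<open>This is where \<open>n ^ s\<close> enters: one factor \<open>card V\<close> for each
  leaf of the full pattern.\<close>

lemma card_Good_total_le:
  assumes "(S, B) \<in> Fam"
  shows "card (Good S) \<le> card V ^ card B * F (card S)"
proof -
  have finB: "finite B"
    using fam_leaves[OF assms] by blast
  let ?T = "B \<rightarrow>\<^sub>E V"
  have finT: "finite ?T"
    using finB finV by (simp add: finite_PiE)
  have BS: "B \<subseteq> S"
    using fam_sub[OF assms] by blast
  have "Good S \<subseteq> (\<Union>x\<in>?T. {\<phi> \<in> Good S. \<forall>b\<in>B. \<phi> b = x b})"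
  proof
    fix \<phi> assume \<phi>: "\<phi> \<in> Good S"
    then have "\<phi> \<in> Emb S"
      using Good_Adm Adm_Emb by blast
    then have "restrict \<phi> B \<in> ?T"
      using Emb_V BS by (simp add: PiE_iff subset_iff)
    then show "\<phi> \<in> (\<Union>x\<in>?T. {\<phi> \<in> Good S. \<forall>b\<in>B. \<phi> b = x b})"
      using \<phi> by (intro UN_I[of "restrict \<phi> B"]) auto
  qed
  then have "card (Good S) \<le> card (\<Union>x\<in>?T. {\<phi> \<in> Good S. \<forall>b\<in>B. \<phi> b = x b})"
    using finT finite_subset[OF Good_Adm finite_Adm[OF finS]] by (intro card_mono) auto
  also have "\<dots> \<le> (\<Sum>x\<in>?T. card {\<phi> \<in> Good S. \<forall>b\<in>B. \<phi> b = x b})"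
    by (rule card_UN_le[OF finT])
  also have "\<dots> \<le> (\<Sum>x\<in>?T. F (card S))"
    using card_Good_le[OF assms] by (intro sum_mono)
  also have "\<dots> = card V ^ card B * F (card S)"
    using finB by (simp add: card_PiE)
  finally show ?thesis .
qed

text \<open>Among the rich pieces of \<open>\<sigma>\<close> take one with the fewest vertices: the
  restriction to it has no rich proper piece, so it is bad and not merely rich.\<close>

lemma Emb_Good_or_bad:
  assumes "\<sigma> \<in> Emb S" "\<sigma> \<notin> Good S"
  shows "\<exists>(D, B)\<in>Fam. restrict \<sigma> D \<in> bad D B"
proof -
  define R where "R = {c \<in> Fam. rich (fst c) (snd c) \<sigma>}"
  have finR: "finite R"
    using fin_fam by (simp add: R_def)
  have "R \<noteq> {}"
    using assms unfolding Good_def R_def by force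
  then obtain c where c: "c \<in> R" and min: "\<And>c'. c' \<in> R \<Longrightarrow> card (fst c) \<le> card (fst c')"
    using ex_min_if_finite[of "(\<lambda>c. card (fst c)) ` R"] finR by (metis (no_types, lifting) finite_imageI image_iff image_is_empty not_le)
  obtain D B where DB: "c = (D, B)" by (cases c)
  have fam: "(D, B) \<in> Fam" and ri: "rich D B \<sigma>"
    using c DB by (simp_all add: R_def)
  have DS: "D \<subseteq> S" and finD: "finite D"
    using fam_sub[OF fam] fam_fin[OF fam] by blast+
  have "restrict \<sigma> D \<in> Adm D"
    unfolding Adm_def
  proof (intro CollectI conjI allI impI notI)
    show "restrict \<sigma> D \<in> Emb D"
      using assms(1) DS by (rule Emb_restrict)
  next
    fix D' B' assume a: "(D', B') \<in> Fam" "D' \<subset> D" "rich D' B' (restrict \<sigma> D)"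
    then have "(D', B') \<in> R"
      using rich_restrict[OF a(1), of D \<sigma>] by (simp add: R_def psubset_imp_subset)
    from min[OF this] have "card D \<le> card D'"
      using DB by simp
    then show False
      using psubset_card_mono[OF finD a(2)] by simp
  qed
  moreover have "rich D B (restrict \<sigma> D)"
    using ri rich_restrict[OF fam subset_refl] by simp
  ultimately show ?thesis
    using fam by (intro bexI[of _ "(D, B)"]) (simp_all add: bad_def)
qed

text \<open>Measured against \<open>card V * d ^ (card S - 1)\<close>, at least half as many
  embeddings exist and fewer than a quarter as many are good, so more than a quarter must come from
  bad restrictions. A bad restriction to \<open>D\<close> extends in at most
  \<open>(K * d) ^ (card S - card D)\<close> ways, and averaging over \<open>Fam\<close> gives the
  factor \<open>4 * card Fam * K ^ card S\<close>.\<close>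

lemma exists_bad:
  assumes top: "(S, B) \<in> Fam" and K: "1 \<le> K"
    and total: "card V * d ^ (card S - 1) \<le> 2 * card (Emb S)"
    and large: "4 * (card V ^ card B * F (card S)) < card V * d ^ (card S - 1)"
  shows "\<exists>(D, B)\<in>Fam. card V * d ^ (card D - 1) \<le> 4 * card Fam * K ^ card S * card (bad D B)"
proof (rule ccontr)
  assume neg: "\<not> ?thesis"
  let ?N = "card S" and ?n = "card V" and ?q = "card Fam"
  let ?G = "\<lambda>c. {\<sigma> \<in> Emb S. restrict \<sigma> (fst c) \<in> bad (fst c) (snd c)}"
  have finE: "finite (Emb S)"
    using finS by (rule finite_Emb)
  have each: "4 * ?q * card (?G c) \<le> ?n * d ^ (?N - 1)" if c: "c \<in> Fam" for c
  proof -
    obtain D B' where DB: "c = (D, B')" by (cases c)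
    have fam: "(D, B') \<in> Fam" using c DB by simp
    have D: "D \<subseteq> S" "D \<noteq> {}" "finite D" "card D \<le> ?N" "1 \<le> card D"
      using fam_sub[OF fam] fam_fin[OF fam] card_mono[OF finS, of D]
      by (auto simp: Suc_le_eq card_gt_0_iff)
    have "card (?G c) \<le> card (bad D B') * (K * d) ^ (?N - card D)"
      using card_extend[OF finS conn_S D(1,2), of "bad D B'"] bad_Adm[of D B'] Adm_Emb DB by (simp add: subset_iff)
    also have "\<dots> \<le> card (bad D B') * (K ^ ?N * d ^ (?N - card D))"
      unfolding power_mult_distrib using K by (intro mult_le_mono2 mult_le_mono1 power_increasing) auto
    finally have "4 * ?q * card (?G c) \<le> 4 * ?q * (card (bad D B') * (K ^ ?N * d ^ (?N - card D)))"
      by (rule mult_le_mono2)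
    also have "\<dots> = (4 * ?q * K ^ ?N * card (bad D B')) * d ^ (?N - card D)"
      by (simp add: mult_ac)
    also have "\<dots> \<le> (?n * d ^ (card D - 1)) * d ^ (?N - card D)"
      using neg fam by (intro mult_le_mono1) fastforce
    also have "\<dots> = ?n * d ^ (?N - 1)"
      using D by (simp add: mult.assoc flip: power_add)
    finally show ?thesis .
  qed
  have "Emb S \<subseteq> Good S \<union> (\<Union>c\<in>Fam. ?G c)"
    using Emb_Good_or_bad by fastforce
  then have "card (Emb S) \<le> card (Good S \<union> (\<Union>c\<in>Fam. ?G c))"
    using finite_subset[OF Good_Adm finite_Adm[OF finS]] fin_fam finE by (intro card_mono) auto
  also have "\<dots> \<le> card (Good S) + (\<Sum>c\<in>Fam. card (?G c))"
    using card_Un_le[of "Good S" "\<Union>c\<in>Fam. ?G c"] card_UN_le[OF fin_fam, of ?G] by linarith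
  finally have 1: "card (Emb S) \<le> card (Good S) + (\<Sum>c\<in>Fam. card (?G c))" .
  have "?q * (4 * (\<Sum>c\<in>Fam. card (?G c))) = (\<Sum>c\<in>Fam. 4 * ?q * card (?G c))"
    by (simp add: sum_distrib_left mult_ac)
  also have "\<dots> \<le> (\<Sum>c\<in>Fam. ?n * d ^ (?N - 1))"
    using each by (rule sum_mono)
  also have "\<dots> = ?q * (?n * d ^ (?N - 1))"
    by simp
  finally have "4 * (\<Sum>c\<in>Fam. card (?G c)) \<le> ?n * d ^ (?N - 1)"
    using top fin_fam by (auto simp: card_gt_0_iff)
  then have "?n * d ^ (?N - 1) \<le> 4 * card (Good S)"
    using 1 total by linarith
  also have "\<dots> \<le> 4 * (card V ^ card B * F (card S))"
    using card_Good_total_le[OF top] by simp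
  finally show False
    using large by simp
qed

text \<open>The number of bad embeddings and the quantity required by \<open>core_exists\<close>
  differ by one power of \<open>d\<close>, which absorbs all constants once \<open>d\<close> is
  large.\<close>

lemma bad_core:
  assumes fam: "(D, B) \<in> Fam" and "2 \<le> card D" and K: "1 \<le> K" and E: "1 \<le> E"
    and many: "card V * d ^ (card D - 1) \<le> E * card (bad D B)"
    and d: "4 * card S * h * K ^ card S * E \<le> d"
    and h2: "4 * h * F (card D - 1) ^ card Fam \<le> L (card D)"
  obtains X where "core D B h X" "card V * d ^ (card D - 1) \<le> 2 * E * card X"
proof -
  have DN: "card D \<le> card S"
    using fam_sub[OF fam] card_mono[OF finS, of D] by blast
  have e: "card D - 1 = Suc (card D - 2)"
    using assms(2) by simp
  have "E * (4 * card S * h * (card V * (K * d) ^ (card D - 2)))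
      = 4 * card S * h * E * (K ^ (card D - 2) * (card V * d ^ (card D - 2)))"
    by (simp add: power_mult_distrib mult_ac)
  also have "\<dots> \<le> 4 * card S * h * E * (K ^ card S * (card V * d ^ (card D - 2)))"
    using K DN by (intro mult_le_mono2 mult_le_mono1 power_increasing) auto
  also have "\<dots> = (4 * card S * h * K ^ card S * E) * (card V * d ^ (card D - 2))"
    by (simp add: mult_ac)
  also have "\<dots> \<le> d * (card V * d ^ (card D - 2))"
    using d by (rule mult_le_mono1)
  also have "\<dots> = card V * d ^ (card D - 1)"
    unfolding e by (simp add: mult_ac)
  also have "\<dots> \<le> E * card (bad D B)"
    by (rule many)
  finally have "4 * card S * h * (card V * (K * d) ^ (card D - 2)) \<le> card (bad D B)"
    using E by simp
  from core_exists[OF fam this h2] obtain X where X: "core D B h X" "card (bad D B) \<le> 2 * card X" .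
  have "card V * d ^ (card D - 1) \<le> E * (2 * card X)"
    using many mult_le_mono2[OF X(2), of E] by linarith
  then show ?thesis
    using that[OF X(1)] by (simp add: mult_ac)
qed

end

section \<open>Spiders and their pieces\<close>

text \<open>Position 0 is the centre \<open>(0, 0)\<close> for every \<open>i\<close>, so a spider
  is literally a union of paths with one common vertex.\<close>

definition leg :: "nat \<Rightarrow> nat \<Rightarrow> nat \<times> nat" where
  "leg i j = (if j = 0 then (0, 0) else (i, j))"

definition leg_adj :: "nat \<times> nat \<Rightarrow> nat \<times> nat \<Rightarrow> bool" where
  "leg_adj p q \<longleftrightarrow> (\<exists>i j. p = leg i j \<and> q = leg i (Suc j) \<or> q = leg i j \<and> p = leg i (Suc j))"

definition spider :: "nat \<Rightarrow> (nat \<Rightarrow> nat) \<Rightarrow> (nat \<times> nat) set" where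
  "spider s l = (\<Union>i<s. leg i ` {..l i})"

definition feet :: "nat \<Rightarrow> (nat \<Rightarrow> nat) \<Rightarrow> (nat \<times> nat) set" where
  "feet s l = (\<lambda>i. leg i (l i)) ` {..<s}"

text \<open>Legs \<open>i'\<close> and \<open>i\<close> joined at the centre, traversed from the foot of \<open>i'\<close> to the foot of \<open>i\<close>.\<close>

definition line :: "nat \<Rightarrow> nat \<Rightarrow> nat \<Rightarrow> nat \<Rightarrow> nat \<times> nat" where
  "line k i i' z = (if k \<le> z then leg i (z - k) else leg i' (k - z))"

text \<open>Paths have from 2 to \<open>k\<close> edges: shorter ones have no inner vertex, longer
  ones cannot be lengthened to exactly \<open>k\<close>. Segments of a single leg arise from
  cutting; the path of length two across the centre settles spiders with two legs of length
  one.\<close>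

definition pieces :: "nat \<Rightarrow> nat \<Rightarrow> ((nat \<times> nat) set \<times> (nat \<times> nat) set) set" where
  "pieces s k = {(spider s l, feet s l) | l. \<forall>i<s. 1 \<le> l i \<and> l i \<le> k} \<union>
     {(line k i i' ` {a..b}, {line k i i' a, line k i i' b}) | i i' a b.
        i < s \<and> i' < s \<and> i \<noteq> i' \<and> a + 2 \<le> b \<and> b \<le> a + k \<and> b \<le> 2 * k}"

lemma leg_0 [simp]: "leg i 0 = (0, 0)"
  by (simp add: leg_def)

lemma leg_eq_iff: "leg i j = leg i' j' \<longleftrightarrow> j = j' \<and> (j = 0 \<or> i = i')"
  by (auto simp: leg_def)

lemma leg_adj_leg [simp]: "leg_adj (leg i j) (leg i (Suc j))" "leg_adj (leg i (Suc j)) (leg i j)"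
  by (auto simp: leg_adj_def)

lemma leg_adj_sym: "leg_adj p q \<Longrightarrow> leg_adj q p"
  by (auto simp: leg_adj_def)

lemma leg_adj_irrefl: "\<not> leg_adj p p"
  by (auto simp: leg_adj_def leg_eq_iff)

lemma line_eq_iff: "i \<noteq> i' \<Longrightarrow> line k i i' z = line k i i' z' \<longleftrightarrow> z = z'"
  by (auto simp: line_def leg_eq_iff)

lemma line_adj: "leg_adj (line k i i' z) (line k i i' (Suc z))"
proof -
  consider "k \<le> z" | "Suc z = k" | "Suc z < k"
    by linarith
  then show ?thesis
  proof cases
    case 1
    then show ?thesis
      by (simp add: line_def Suc_diff_le)
  next
    case 2
    then have "line k i i' z = leg i' (Suc 0)" "line k i i' (Suc z) = leg i' 0"
      by (auto simp: line_def)
    then show ?thesis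
      by (simp only: leg_adj_leg)
  next
    case 3
    then have "line k i i' z = leg i' (Suc (k - Suc z))" "line k i i' (Suc z) = leg i' (k - Suc z)"
      by (auto simp: line_def Suc_diff_Suc)
    then show ?thesis
      by (simp only: leg_adj_leg)
  qed
qed

lemma finite_spider: "finite (spider s l)"
  by (simp add: spider_def)

lemma leg_in_spider: "leg i j \<in> spider s l \<longleftrightarrow> (if j = 0 then 0 < s else i < s \<and> j \<le> l i)"
proof (cases "j = 0")
  case True
  have "(0, 0) \<in> leg x ` {..l x}" for x
    by (rule image_eqI[of _ _ 0]) simp_all
  then show ?thesis
    using True by (auto simp: spider_def)
qed (auto simp: spider_def leg_eq_iff)

lemma spiderE:
  assumes "p \<in> spider s l"
  obtains i j where "i < s" "j \<le> l i" "p = leg i j"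
  using assms unfolding spider_def by blast

lemma leg_spiderI: "i < s \<Longrightarrow> j \<le> l i \<Longrightarrow> leg i j \<in> spider s l"
  unfolding spider_def by blast

lemma feetI: "i < s \<Longrightarrow> leg i (l i) \<in> feet s l"
  unfolding feet_def by blast

lemma leg_in_feet: "\<forall>i<s. 1 \<le> l i \<Longrightarrow> leg i j \<in> feet s l \<longleftrightarrow> i < s \<and> j = l i"
  by (fastforce simp: feet_def leg_eq_iff)

lemma card_spider: "0 < s \<Longrightarrow> card (spider s (\<lambda>_. k)) = s * k + 1"
proof -
  assume s: "0 < s"
  have "spider s (\<lambda>_. k) = insert (0, 0) ({..<s} \<times> {1..k})"
  proof
    show "spider s (\<lambda>_. k) \<subseteq> insert (0, 0) ({..<s} \<times> {1..k})"
      by (auto simp: spider_def leg_def)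
    show "insert (0, 0) ({..<s} \<times> {1..k}) \<subseteq> spider s (\<lambda>_. k)"
    proof
      fix p assume p: "p \<in> insert (0, 0) ({..<s} \<times> {1..k})"
      obtain i j where ij: "p = (i, j)" by (cases p)
      show "p \<in> spider s (\<lambda>_. k)"
      proof (cases "j = 0")
        case True
        then have "p = leg 0 0" using p ij by auto
        then show ?thesis using s by (simp only: leg_in_spider) simp
      next
        case False
        then have "p = leg i j" "i < s" "j \<le> k" using p ij by (auto simp: leg_def)
        then show ?thesis by (simp add: leg_in_spider)
      qed
    qed
  qed
  then show ?thesis
    by (simp add: card_insert_if)
qed

lemma card_feet: "\<forall>i<s. 1 \<le> l i \<Longrightarrow> card (feet s l) = s"
  unfolding feet_def by (subst card_image) (auto simp: inj_on_def leg_eq_iff)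

lemma spider_mono: "\<forall>i<s. l i \<le> l' i \<Longrightarrow> spider s l \<subseteq> spider s l'"
  unfolding spider_def by fastforce

lemma feet_subset_spider: "feet s l \<subseteq> spider s l"
  unfolding feet_def spider_def by blast

lemma line_in_spider:
  assumes "i < s" "i' < s" "z \<le> 2 * k"
  shows "line k i i' z \<in> spider s (\<lambda>_. k)"
  using assms by (auto simp: line_def intro!: leg_spiderI)

lemma spider_pieces: "\<forall>i<s. 1 \<le> l i \<and> l i \<le> k \<Longrightarrow> (spider s l, feet s l) \<in> pieces s k"
  unfolding pieces_def by blast

lemma line_pieces:
  "i < s \<Longrightarrow> i' < s \<Longrightarrow> i \<noteq> i' \<Longrightarrow> a + 2 \<le> b \<Longrightarrow> b \<le> a + k \<Longrightarrow> b \<le> 2 * k \<Longrightarrow>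
    (line k i i' ` {a..b}, {line k i i' a, line k i i' b}) \<in> pieces s k"
  unfolding pieces_def by blast

lemma pieces_cases:
  assumes "(D, B) \<in> pieces s k"
  obtains (spider) l where "D = spider s l" "B = feet s l" "\<forall>i<s. 1 \<le> l i \<and> l i \<le> k"
  | (line) i i' a b where "D = line k i i' ` {a..b}" "B = {line k i i' a, line k i i' b}"
      "i < s" "i' < s" "i \<noteq> i'" "a + 2 \<le> b" "b \<le> a + k" "b \<le> 2 * k"
  using assms unfolding pieces_def by blast

lemma pieces_sub:
  assumes "(D, B) \<in> pieces s k" "2 \<le> s"
  shows "B \<subseteq> D \<and> D \<subseteq> spider s (\<lambda>_. k) \<and> D - B \<noteq> {}"
  using assms(1)
proof (cases rule: pieces_cases)
  case (spider l)
  have "\<forall>i<s. 1 \<le> l i"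
    using spider(3) by blast
  from leg_in_feet[OF this, of 0 0] this have "leg 0 0 \<notin> B"
    unfolding spider(2) using assms(2) by (auto dest: spec[of _ 0])
  moreover have "leg 0 0 \<in> D"
    unfolding spider(1) using assms(2) by (intro leg_spiderI) auto
  moreover have "D \<subseteq> spider s (\<lambda>_. k)"
    unfolding spider(1) using spider(3) by (intro spider_mono) auto
  ultimately show ?thesis
    using spider feet_subset_spider by blast
next
  case (line i i' a b)
  have "line k i i' (Suc a) \<in> D - B"
    using line by (simp add: line_eq_iff)
  moreover have "D \<subseteq> spider s (\<lambda>_. k)"
    using line line_in_spider[of i s i' _ k] by auto
  moreover have "B \<subseteq> D"
    using line by auto
  ultimately show ?thesis
    by blast
qed

lemma pieces_leaf:
  assumes "(D, B) \<in> pieces s k" "a \<in> B"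
  shows "\<exists>a'\<in>D - B. leg_adj a a'"
  using assms(1)
proof (cases rule: pieces_cases)
  case (spider l)
  then obtain i where i: "i < s" "a = leg i (l i)"
    using assms(2) unfolding feet_def by blast
  have "1 \<le> l i"
    using spider(3) i(1) by blast
  then have l: "l i = Suc (l i - 1)"
    by simp
  have "leg i (l i - 1) \<in> D"
    unfolding spider(1) using i by (intro leg_spiderI) auto
  moreover have "leg i (l i - 1) \<notin> B"
  proof -
    have "\<forall>i<s. 1 \<le> l i" using spider(3) by blast
    from leg_in_feet[OF this] show ?thesis
      unfolding spider(2) using l by auto
  qed
  moreover have "leg_adj a (leg i (l i - 1))"
    using i(2) l leg_adj_leg(2)[of i "l i - 1"] by simp
  ultimately show ?thesis
    by blast
next
  case (line i i' x y)
  show ?thesis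
  proof (cases "a = line k i i' x")
    case True
    have "line k i i' (Suc x) \<in> D - B"
      using line by (simp add: line_eq_iff)
    then show ?thesis
      using True line_adj by blast
  next
    case False
    then have "a = line k i i' y"
      using assms(2) line(2) by simp
    moreover have "line k i i' (y - 1) \<in> D - B"
    proof -
      have "y - 1 \<noteq> x" "y - 1 \<noteq> y" "y - 1 \<in> {x..y}"
        using line(6) by auto
      then show ?thesis
        unfolding line(1,2) using line_eq_iff[OF line(5)] by blast
    qed
    moreover have "leg_adj (line k i i' y) (line k i i' (y - 1))"
    proof -
      have "Suc (y - 1) = y"
        using line(6) by simp
      then show ?thesis
        using leg_adj_sym[OF line_adj[of k i i' "y - 1"]] by (simp only:)
    qed
    ultimately show ?thesis
      by blast
  qed
qed

lemma split_witness:
  assumes "C \<subseteq> P" "D \<subseteq> X \<union> \<Union>(fst ` C)" "\<And>D' B'. (D', B') \<in> C \<Longrightarrow> D' \<subset> D \<and> B' \<subseteq> X"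
  shows "\<exists>C\<subseteq>P. D \<subseteq> X \<union> \<Union>(fst ` C) \<and> (\<forall>(D', B')\<in>C. D' \<subset> D \<and> B' \<subseteq> X)"
proof (intro exI[of _ C] conjI assms(1,2) ballI)
  fix c assume "c \<in> C"
  then show "case c of (D', B') \<Rightarrow> D' \<subset> D \<and> B' \<subseteq> X"
    using assms(3) by (cases c) simp
qed

text \<open>Cut at the centre, a spider falls into its legs; cut elsewhere, into a spider with one
  shorter leg and the outer part of that leg. A segment with a single edge is covered by its two
  ends, which are prescribed, so no piece is taken for it.\<close>

lemma pieces_split_spider:
  assumes l: "\<forall>i<s. 1 \<le> l i \<and> l i \<le> k" and s: "2 \<le> s" and p: "p \<in> spider s l - feet s l"
  shows "\<exists>C\<subseteq>pieces s k. spider s l \<subseteq> insert p (feet s l) \<union> \<Union>(fst ` C) \<and>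
    (\<forall>(D', B')\<in>C. D' \<subset> spider s l \<and> B' \<subseteq> insert p (feet s l))"
proof -
  have l1: "\<forall>i<s. 1 \<le> l i"
    using l by blast
  have seg_sub: "line k i i' ` {k + c..k + l i} \<subseteq> spider s l" if "i < s" for i i' c
    using that by (auto simp: line_def intro!: leg_spiderI)
  have leg_seg: "leg i j \<in> line k i i' ` {k + c..k + l i}" if "c \<le> j" "j \<le> l i" for i i' j c
    using that by (intro image_eqI[of _ _ "k + j"]) (auto simp: line_def)
  obtain i0 j0 where ij: "i0 < s" "j0 \<le> l i0" "p = leg i0 j0"
    using p by (blast elim: spiderE)
  have other: "\<exists>i'<s. i' \<noteq> i" for i
    using s by (intro exI[of _ "if i = 0 then 1 else 0"]) auto
  show ?thesis
  proof (cases "j0 = 0")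
    case True
    \<comment> \<open>A line is named by two different legs. To write a segment of leg
      \<open>i\<close> as a line, any other leg may serve as the second one, and
      \<open>2 \<le> s\<close> provides it.\<close>
    define o' where "o' i = (SOME i'. i' < s \<and> i' \<noteq> i)" for i :: nat
    have o': "o' i < s" "o' i \<noteq> i" for i
      using someI_ex[OF other[of i]] by (simp_all add: o'_def)
    let ?C = "(\<lambda>i. (line k i (o' i) ` {k + 0..k + l i}, {line k i (o' i) (k + 0), line k i (o' i) (k + l i)})) ` {i. i < s \<and> 2 \<le> l i}"
    have pc: "p = (0, 0)"
      using ij True by simp
    have "?C \<subseteq> pieces s k"
      using l o'(1) o'(2)[THEN not_sym] by (auto intro!: line_pieces)
    moreover have "spider s l \<subseteq> insert p (feet s l) \<union> \<Union>(fst ` ?C)"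
    proof
      fix r assume "r \<in> spider s l"
      then obtain i j where r: "i < s" "j \<le> l i" "r = leg i j"
        by (rule spiderE)
      show "r \<in> insert p (feet s l) \<union> \<Union>(fst ` ?C)"
      proof (cases "2 \<le> l i")
        case True
        then have "r \<in> line k i (o' i) ` {k + 0..k + l i}"
          unfolding r(3) using r(2) by (intro leg_seg) auto
        then show ?thesis
          using r(1) True by force
      next
        case False
        then have "l i = 1"
          using l1 r(1) by (simp add: le_antisym not_less_eq_eq)
        then have "j = 0 \<or> j = l i"
          using r(2) by linarith
        then show ?thesis
          using r pc feetI[of i s l] by auto
      qed
    qed
    moreover have "D' \<subset> spider s l \<and> B' \<subseteq> insert p (feet s l)" if c: "(D', B') \<in> ?C" for D' B'
    proof -
      obtain i where i: "i < s" "2 \<le> l i" "D' = line k i (o' i) ` {k + 0..k + l i}"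
        "B' = {line k i (o' i) (k + 0), line k i (o' i) (k + l i)}"
        using c by blast
      have "leg (o' i) 1 \<in> spider s l"
        using o' l1 by (intro leg_spiderI) auto
      moreover have "leg (o' i) 1 \<notin> D'"
        using o'(2)[of i] unfolding i(3) by (auto simp: line_def leg_eq_iff)
      moreover have "D' \<subseteq> spider s l"
        unfolding i(3) using i(1) by (rule seg_sub)
      moreover have "B' \<subseteq> insert p (feet s l)"
        unfolding i(4) using pc feetI[OF i(1)] by (simp add: line_def)
      ultimately show ?thesis
        by blast
    qed
    ultimately show ?thesis
      by (rule split_witness)
  next
    case False
    have j0: "1 \<le> j0" "j0 < l i0"
      using False ij p leg_in_feet[OF l1, of i0 j0] by auto
    obtain i' where i': "i' < s" "i' \<noteq> i0"
      using other by blast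
    define l' where "l' = l(i0 := j0)"
    define C1 where "C1 = {(spider s l', feet s l')}"
    define C2 where "C2 = (if j0 + 2 \<le> l i0 then {(line k i0 i' ` {k + j0..k + l i0}, {line k i0 i' (k + j0), line k i0 i' (k + l i0)})} else {})"
    have "\<forall>i<s. 1 \<le> l' i \<and> l' i \<le> k"
      using l j0 ij(1) by (auto simp: l'_def intro: order_trans less_imp_le)
    then have "C1 \<subseteq> pieces s k"
      unfolding C1_def using spider_pieces by blast
    moreover have "C2 \<subseteq> pieces s k"
    proof (cases "j0 + 2 \<le> l i0")
      case True
      have "(line k i0 i' ` {k + j0..k + l i0}, {line k i0 i' (k + j0), line k i0 i' (k + l i0)}) \<in> pieces s k"
        using ij i' l True by (intro line_pieces) (auto intro: trans_le_add1)
      then show ?thesis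
        using True by (simp add: C2_def)
    qed (simp add: C2_def)
    ultimately have "C1 \<union> C2 \<subseteq> pieces s k"
      by (rule Un_least)
    moreover have "spider s l \<subseteq> insert p (feet s l) \<union> \<Union>(fst ` (C1 \<union> C2))"
    proof
      fix r assume "r \<in> spider s l"
      then obtain i j where r: "i < s" "j \<le> l i" "r = leg i j"
        by (rule spiderE)
      show "r \<in> insert p (feet s l) \<union> \<Union>(fst ` (C1 \<union> C2))"
      proof (cases "i = i0 \<and> j0 < j")
        case F: False
        then have "r \<in> spider s l'"
          unfolding r(3) using r by (intro leg_spiderI) (auto simp: l'_def)
        then show ?thesis
          by (simp add: C1_def)
      next
        case True
        show ?thesis
        proof (cases "j0 + 2 \<le> l i0")
          case T2: True
          have "r \<in> line k i0 i' ` {k + j0..k + l i0}"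
            using True r leg_seg[of j0 j i0 i'] by simp
          then show ?thesis
            using T2 by (simp add: C2_def)
        next
          case F: False
          then have "j = l i"
            using True r(2) by auto
          then show ?thesis
            using r feetI[of i s l] by simp
        qed
      qed
    qed
    moreover have "D' \<subset> spider s l \<and> B' \<subseteq> insert p (feet s l)" if m: "(D', B') \<in> C1 \<union> C2" for D' B'
    proof -
      have foot: "leg i0 (l i0) \<in> spider s l"
        using ij(1) by (intro leg_spiderI) auto
      consider "D' = spider s l'" "B' = feet s l'" |
        "D' = line k i0 i' ` {k + j0..k + l i0}" "B' = {line k i0 i' (k + j0), line k i0 i' (k + l i0)}"
        using m unfolding C1_def C2_def by (cases "j0 + 2 \<le> l i0") auto
      then show ?thesis
      proof cases
        case 1
        have "leg i0 (l i0) \<notin> D'"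
          unfolding 1 using j0 by (simp add: leg_in_spider l'_def)
        moreover have "D' \<subseteq> spider s l"
          unfolding 1 using j0 by (intro spider_mono) (simp add: l'_def)
        moreover have "B' \<subseteq> insert p (feet s l)"
        proof
          fix r assume "r \<in> B'"
          then obtain i where i: "i < s" "r = leg i (l' i)"
            unfolding 1 feet_def by blast
          then show "r \<in> insert p (feet s l)"
            using ij(3) feetI[of i s l] by (cases "i = i0") (auto simp: l'_def)
        qed
        ultimately show ?thesis
          using foot by blast
      next
        case 2
        have "leg i0 0 \<notin> D'"
          unfolding 2 using j0 by (auto simp: line_def leg_def)
        moreover have "leg i0 0 \<in> spider s l"
          using ij(1) by (intro leg_spiderI) auto
        moreover have "D' \<subseteq> spider s l"
          unfolding 2 using ij(1) by (rule seg_sub)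
        moreover have "B' \<subseteq> insert p (feet s l)"
          unfolding 2 using ij feetI[OF ij(1), of l] by (simp add: line_def)
        ultimately show ?thesis
          by blast
      qed
    qed
    ultimately show ?thesis
      by (rule split_witness)
  qed
qed

lemma pieces_split_line:
  assumes i: "i < s" "i' < s" "i \<noteq> i'" and ab: "a + 2 \<le> b" "b \<le> a + k" "b \<le> 2 * k"
    and p: "p \<in> line k i i' ` {a..b} - {line k i i' a, line k i i' b}"
  shows "\<exists>C\<subseteq>pieces s k. line k i i' ` {a..b} \<subseteq> insert p {line k i i' a, line k i i' b} \<union> \<Union>(fst ` C) \<and>
    (\<forall>(D', B')\<in>C. D' \<subset> line k i i' ` {a..b} \<and> B' \<subseteq> insert p {line k i i' a, line k i i' b})"
proof -
  let ?l = "line k i i'"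
  obtain c where "c \<in> {a..b}" "p = ?l c"
    using p by blast
  moreover have "c \<noteq> a" "c \<noteq> b"
    using p calculation by auto
  ultimately have c: "a < c" "c < b" "p = ?l c"
    by auto
  define sg where "sg x y = (if x + 2 \<le> y then {(?l ` {x..y}, {?l x, ?l y})} else {})" for x y
  have sg_fam: "sg x y \<subseteq> pieces s k" if "a \<le> x" "y \<le> b" for x y
    using that i ab line_pieces[of i s i' x y k] by (simp add: sg_def)
  have sg_cov: "?l ` {x..y} \<subseteq> {?l x, ?l y} \<union> \<Union>(fst ` sg x y)" for x y
  proof (cases "x + 2 \<le> y")
    case True
    then show ?thesis by (auto simp: sg_def)
  next
    case False
    then have "{x..y} \<subseteq> {x, y}" by auto
    then show ?thesis by blast
  qed
  have sg_prop: "D' \<subset> ?l ` {a..b} \<and> B' \<subseteq> {?l x, ?l y}"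
    if "(D', B') \<in> sg x y" "a \<le> x" "y \<le> b" "a < x \<or> y < b" for x y D' B'
  proof -
    have D': "D' = ?l ` {x..y}" "B' = {?l x, ?l y}"
      using that(1) by (auto simp: sg_def split: if_splits)
    have inj: "inj ?l"
      using line_eq_iff[OF i(3)] by (auto simp: inj_on_def)
    have "{x..y} \<subset> {a..b}"
      using that(2-) ab by auto
    then have "D' \<subset> ?l ` {a..b}"
      unfolding D' using inj by (metis image_strict_mono inj_on_subset subset_UNIV)
    then show ?thesis using D' by simp
  qed
  have "sg a c \<union> sg c b \<subseteq> pieces s k"
    using sg_fam[of a c] sg_fam[of c b] c by auto
  moreover have "?l ` {a..b} \<subseteq> insert p {?l a, ?l b} \<union> \<Union>(fst ` (sg a c \<union> sg c b))"
  proof -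
    have "?l ` {a..b} \<subseteq> ?l ` {a..c} \<union> ?l ` {c..b}"
      using c by force
    moreover have "X \<subseteq> insert y {x, z} \<union> (U1 \<union> U2)"
      if "X \<subseteq> Y \<union> Z" "Y \<subseteq> {x, y} \<union> U1" "Z \<subseteq> {y, z} \<union> U2" for X Y Z U1 U2 :: "(nat \<times> nat) set" and x y z
      using that by blast
    ultimately show ?thesis
      unfolding image_Un Union_Un_distrib c(3) using sg_cov[of a c] sg_cov[of c b] by simp
  qed
  moreover have "D' \<subset> ?l ` {a..b} \<and> B' \<subseteq> insert p {?l a, ?l b}" if "(D', B') \<in> sg a c \<union> sg c b" for D' B'
    using that sg_prop[of D' B' a c] sg_prop[of D' B' c b] c by auto
  ultimately show ?thesis
    by (rule split_witness)
qed

lemma pieces_split: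
  assumes "(D, B) \<in> pieces s k" "2 \<le> s" "p \<in> D - B"
  shows "\<exists>C\<subseteq>pieces s k. D \<subseteq> insert p B \<union> \<Union>(fst ` C) \<and> (\<forall>(D', B')\<in>C. D' \<subset> D \<and> B' \<subseteq> insert p B)"
  using assms(1)
proof (cases rule: pieces_cases)
  case (spider l)
  then show ?thesis
    using pieces_split_spider[OF spider(3) assms(2), of p] assms(3) by simp
next
  case (line i i' a b)
  then show ?thesis
    using pieces_split_line[OF line(3-8), of p] assms(3) by simp
qed

locale spider_host = host V adj d K
  for V :: "'a set" and adj :: "'a \<Rightarrow> 'a \<Rightarrow> bool" and d K :: nat +
  fixes s k :: nat and L F :: "nat \<Rightarrow> nat"
  assumes s2: "2 \<le> s" and k2: "2 \<le> k" and K1: "1 \<le> K"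
    and F1: "1 \<le> F m" and Fmono: "mono F"
    and Frec: "1 \<le> m \<Longrightarrow> L m * card (spider s (\<lambda>_. k)) * card (spider s (\<lambda>_. k)) * F (m - 1) ^ card (pieces s k) \<le> F m"

sublocale spider_host \<subseteq> host_pattern V adj d K leg_adj
  by unfold_locales (auto simp: leg_adj_sym leg_adj_irrefl)

context spider_host
begin

lemma conn_line: "a \<le> b \<Longrightarrow> conn (line k i i' ` {a..b})"
proof (induction b rule: dec_induct)
  case base
  then show ?case
    by (simp add: conn_single)
next
  case (step b)
  have "{a..Suc b} = insert (Suc b) {a..b}"
    using step by auto
  then have e: "line k i i' ` {a..Suc b} = insert (line k i i' (Suc b)) (line k i i' ` {a..b})"
    by simp
  show ?case
    unfolding e using step by (intro conn_insert[OF step.IH _ line_adj]) auto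
qed

lemma conn_leg: "conn (leg i ` {..m})"
proof (induction m)
  case 0
  then show ?case
    by (simp add: conn_single)
next
  case (Suc m)
  have e: "leg i ` {..Suc m} = insert (leg i (Suc m)) (leg i ` {..m})"
    by (simp add: atMost_Suc)
  show ?case
    unfolding e by (rule conn_insert[OF Suc, of "leg i m"]) auto
qed

lemma conn_spider: "conn (spider s l)"
  unfolding spider_def
proof (rule conn_UN)
  fix i
  show "(0, 0) \<in> leg i ` {..l i}"
    by (intro image_eqI[of _ _ 0]) auto
qed (rule conn_leg)

text \<open>Without one foot a spider is again a spider, possibly with a leg of length 0; this is
  why \<open>conn_spider\<close> admits arbitrary leg lengths.\<close>

lemma pieces_conn:
  assumes "(D, B) \<in> pieces s k" "a \<in> B"
  shows "conn (D - {a})"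
  using assms(1)
proof (cases rule: pieces_cases)
  case (spider l)
  then obtain i where i: "i < s" "a = leg i (l i)"
    using assms(2) unfolding feet_def by blast
  have li: "1 \<le> l i"
    using spider(3) i(1) by blast
  have "D - {a} = spider s (l(i := l i - 1))"
  proof
    show "D - {a} \<subseteq> spider s (l(i := l i - 1))"
    proof
      fix r assume r: "r \<in> D - {a}"
      then obtain i' j where ij: "i' < s" "j \<le> l i'" "r = leg i' j"
        using spider(1) by (blast elim: spiderE)
      have "i' = i \<Longrightarrow> j \<noteq> l i"
        using r i(2) ij(3) by blast
      then have "j \<le> (l(i := l i - 1)) i'"
        using ij(2) by (cases "i' = i") simp_all
      then show "r \<in> spider s (l(i := l i - 1))"
        unfolding ij(3) by (rule leg_spiderI[OF ij(1)])
    qed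
    show "spider s (l(i := l i - 1)) \<subseteq> D - {a}"
    proof
      fix r assume "r \<in> spider s (l(i := l i - 1))"
      then obtain i' j where r: "i' < s" "j \<le> (l(i := l i - 1)) i'" "r = leg i' j"
        by (rule spiderE)
      then have "j \<le> l i'" "r \<noteq> a"
        using i li by (auto simp: leg_eq_iff split: if_splits)
      then show "r \<in> D - {a}"
        using r spider(1) leg_spiderI[of i' s j l] by simp
    qed
  qed
  then show ?thesis
    using conn_spider by simp
next
  case (line i i' x y)
  have inj: "inj (line k i i')"
    using line_eq_iff[OF line(5)] by (auto simp: inj_on_def)
  have sub: "line k i i' ` {x..y} - {line k i i' z} = line k i i' ` ({x..y} - {z})" if "z \<in> {x..y}" for z
    by (simp add: image_set_diff[OF inj])
  show ?thesis
  proof (cases "a = line k i i' x")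
    case True
    have "D - {a} = line k i i' ` ({x..y} - {x})"
      unfolding line(1) True using line(6) by (intro sub) auto
    also have "{x..y} - {x} = {Suc x..y}"
      by auto
    finally show ?thesis
      using conn_line[of "Suc x" y i i'] line(6) by simp
  next
    case False
    then have a: "a = line k i i' y"
      using assms(2) line(2) by simp
    have "D - {a} = line k i i' ` ({x..y} - {y})"
      unfolding line(1) a using line(6) by (intro sub) auto
    also have "{x..y} - {y} = {x..y - 1}"
      using line(6) by auto
    finally show ?thesis
      using conn_line[of x "y - 1" i i'] line(6) by simp
  qed
qed

end

sublocale spider_host \<subseteq> host_family V adj d K leg_adj "spider s (\<lambda>_. k)" "pieces s k" L F
proof unfold_locales
  show "finite (spider s (\<lambda>_. k))"
    by (rule finite_spider)
  show "conn (spider s (\<lambda>_. k))"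
    by (rule conn_spider)
  show "B \<subseteq> D \<and> D \<subseteq> spider s (\<lambda>_. k) \<and> D - B \<noteq> {}" if "(D, B) \<in> pieces s k" for D B
    using that s2 by (rule pieces_sub)
  show "\<exists>C\<subseteq>pieces s k. D \<subseteq> insert p B \<union> \<Union>(fst ` C) \<and> (\<forall>(D', B')\<in>C. D' \<subset> D \<and> B' \<subseteq> insert p B)"
    if "(D, B) \<in> pieces s k" "p \<in> D - B" for D B p
    using that(1) s2 that(2) by (rule pieces_split)
  show "\<exists>a'\<in>D - B. leg_adj a a'" if "(D, B) \<in> pieces s k" "a \<in> B" for D B a
    using that by (rule pieces_leaf)
  show "conn (D - {a})" if "(D, B) \<in> pieces s k" "a \<in> B" for D B a
    using that by (rule pieces_conn)
  show "1 \<le> F m" for m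
    by (rule F1)
  show "mono F"
    by (rule Fmono)
  show "1 \<le> m \<Longrightarrow> L m * card (spider s (\<lambda>_. k)) * card (spider s (\<lambda>_. k)) * F (m - 1) ^ card (pieces s k) \<le> F m" for m
    by (rule Frec)
qed

context spider_host
begin

text \<open>The spider grows by single leaves: shortening a nonzero leg removes one, and
  \<open>card_extend_lower\<close> puts it back. The size of the full spider bounds the number of
  used vertices uniformly in all steps.\<close>

lemma card_Emb_spider_ge:
  assumes "\<forall>i<s. l i \<le> k"
  shows "card V * (d - card (spider s (\<lambda>_. k))) ^ (\<Sum>i<s. l i) \<le> card (Emb (spider s l))"
  using assms
proof (induction "\<Sum>i<s. l i" arbitrary: l)
  case 0
  then have "\<forall>i<s. l i = 0"
    by simp
  then have sp: "spider s l = {(0, 0)}"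
    using s2 by (auto simp: spider_def lessThan_empty_iff)
  have "(\<lambda>v. restrict (\<lambda>_. v) {(0, 0)}) ` V \<subseteq> Emb (spider s l)"
    unfolding sp by (rule image_subsetI, rule EmbI) (auto simp: leg_adj_irrefl)
  moreover have "inj_on (\<lambda>v. restrict (\<lambda>_. v) {(0::nat, 0::nat)}) V"
    by (rule inj_onI) (metis restrict_apply' singletonI)
  ultimately have "card V \<le> card (Emb (spider s l))"
    using finite_Emb[OF finite_spider] by (intro card_inj_on_le)
  then show ?case
    using 0(1) by simp
next
  case (Suc m)
  then obtain i where i: "i < s" "l i \<noteq> 0"
    by (metis (no_types, lifting) lessThan_iff nat.distinct(1) sum.neutral)
  define l' where "l' = l(i := l i - 1)"
  have li: "l i = Suc (l i - 1)"
    using i by simp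
  have sum: "(\<Sum>i<s. l i) = Suc (\<Sum>i<s. l' i)"
  proof -
    have "(\<Sum>j<s. l j) = l i + (\<Sum>j\<in>{..<s} - {i}. l j)" "(\<Sum>j<s. l' j) = l' i + (\<Sum>j\<in>{..<s} - {i}. l' j)"
      using i by (simp_all add: sum.remove)
    moreover have "(\<Sum>j\<in>{..<s} - {i}. l j) = (\<Sum>j\<in>{..<s} - {i}. l' j)"
      by (intro sum.cong) (auto simp: l'_def)
    moreover have "l' i = l i - 1"
      by (simp add: l'_def)
    ultimately show ?thesis
      using li by linarith
  qed
  have l'k: "\<forall>i<s. l' i \<le> k"
    using Suc.prems by (auto simp: l'_def intro: le_diff_conv[THEN iffD2] trans_le_add1)
  have l'l: "\<forall>j<s. l' j \<le> l j"
    by (simp add: l'_def)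
  let ?N = "card (spider s (\<lambda>_. k))"
  have ins: "spider s l = insert (leg i (l i)) (spider s l')"
  proof
    show "spider s l \<subseteq> insert (leg i (l i)) (spider s l')"
    proof
      fix r assume "r \<in> spider s l"
      then obtain i' j where "i' < s" "j \<le> l i'" "r = leg i' j"
        by (rule spiderE)
      then show "r \<in> insert (leg i (l i)) (spider s l')"
        by (cases "i' = i \<and> j = l i") (auto simp: l'_def intro!: leg_spiderI)
    qed
    show "insert (leg i (l i)) (spider s l') \<subseteq> spider s l"
      using spider_mono[OF l'l] leg_spiderI[OF i(1), of "l i" l] by simp
  qed
  have "card (spider s l') \<le> ?N"
    using l'k by (intro card_mono finite_spider spider_mono)
  then have "card V * (d - ?N) ^ (\<Sum>i<s. l i) \<le> (card V * (d - ?N) ^ (\<Sum>i<s. l' i)) * (d - card (spider s l'))"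
    unfolding sum by (simp add: mult_ac mult_le_mono diff_le_mono2)
  also have "\<dots> \<le> card (Emb (spider s l')) * (d - card (spider s l'))"
    using Suc.hyps(1)[of l'] Suc.hyps(2) sum l'k by (intro mult_le_mono1) simp
  also have "\<dots> \<le> card (Emb (insert (leg i (l i)) (spider s l')))"
  proof (rule card_extend_lower[OF finite_spider])
    show "leg i (l i) \<notin> spider s l'"
      using i(2) by (simp add: leg_in_spider l'_def) arith
    show "leg i (l i - 1) \<in> spider s l'"
      using i(1) by (intro leg_spiderI) (auto simp: l'_def)
    fix r assume r: "r \<in> spider s l'" "leg_adj r (leg i (l i))"
    then obtain i' j where ij: "i' < s" "j \<le> l' i'" "r = leg i' j"
      by (blast elim: spiderE)
    obtain a b where "r = leg a b \<and> leg i (l i) = leg a (Suc b) \<or> leg i (l i) = leg a b \<and> r = leg a (Suc b)"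
      using r(2) unfolding leg_adj_def by blast
    then show "r = leg i (l i - 1)"
    proof
      assume "r = leg a b \<and> leg i (l i) = leg a (Suc b)"
      then show ?thesis
        using li by (auto simp: leg_eq_iff)
    next
      assume a: "leg i (l i) = leg a b \<and> r = leg a (Suc b)"
      then have "b = l i" "a = i"
        using i(2) by (auto simp: leg_eq_iff)
      then have "r = leg i (Suc (l i))"
        using a by simp
      then have "Suc (l i) \<le> l i - 1"
        using r(1) by (simp add: leg_in_spider l'_def)
      then have False
        by arith
      then show ?thesis ..
    qed
  qed
  finally show ?case
    unfolding ins .
qed

end

section \<open>From a core of spiders to the subdivision\<close>

text \<open>
  A leg that follows \<open>f\<close> for \<open>l\<close> steps and then \<open>q\<close> backwards, with one further vertex \<open>x\<close> at the end
  if \<open>e = 1\<close> (the number of missing steps is odd).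
\<close>

definition join_leg :: "(nat \<Rightarrow> 'a) \<Rightarrow> nat \<Rightarrow> nat \<Rightarrow> 'a \<Rightarrow> (nat \<Rightarrow> 'a) \<Rightarrow> nat \<Rightarrow> nat \<Rightarrow> 'a" where
  "join_leg f l e x q k j = (if j < l then f j else if j + e \<le> k then q (k - e - j) else x)"

context host
begin

lemma join_leg_adj:
  assumes "l + m + e = k" "e \<le> 1" "q m = f l" and f: "\<And>j. j < l \<Longrightarrow> adj (f j) (f (Suc j))"
    and q: "\<And>j. j < m \<Longrightarrow> adj (q j) (q (Suc j))" and "e = 1 \<Longrightarrow> adj (q 0) x" and j: "j < k"
  shows "adj (join_leg f l e x q k j) (join_leg f l e x q k (Suc j))"
proof -
  consider "Suc j < l" | "Suc j = l" | "l \<le> j" "Suc j + e \<le> k" | "l \<le> j" "k < Suc j + e"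
    by linarith
  then show ?thesis
  proof cases
    case 1
    then show ?thesis
      using f[of j] by (simp add: join_leg_def)
  next
    case 2
    then have "k - e - Suc j = m"
      using assms(1) by simp
    then show ?thesis
      using f[of j] 2 assms(1,3) by (simp add: join_leg_def)
  next
    case 3
    then have "k - e - j = Suc (k - e - Suc j)" "k - e - Suc j < m"
      using assms(1) by simp_all
    then show ?thesis
      using 3 adj_sym[OF q[of "k - e - Suc j"]] by (simp add: join_leg_def)
  next
    case 4
    then have "e = 1" "j + e = k"
      using j assms(2) by linarith+
    then show ?thesis
      using 4 assms(6) by (simp add: join_leg_def)
  qed
qed

lemma join_leg_cases:
  assumes "l + m + e = k" "e \<le> 1" "j \<le> k"
  obtains (inner) "j < l" "join_leg f l e x q k j = f j"
  | (walk) c where "l \<le> j" "c \<le> m" "c + e + j = k" "join_leg f l e x q k j = q c"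
  | (last) "e = 1" "j = k" "l \<le> j" "join_leg f l e x q k j = x"
proof -
  consider "j < l" | "l \<le> j" "j + e \<le> k" | "l \<le> j" "k < j + e"
    by linarith
  then show ?thesis
  proof cases
    case 1
    then show ?thesis
      by (intro inner) (simp_all add: join_leg_def)
  next
    case 2
    then show ?thesis
      using assms by (intro walk[of "k - e - j"]) (simp_all add: join_leg_def)
  next
    case 3
    then have "e = 1" "j = k"
      using assms(2,3) by linarith+
    then show ?thesis
      using 3 by (intro last) (simp_all add: join_leg_def)
  qed
qed

end

context spider_host
begin

abbreviation "full \<equiv> spider s (\<lambda>_. k)"
abbreviation "ends \<equiv> feet s (\<lambda>_. k)"

text \<open>The \<open>k\<close>-subdivision of \<open>K_{s,t}\<close> seen as \<open>t\<close> full
  spiders on common feet: the centres are the side of size \<open>t\<close>, the feet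
  \<open>x i\<close> the side of size \<open>s\<close>. Only \<open>ends\<close> is removed, so
  disjoint interiors also means distinct centres.\<close>

definition has_copy :: "nat \<Rightarrow> bool" where
  "has_copy t \<longleftrightarrow> (\<exists>x \<sigma>. (\<forall>j<t. \<sigma> j \<in> Emb full \<and> (\<forall>i<s. \<sigma> j (leg i k) = x i)) \<and>
     (\<forall>j<t. \<forall>j'<t. j \<noteq> j' \<longrightarrow> \<sigma> j ` (full - ends) \<inter> \<sigma> j' ` (full - ends) = {}))"

lemma interiorE:
  assumes "p \<in> full - ends"
  obtains i j where "i < s" "j < k" "p = leg i j"
proof -
  obtain i j where ij: "i < s" "j \<le> k" "p = leg i j"
    using assms by (blast elim: spiderE)
  then have "j \<noteq> k"
    using assms feetI[of i s "\<lambda>_. k"] by auto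
  then show ?thesis
    using that[of i j] ij by simp
qed

lemma emb_of_legs:
  assumes g0: "\<And>i. i < s \<Longrightarrow> g i 0 = y"
    and adj: "\<And>i j. i < s \<Longrightarrow> j < k \<Longrightarrow> adj (g i j) (g i (Suc j))"
    and inj: "\<And>i j i' j'. i < s \<Longrightarrow> i' < s \<Longrightarrow> j \<le> k \<Longrightarrow> j' \<le> k \<Longrightarrow> g i j = g i' j' \<Longrightarrow> j = j' \<and> (j = 0 \<or> i = i')"
  shows "\<exists>\<sigma>\<in>Emb full. \<forall>i<s. \<forall>j\<le>k. \<sigma> (leg i j) = g i j"
proof -
  define \<sigma> where "\<sigma> = restrict (\<lambda>p. g (fst p) (snd p)) full"
  have \<sigma>: "\<sigma> (leg i j) = g i j" if "i < s" "j \<le> k" for i j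
  proof -
    have "leg i j \<in> full"
      using that by (rule leg_spiderI)
    then have e: "\<sigma> (leg i j) = g (fst (leg i j)) (snd (leg i j))"
      by (simp add: \<sigma>_def)
    show ?thesis
      unfolding e using g0[of 0] g0[of i] that s2 by (cases "j = 0") (simp_all add: leg_def)
  qed
  have "\<sigma> \<in> Emb full"
  proof (rule EmbI)
    fix p assume "p \<in> full"
    then obtain i j where ij: "i < s" "j \<le> k" "p = leg i j"
      by (rule spiderE)
    have "g i j \<in> V"
    proof (cases "j < k")
      case True
      then show ?thesis
        using adj_V[OF adj[OF ij(1) True]] by blast
    next
      case False
      then have "j = Suc (j - 1)" "j - 1 < k"
        using ij(2) k2 by simp_all
      then show ?thesis
        using adj_V[OF adj[OF ij(1), of "j - 1"]] by simp
    qed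
    then show "\<sigma> p \<in> V"
      using \<sigma> ij by simp
  next
    fix p assume "p \<notin> full"
    then show "\<sigma> p = undefined"
      by (simp add: \<sigma>_def)
  next
    show "inj_on \<sigma> full"
    proof (rule inj_onI)
      fix p p' assume p: "p \<in> full" "p' \<in> full" "\<sigma> p = \<sigma> p'"
      obtain i j where ij: "i < s" "j \<le> k" "p = leg i j"
        using p(1) by (rule spiderE)
      obtain i' j' where ij': "i' < s" "j' \<le> k" "p' = leg i' j'"
        using p(2) by (rule spiderE)
      have "g i j = g i' j'"
        using p(3) ij ij' \<sigma> by simp
      then have "j = j' \<and> (j = 0 \<or> i = i')"
        by (intro inj ij ij')
      then show "p = p'"
        unfolding ij(3) ij'(3) leg_eq_iff .
    qed
  next
    fix p p' assume p: "p \<in> full" "p' \<in> full" "leg_adj p p'"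
    obtain a b where ab: "p = leg a b \<and> p' = leg a (Suc b) \<or> p' = leg a b \<and> p = leg a (Suc b)"
      using p(3) unfolding leg_adj_def by blast
    then have "leg a (Suc b) \<in> full"
      using p(1,2) by blast
    then have "a < s" "Suc b \<le> k"
      by (simp_all add: leg_in_spider)
    then have "adj (\<sigma> (leg a b)) (\<sigma> (leg a (Suc b)))"
      using adj[of a b] \<sigma>[of a b] \<sigma>[of a "Suc b"] by simp
    then show "adj (\<sigma> p) (\<sigma> p')"
      using ab adj_sym by blast
  qed
  then show ?thesis
    using \<sigma> by (intro bexI[of _ \<sigma>]) simp_all
qed

text \<open>The spiders are chosen greedily on fixed feet. \<open>W j\<close> reserves at most one
  vertex for the \<open>j\<close>-th spider, namely its centre when that is prescribed, and all
  other spiders keep away from it. Earlier interiors together with foreign reservations amount to at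
  most \<open>t * (card full + 1)\<close> vertices.\<close>

lemma has_copyI:
  fixes W :: "nat \<Rightarrow> 'a set"
  assumes W: "\<And>j. j < t \<Longrightarrow> finite (W j) \<and> card (W j) \<le> 1"
    "\<And>j j'. j < t \<Longrightarrow> j' < t \<Longrightarrow> j \<noteq> j' \<Longrightarrow> W j \<inter> W j' = {}"
    and step: "\<And>j Z. j < t \<Longrightarrow> finite Z \<Longrightarrow> card Z \<le> t * (card full + 1) \<Longrightarrow> Z \<inter> W j = {} \<Longrightarrow>
      \<exists>\<sigma>\<in>Emb full. (\<forall>i<s. \<sigma> (leg i k) = x i) \<and> \<sigma> ` (full - ends) \<inter> Z = {}"
  shows "has_copy t"
proof -
  have "\<exists>\<sigma>. (\<forall>j<n. \<sigma> j \<in> Emb full \<and> (\<forall>i<s. \<sigma> j (leg i k) = x i)) \<and>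
      (\<forall>j<n. \<forall>j'<n. j \<noteq> j' \<longrightarrow> \<sigma> j ` (full - ends) \<inter> \<sigma> j' ` (full - ends) = {}) \<and>
      (\<forall>j<n. \<forall>j'<t. j \<noteq> j' \<longrightarrow> \<sigma> j ` (full - ends) \<inter> W j' = {})" if "n \<le> t" for n
    using that
  proof (induction n)
    case 0
    then show ?case by simp
  next
    case (Suc n)
    then have "n \<le> t" by simp
    from Suc.IH[OF this] obtain \<sigma> where s1: "\<forall>j<n. \<sigma> j \<in> Emb full \<and> (\<forall>i<s. \<sigma> j (leg i k) = x i)"
      and s2: "\<forall>j<n. \<forall>j'<n. j \<noteq> j' \<longrightarrow> \<sigma> j ` (full - ends) \<inter> \<sigma> j' ` (full - ends) = {}"
      and s3: "\<forall>j<n. \<forall>j'<t. j \<noteq> j' \<longrightarrow> \<sigma> j ` (full - ends) \<inter> W j' = {}"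
      by (elim exE conjE)
    define Z1 where "Z1 = (\<Union>j<n. \<sigma> j ` (full - ends))"
    define Z2 where "Z2 = (\<Union>j'\<in>{..<t} - {n}. W j')"
    have nt: "n < t"
      using Suc.prems by simp
    have fin: "finite Z1" "finite Z2"
      using finite_spider W(1) by (auto simp: Z1_def Z2_def)
    have "card Z1 \<le> (\<Sum>j<n. card (\<sigma> j ` (full - ends)))"
      unfolding Z1_def by (rule card_UN_le) simp
    also have "\<dots> \<le> (\<Sum>j<n. card full)"
    proof (rule sum_mono)
      fix j
      have "card (\<sigma> j ` (full - ends)) \<le> card (full - ends)"
        by (intro card_image_le finite_Diff finite_spider)
      also have "\<dots> \<le> card full"
        by (intro card_mono finite_spider) auto
      finally show "card (\<sigma> j ` (full - ends)) \<le> card full" .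
    qed
    also have "\<dots> \<le> t * card full"
      using nt by simp
    finally have c1: "card Z1 \<le> t * card full" .
    have "card Z2 \<le> (\<Sum>j'\<in>{..<t} - {n}. card (W j'))"
      unfolding Z2_def by (rule card_UN_le) simp
    also have "\<dots> \<le> (\<Sum>j'\<in>{..<t} - {n}. 1)"
      using W(1) by (intro sum_mono) simp
    also have "\<dots> \<le> t"
      using nt by simp
    finally have c: "card (Z1 \<union> Z2) \<le> t * (card full + 1)"
      using c1 card_Un_le[of Z1 Z2] by simp
    have dis: "(Z1 \<union> Z2) \<inter> W n = {}"
    proof -
      have "Z1 \<inter> W n = {}"
        unfolding Z1_def using s3 nt by auto
      moreover have "Z2 \<inter> W n = {}"
        unfolding Z2_def using W(2) nt by auto
      ultimately show ?thesis by blast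
    qed
    have "finite (Z1 \<union> Z2)"
      using fin by simp
    from step[OF nt this c dis] obtain \<tau> where \<tau>: "\<tau> \<in> Emb full" "\<forall>i<s. \<tau> (leg i k) = x i"
      "\<tau> ` (full - ends) \<inter> (Z1 \<union> Z2) = {}"
      by (elim bexE conjE)
    have \<tau>1: "\<tau> ` (full - ends) \<inter> \<sigma> j ` (full - ends) = {}" if "j < n" for j
    proof -
      have "\<sigma> j ` (full - ends) \<subseteq> Z1"
        unfolding Z1_def using that by blast
      then show ?thesis using \<tau>(3) by blast
    qed
    have \<tau>2: "\<tau> ` (full - ends) \<inter> W j' = {}" if "j' < t" "n \<noteq> j'" for j'
    proof -
      have "W j' \<subseteq> Z2"
        unfolding Z2_def using that by blast
      then show ?thesis using \<tau>(3) by blast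
    qed
    let ?\<sigma> = "\<sigma>(n := \<tau>)"
    show ?case
    proof (intro exI[of _ ?\<sigma>] conjI allI impI)
      fix j assume "j < Suc n"
      then show "?\<sigma> j \<in> Emb full"
        using s1 \<tau>(1) by (cases "j = n") simp_all
    next
      fix j i assume "j < Suc n" "i < s"
      then show "?\<sigma> j (leg i k) = x i"
        using s1 \<tau>(2) by (cases "j = n") simp_all
    next
      fix j j' assume "j < Suc n" "j' < Suc n" "j \<noteq> j'"
      then consider "j = n" "j' < n" | "j' = n" "j < n" | "j < n" "j' < n"
        by linarith
      then show "?\<sigma> j ` (full - ends) \<inter> ?\<sigma> j' ` (full - ends) = {}"
      proof cases
        case 1
        then show ?thesis using \<tau>1[of j'] by simp
      next
        case 2
        then show ?thesis using \<tau>1[of j] by (simp add: Int_commute)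
      next
        case 3
        then show ?thesis using s2 \<open>j \<noteq> j'\<close> by simp
      qed
    next
      fix j j' assume "j < Suc n" "j' < t" "j \<noteq> j'"
      then show "?\<sigma> j ` (full - ends) \<inter> W j' = {}"
        using s3 \<tau>2[of j'] by (cases "j = n") simp_all
    qed
  qed
  from this[OF order_refl] show ?thesis
    unfolding has_copy_def by (elim exE conjE) (intro exI conjI)
qed

lemma core_vary_set:
  assumes co: "core D B h X" and \<phi>0: "\<phi>0 \<in> X" and Z: "finite Z" "card Z < h" and "finite A" "A \<subseteq> B"
  shows "\<exists>\<phi>\<in>X. (\<forall>p. p \<notin> A \<longrightarrow> \<phi> p = \<phi>0 p) \<and> \<phi> ` A \<inter> Z = {}"
  using assms(5,6)
proof (induction A)
  case empty
  then show ?case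
    using \<phi>0 by auto
next
  case (insert a A)
  have "A \<subseteq> B"
    using insert.prems by simp
  from insert.IH[OF this] obtain \<phi> where \<phi>: "\<phi> \<in> X" "\<forall>p. p \<notin> A \<longrightarrow> \<phi> p = \<phi>0 p" "\<phi> ` A \<inter> Z = {}"
    by (elim bexE conjE)
  have "a \<in> B"
    using insert.prems by simp
  from core_vary[OF co \<phi>(1) this Z] obtain w where w: "w \<notin> Z" "\<phi>(a := w) \<in> X" .
  have "(\<phi>(a := w)) ` insert a A = insert w (\<phi> ` A)"
    using insert.hyps by auto
  then show ?case
    using w \<phi>(2,3) by (intro bexI[OF _ w(2)] conjI) auto
qed

text \<open>
  For legs with an odd number of missing steps the final leaf is the last but one vertex of the leg
  in a fixed core embedding, so that the first step may go to any of the many variants of its leaf.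
  This would identify two final leaves only if two legs had length one.
\<close>

lemma spider_core_has_copy:
  assumes l: "\<forall>i<s. 1 \<le> l i \<and> l i \<le> k"
    and ones: "\<And>i i'. i < s \<Longrightarrow> i' < s \<Longrightarrow> l i = 1 \<Longrightarrow> l i' = 1 \<Longrightarrow> i = i'"
    and co: "core (spider s l) (feet s l) h X" and "X \<noteq> {}"
    and h: "t * (card full + 1) + card full + card full * (k + 2) < h" and hL: "h \<le> L (card (spider s l))"
  shows "has_copy t"
proof -
  let ?D = "spider s l" and ?B = "feet s l"
  have fam: "(?D, ?B) \<in> pieces s k"
    using l by (rule spider_pieces)
  have l1: "\<forall>i<s. 1 \<le> l i"
    using l by blast
  have Dfull: "?D \<subseteq> full"
    using l by (intro spider_mono) simp
  obtain \<phi>0 where \<phi>0: "\<phi>0 \<in> X"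
    using assms(4) by blast
  have E0: "\<phi>0 \<in> Emb ?D"
    using core_bad[OF co \<phi>0] by blast
  define e where "e i = (k - l i) mod 2" for i
  define m where "m p = (k - l (fst p)) div 2" for p :: "nat \<times> nat"
  define a where "a i = leg i (l i)" for i
  \<comment> \<open>The feet depend on \<open>\<phi>0\<close> alone, so all \<open>t\<close> spiders
    share them, whereas the embedding \<open>\<phi>\<close> chosen below changes with
    \<open>Z\<close>.\<close>
  define x where "x i = (if e i = 1 then \<phi>0 (leg i (l i - 1)) else \<phi>0 (a i))" for i
  have e1: "e i \<le> 1" for i
    by (simp add: e_def)
  have aB: "a i \<in> ?B" if "i < s" for i
    unfolding a_def using that by (rule feetI)
  have aD: "leg i j \<in> ?D" if "i < s" "j \<le> l i" for i j
    using that by (rule leg_spiderI)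
  have int: "leg i j \<in> ?D - ?B" if "i < s" "j < l i" for i j
    using aD[of i j] that leg_in_feet[OF l1, of i j] by simp
  have fst_a: "fst (a i) = i" if "i < s" for i
    using l1 that by (auto simp: a_def leg_def)
  have len: "l i + 2 * m (a i) + e i = k" if "i < s" for i
  proof -
    have "2 * ((k - l i) div 2) + (k - l i) mod 2 = k - l i"
      by simp
    moreover have "l i \<le> k"
      using l that by blast
    ultimately show ?thesis
      using fst_a[OF that] by (simp add: m_def e_def)
  qed
  have a_inj: "a i = a i' \<longleftrightarrow> i = i'" if "i < s" "i' < s" for i i'
    using fst_a that by metis
  show ?thesis
  proof (rule has_copyI[where W = "\<lambda>_. {}" and x = x])
    fix j and Z :: "'a set" assume Z: "finite Z" "card Z \<le> t * (card full + 1)"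
    \<comment> \<open>All feet lie in the image of \<open>\<phi>0\<close>. Avoiding that image keeps
      the new interior and the walks, apart from first vertices in the even case, off the feet of
      every leg.\<close>
    define Z' where "Z' = Z \<union> \<phi>0 ` ?D"
    have finZ': "finite Z'"
      using Z(1) finite_spider by (simp add: Z'_def)
    have "card (\<phi>0 ` ?D) \<le> card full"
      using card_image_le[OF finite_spider, of \<phi>0 s l] card_mono[OF finite_spider Dfull] by linarith
    then have cZ': "card Z' \<le> t * (card full + 1) + card full"
      using card_Un_le[of Z "\<phi>0 ` ?D"] Z(2) unfolding Z'_def by linarith
    define A where "A = a ` {i. i < s \<and> e i = 1}"
    have A: "finite A" "A \<subseteq> ?B"
      using aB by (auto simp: A_def)
    have "card Z' < h"
      using cZ' h by linarith
    from core_vary_set[OF co \<phi>0 finZ' this A] obtain \<phi> where \<phi>: "\<phi> \<in> X" "\<forall>p. p \<notin> A \<longrightarrow> \<phi> p = \<phi>0 p"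
      "\<phi> ` A \<inter> Z' = {}"
      by (elim bexE conjE)
    have E: "\<phi> \<in> Emb ?D"
      using core_bad[OF co \<phi>(1)] by blast
    have m: "\<forall>p\<in>?B. 2 * m p \<le> k"
      by (auto simp: m_def)
    have hZ: "card Z' + card full * (k + 2) < h"
      using cZ' h by linarith
    from core_realize[OF fam co \<phi>(1) finZ' m hZ hL]
    obtain \<tau> q where \<tau>: "\<tau> \<in> Emb ?D" and q1: "\<forall>p\<in>?B. q p 0 = \<phi> p" "\<forall>p\<in>?B. q p (2 * m p) = \<tau> p"
      "\<forall>p\<in>?B. walk (q p) (2 * m p)" "\<forall>p\<in>?B. q p ` {1..2 * m p} \<inter> (Z' \<union> \<phi> ` ?B) = {}"
      "\<forall>p\<in>?B. \<forall>p'\<in>?B. p \<noteq> p' \<longrightarrow> q p ` {..2 * m p} \<inter> q p' ` {..2 * m p'} = {}"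
      and dis: "\<tau> ` (?D - ?B) \<inter> (Z' \<union> (\<Union>p\<in>?B. q p ` {..2 * m p})) = {}"
      by (elim exE conjE)
    note q = bspec[OF q1(1)] bspec[OF q1(2)] bspec[OF q1(3)] bspec[OF q1(4)] bspec[OF bspec[OF q1(5)], rule_format]
    define M where "M i = 2 * m (a i)" for i
    define Q where "Q i = q (a i)" for i
    have Q0: "Q i 0 = \<phi> (a i)" if "i < s" for i
      unfolding Q_def by (intro q(1) aB that)
    have QM: "Q i (M i) = \<tau> (a i)" if "i < s" for i
      unfolding Q_def M_def by (intro q(2) aB that)
    have Qinj: "c = c'" if "i < s" "c \<le> M i" "c' \<le> M i" "Q i c = Q i c'" for i c c'
      using q(3)[OF aB[OF that(1)]] that(2-4) unfolding walk_def Q_def M_def by (auto dest: inj_onD)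
    have Qadj: "adj (Q i c) (Q i (Suc c))" if "i < s" "c < M i" for i c
      using q(3)[OF aB[OF that(1)]] that(2) unfolding walk_def Q_def M_def by blast
    have Qdis: "Q i c \<noteq> Q i' c'" if "i < s" "i' < s" "i \<noteq> i'" "c \<le> M i" "c' \<le> M i'" for i i' c c'
    proof -
      have "a i \<noteq> a i'"
        using a_inj that by blast
      from q(5)[OF aB[OF that(1)] aB[OF that(2)] this] show ?thesis
        using that(4,5) unfolding Q_def M_def by (auto simp: disjoint_iff)
    qed
    have QZ: "Q i c \<notin> Z'" if "i < s" "c \<le> M i" "1 \<le> c \<or> e i = 1" for i c
    proof (cases "c = 0")
      case True
      then have "a i \<in> A"
        using that by (auto simp: A_def)
      then show ?thesis
        using True Q0[OF that(1)] \<phi>(3) by auto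
    next
      case False
      then have "Q i c \<in> Q i ` {1..M i}"
        using that(2) by simp
      then show ?thesis
        using q(4)[OF aB[OF that(1)]] unfolding Q_def M_def by blast
    qed
    have \<tau>Q: "\<tau> (leg i j) \<noteq> Q i' c" if "i < s" "j < l i" "i' < s" "c \<le> M i'" for i j i' c
    proof -
      have "\<tau> (leg i j) \<in> \<tau> ` (?D - ?B)"
        using int[OF that(1,2)] by blast
      moreover have "Q i' c \<in> (\<Union>p\<in>?B. q p ` {..2 * m p})"
        using aB[OF that(3)] that(4) unfolding Q_def M_def by blast
      ultimately show ?thesis
        using dis by (metis (no_types) IntI UnI2 empty_iff)
    qed
    have \<tau>Z: "\<tau> (leg i j) \<notin> Z'" if "i < s" "j < l i" for i j
      using dis imageI[OF int[OF that], of \<tau>] by (metis (no_types) IntI UnI1 empty_iff)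
    have xZ: "x i \<in> Z'" if "i < s" for i
      using aD[OF that, of "l i"] aD[OF that, of "l i - 1"] by (simp add: x_def a_def Z'_def)
    have xQ: "x i \<noteq> Q i' c" if i: "i < s" "e i = 1" "i' < s" "c \<le> M i'" for i i' c
    proof (cases "1 \<le> c \<or> e i' = 1")
      case True
      then show ?thesis
        using QZ[OF i(3,4) True] xZ[OF i(1)] by auto
    next
      case False
      then have c: "c = 0" "a i' \<notin> A"
        using a_inj i(3) by (auto simp: A_def)
      then have "Q i' c = \<phi>0 (leg i' (l i'))"
        using Q0[OF i(3)] \<phi>(2) by (simp add: a_def)
      moreover have "x i = \<phi>0 (leg i (l i - 1))"
        using i(2) by (simp add: x_def)
      moreover have "leg i (l i - 1) \<noteq> leg i' (l i')"
      proof -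
        have "1 \<le> l i" "1 \<le> l i'"
          using l1 i by blast+
        then show ?thesis
          by (auto simp: leg_eq_iff)
      qed
      moreover have "leg i (l i - 1) \<in> ?D" "leg i' (l i') \<in> ?D"
        using aD i by simp_all
      ultimately show ?thesis
        using Emb_inj[OF E0] by simp
    qed
    have xx: "i = i'" if i: "i < s" "e i = 1" "i' < s" "e i' = 1" "x i = x i'" for i i'
    proof -
      have "\<phi>0 (leg i (l i - 1)) = \<phi>0 (leg i' (l i' - 1))"
        using i by (simp add: x_def)
      then have "leg i (l i - 1) = leg i' (l i' - 1)"
        using Emb_inj[OF E0] aD i by simp
      moreover have "1 \<le> l i" "1 \<le> l i'"
        using l1 i by blast+
      ultimately show ?thesis
        using ones[OF i(1,3)] by (auto simp: leg_eq_iff)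
    qed
    \<comment> \<open>In the odd case the last edge exists because \<open>\<phi>\<close> was
      obtained from \<open>\<phi>0\<close> by moving leaves only: the leaf of \<open>\<phi>\<close>
      is still adjacent to the penultimate vertex \<open>x i\<close> of that leg in
      \<open>\<phi>0\<close>.\<close>
    define g where "g i = join_leg (\<lambda>j. \<tau> (leg i j)) (l i) (e i) (x i) (Q i) k" for i
    have len': "l i + M i + e i = k" if "i < s" for i
      using len[OF that] by (simp add: M_def)
    have gadj: "adj (g i j) (g i (Suc j))" if i: "i < s" "j < k" for i j
      unfolding g_def
    proof (rule join_leg_adj[OF len'[OF i(1)] e1])
      show "Q i (M i) = \<tau> (leg i (l i))"
        using QM[OF i(1)] by (simp add: a_def)
      show "adj (\<tau> (leg i j)) (\<tau> (leg i (Suc j)))" if "j < l i" for j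
        using that i(1) aD by (intro Emb_adj[OF \<tau>]) simp_all
      show "adj (Q i j) (Q i (Suc j))" if "j < M i" for j
        using Qadj[OF i(1) that] .
      show "adj (Q i 0) (x i)" if "e i = 1"
      proof -
        have ne: "leg i (l i - 1) \<notin> A"
          using int[OF i(1), of "l i - 1"] l1 i(1) A(2) by fastforce
        have "1 \<le> l i"
          using l1 i(1) by blast
        then have l': "Suc (l i - 1) = l i"
          by simp
        have "leg_adj (leg i (l i - 1)) (leg i (l i))"
          using leg_adj_leg(1)[of i "l i - 1"] unfolding l' .
        then have "adj (\<phi> (leg i (l i - 1))) (\<phi> (leg i (l i)))"
          using aD[OF i(1), of "l i - 1"] aD[OF i(1), of "l i"] by (intro Emb_adj[OF E]) simp_all
        moreover have "\<phi> (leg i (l i - 1)) = \<phi>0 (leg i (l i - 1))"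
          using \<phi>(2) ne by blast
        ultimately have "adj (\<phi>0 (leg i (l i - 1))) (\<phi> (a i))"
          by (simp add: a_def)
        then show ?thesis
          using adj_sym Q0[OF i(1)] that by (simp add: x_def)
      qed
    qed (rule i(2))
    have ginj: "j = j' \<and> (j = 0 \<or> i = i')"
      if i: "i < s" "i' < s" "j \<le> k" "j' \<le> k" and eq: "g i j = g i' j'" for i j i' j'
    proof (cases rule: join_leg_cases[OF len'[OF i(1)] e1 i(3), of "\<lambda>j. \<tau> (leg i j)" "x i" "Q i", case_names inner walk last])
      case inner
      note 1 = inner
      show ?thesis
      proof (cases rule: join_leg_cases[OF len'[OF i(2)] e1 i(4), of "\<lambda>j. \<tau> (leg i' j)" "x i'" "Q i'", case_names inner walk last])
        case inner
        then have "\<tau> (leg i j) = \<tau> (leg i' j')"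
          using 1 eq by (simp add: g_def)
        then have "leg i j = leg i' j'"
          using Emb_inj[OF \<tau>, of "leg i j" "leg i' j'"] aD i 1(1) inner(1) by simp
        then show ?thesis
          by (rule leg_eq_iff[THEN iffD1])
      next
        case (walk c)
        then show ?thesis
          using 1 eq \<tau>Q[OF i(1) 1(1) i(2) walk(2)] by (simp add: g_def)
      next
        case last
        then show ?thesis
          using 1 eq \<tau>Z[OF i(1) 1(1)] xZ[OF i(2)] by (simp add: g_def)
      qed
    next
      case (walk c)
      note 1 = walk
      show ?thesis
      proof (cases rule: join_leg_cases[OF len'[OF i(2)] e1 i(4), of "\<lambda>j. \<tau> (leg i' j)" "x i'" "Q i'", case_names inner walk last])
        case inner
        then show ?thesis
          using 1 eq \<tau>Q[OF i(2) inner(1) i(1) 1(2)] by (simp add: g_def)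
      next
        case (walk c')
        then have Qeq: "Q i c = Q i' c'"
          using 1 eq by (simp add: g_def)
        then have "i = i'"
          using Qdis[OF i(1,2) _ 1(2) walk(2)] by blast
        then have "c = c'"
          using Qinj[OF i(1) 1(2)] walk(2) Qeq by simp
        then show ?thesis
          using \<open>i = i'\<close> 1(3) walk(3) by simp
      next
        case last
        then show ?thesis
          using 1 eq xQ[OF i(2) last(1) i(1) 1(2)] by (simp add: g_def)
      qed
    next
      case last
      note 1 = last
      show ?thesis
      proof (cases rule: join_leg_cases[OF len'[OF i(2)] e1 i(4), of "\<lambda>j. \<tau> (leg i' j)" "x i'" "Q i'", case_names inner walk last])
        case inner
        then show ?thesis
          using 1 eq \<tau>Z[OF i(2) inner(1)] xZ[OF i(1)] by (simp add: g_def)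
      next
        case (walk c')
        then show ?thesis
          using 1 eq xQ[OF i(1) 1(1) i(2) walk(2)] by (simp add: g_def)
      next
        case last
        then have "x i = x i'"
          using 1 eq by (simp add: g_def)
        then show ?thesis
          using xx[OF i(1) 1(1) i(2) last(1)] 1(2) last(2) by simp
      qed
    qed
    have g0: "g i 0 = \<tau> (leg 0 0)" if "i < s" for i
    proof -
      have "0 < l i"
        using l1 that by fastforce
      then show ?thesis
        by (simp add: g_def join_leg_def)
    qed
    have "\<exists>\<sigma>\<in>Emb full. \<forall>i<s. \<forall>j\<le>k. \<sigma> (leg i j) = g i j"
      using g0 gadj ginj by (rule emb_of_legs)
    then obtain \<sigma> where \<sigma>: "\<sigma> \<in> Emb full" "\<forall>i<s. \<forall>j\<le>k. \<sigma> (leg i j) = g i j" ..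
    have gk: "g i k = x i" if i: "i < s" for i
    proof (cases rule: join_leg_cases[OF len'[OF i] e1 order_refl, of "\<lambda>j. \<tau> (leg i j)" "x i" "Q i", case_names inner walk last])
      case inner
      then show ?thesis
        using len'[OF i] by simp
    next
      case (walk c)
      then have "c = 0" "e i = 0"
        by simp_all
      moreover have "a i \<notin> A"
        using a_inj i calculation(2) by (auto simp: A_def)
      ultimately show ?thesis
        using walk Q0[OF i] \<phi>(2) by (simp add: g_def x_def)
    next
      case last
      then show ?thesis
        by (simp add: g_def)
    qed
    have "\<sigma> p \<notin> Z'" if p: "p \<in> full - ends" for p
    proof -
      obtain i j where ij: "i < s" "j < k" "p = leg i j"
        using p by (rule interiorE)
      have "g i j \<notin> Z'"
      proof (cases rule: join_leg_cases[OF len'[OF ij(1)] e1 less_imp_le[OF ij(2)], of "\<lambda>j. \<tau> (leg i j)" "x i" "Q i", case_names inner walk last])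
        case inner
        then show ?thesis
          using \<tau>Z[OF ij(1) inner(1)] by (simp add: g_def)
      next
        case (walk c)
        then have "1 \<le> c \<or> e i = 1"
          using ij(2) e1[of i] by linarith
        then show ?thesis
          using QZ[OF ij(1) walk(2)] walk(4) by (simp add: g_def)
      next
        case last
        then show ?thesis
          using ij(2) by simp
      qed
      then show ?thesis
        using \<sigma>(2) ij by simp
    qed
    then have "\<sigma> ` (full - ends) \<inter> Z = {}"
      unfolding Z'_def by blast
    moreover have "\<forall>i<s. \<sigma> (leg i k) = x i"
      using \<sigma>(2) gk by simp
    ultimately show "\<exists>\<sigma>\<in>Emb full. (\<forall>i<s. \<sigma> (leg i k) = x i) \<and> \<sigma> ` (full - ends) \<inter> Z = {}"
      using \<sigma>(1) by blast
  qed simp_all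
qed

end

section \<open>From a core of paths to the subdivision\<close>

text \<open>Vertices of degree below \<open>c * \<alpha> / 2\<close> carry at most
  \<open>c * \<alpha> * \<beta> / 2\<close> pairs. The other half must lie on the remaining
  vertices, which carry at most \<open>\<alpha>\<close> pairs each.\<close>

lemma dense_degree:
  fixes \<alpha> \<beta> c :: real and A :: "('a \<times> 'b) set"
  assumes fin: "finite P" "finite Q" and A: "A \<subseteq> P \<times> Q" and P: "card P \<le> \<alpha>" and Q: "card Q \<le> \<beta>"
    and dense: "c * \<alpha> * \<beta> \<le> card A" and "0 < \<alpha>" "0 \<le> c"
  shows "c * \<beta> / 2 \<le> card {u \<in> Q. c * \<alpha> / 2 \<le> card {w. (w, u) \<in> A}}"
proof -
  let ?deg = "\<lambda>u. card {w. (w, u) \<in> A}"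
  define Q' where "Q' = {u \<in> Q. c * \<alpha> / 2 \<le> ?deg u}"
  have Q': "Q' \<subseteq> Q" "finite Q'"
    using fin by (auto simp: Q'_def)
  have finN: "finite {w. (w, u) \<in> A}" for u
    using A by (intro finite_subset[OF _ fin(1)]) auto
  have degP: "?deg u \<le> card P" for u
    using A by (intro card_mono fin) auto
  have "A = (\<lambda>(u, w). (w, u)) ` (SIGMA u:Q. {w. (w, u) \<in> A})"
    using A by force
  then have "card A \<le> card (SIGMA u:Q. {w. (w, u) \<in> A})"
    using card_image_le[of "SIGMA u:Q. {w. (w, u) \<in> A}" "\<lambda>(u, w). (w, u)"] fin(2) finN by simp
  also have "\<dots> = (\<Sum>u\<in>Q. ?deg u)"
    using fin(2) finN by simp
  finally have "real (card A) \<le> (\<Sum>u\<in>Q. real (?deg u))"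
    by (simp flip: of_nat_sum)
  also have "\<dots> = (\<Sum>u\<in>Q - Q'. real (?deg u)) + (\<Sum>u\<in>Q'. real (?deg u))"
    using sum.subset_diff[OF Q'(1) fin(2)] .
  also have "\<dots> \<le> (\<Sum>u\<in>Q - Q'. c * \<alpha> / 2) + (\<Sum>u\<in>Q'. \<alpha>)"
  proof (intro add_mono sum_mono)
    show "real (?deg u) \<le> c * \<alpha> / 2" if "u \<in> Q - Q'" for u
      using that by (auto simp: Q'_def)
    show "real (?deg u) \<le> \<alpha>" for u
      using degP[of u] P by linarith
  qed
  also have "\<dots> = card (Q - Q') * (c * \<alpha> / 2) + card Q' * \<alpha>"
    by simp
  also have "\<dots> \<le> \<beta> * (c * \<alpha> / 2) + card Q' * \<alpha>"
  proof -
    have "card (Q - Q') \<le> card Q"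
      using fin(2) by (intro card_mono) auto
    then have "real (card (Q - Q')) \<le> \<beta>"
      using Q by linarith
    then show ?thesis
      using assms(7,8) by (intro add_mono mult_right_mono) auto
  qed
  finally have "(c * \<beta> / 2) * \<alpha> \<le> card Q' * \<alpha>"
    using dense by (simp add: field_simps)
  then show ?thesis
    using assms(7) unfolding Q'_def by simp
qed

text \<open>Greedy selection: as long as \<open>T\<close> uses up at most half of each degree,
  averaging over \<open>P - T\<close> finds a vertex related to a proportion
  \<open>\<gamma> / (2 * \<alpha>)\<close> of the current \<open>U\<close>.\<close>

lemma common_neighbours:
  fixes \<alpha> \<gamma> :: real and A :: "('a \<times> 'b) set"
  assumes fin: "finite P" "finite Q" and P: "card P \<le> \<alpha>" and "Q \<noteq> {}"
    and deg: "\<And>u. u \<in> Q \<Longrightarrow> \<gamma> \<le> card {w \<in> P. (w, u) \<in> A}" and "0 < \<gamma>" "0 < \<alpha>" and "2 * real t \<le> \<gamma>"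
  shows "\<exists>T U. T \<subseteq> P \<and> card T = t \<and> U \<subseteq> Q \<and> (\<gamma> / (2 * \<alpha>)) ^ t * card Q \<le> card U \<and> (\<forall>w\<in>T. \<forall>u\<in>U. (w, u) \<in> A)"
  using assms(8)
proof (induction t)
  case 0
  show ?case
    by (intro exI[of _ "{}"] exI[of _ Q]) auto
next
  case (Suc t)
  then have "2 * real t \<le> \<gamma>" by simp
  from Suc.IH[OF this] obtain T U where TU: "T \<subseteq> P" "card T = t" "U \<subseteq> Q"
    "(\<gamma> / (2 * \<alpha>)) ^ t * card Q \<le> card U" "\<forall>w\<in>T. \<forall>u\<in>U. (w, u) \<in> A"
    by (elim exE conjE)
  have finT: "finite T" and finU: "finite U"
    using TU(1,3) fin finite_subset by blast+
  have "0 < (\<gamma> / (2 * \<alpha>)) ^ t * card Q"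
    using assms(4,6,7) fin(2) by (simp add: card_gt_0_iff)
  then have U0: "0 < card U"
    using TU(4) by linarith
  have degU: "\<gamma> / 2 \<le> card {w \<in> P - T. (w, u) \<in> A}" if "u \<in> U" for u
  proof -
    have "{w \<in> P. (w, u) \<in> A} \<subseteq> {w \<in> P - T. (w, u) \<in> A} \<union> T"
      by blast
    then have "card {w \<in> P. (w, u) \<in> A} \<le> card ({w \<in> P - T. (w, u) \<in> A} \<union> T)"
      using fin(1) finT by (intro card_mono) auto
    also have "\<dots> \<le> card {w \<in> P - T. (w, u) \<in> A} + t"
      using card_Un_le[of "{w \<in> P - T. (w, u) \<in> A}" T] TU(2) by simp
    finally have "\<gamma> \<le> card {w \<in> P - T. (w, u) \<in> A} + real t"
      using deg[of u] that TU(3) by fastforce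
    then show ?thesis
      using Suc.prems by simp
  qed
  let ?x = "\<gamma> / (2 * \<alpha>) * card U"
  have "\<exists>w\<in>P - T. ?x \<le> card {u \<in> U. (w, u) \<in> A}"
  proof (rule ccontr)
    assume "\<not> ?thesis"
    then have less: "real (card {u \<in> U. (w, u) \<in> A}) < ?x" if "w \<in> P - T" for w
      using that by force
    have ind: "(\<Sum>u\<in>U. card {w \<in> P - T. (w, u) \<in> A}) = (\<Sum>w\<in>P - T. card {u \<in> U. (w, u) \<in> A})"
    proof -
      have "(\<Sum>u\<in>U. card {w \<in> P - T. (w, u) \<in> A}) = (\<Sum>u\<in>U. \<Sum>w\<in>P - T. if (w, u) \<in> A then 1 else 0)"
        using fin(1) by (intro sum.cong) (simp_all add: sum.If_cases Int_def)
      also have "\<dots> = (\<Sum>w\<in>P - T. \<Sum>u\<in>U. if (w, u) \<in> A then 1 else 0)"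
        by (rule sum.swap)
      also have "\<dots> = (\<Sum>w\<in>P - T. card {u \<in> U. (w, u) \<in> A})"
        using finU by (intro sum.cong) (simp_all add: sum.If_cases Int_def)
      finally show ?thesis .
    qed
    obtain u where "u \<in> U"
      using U0 by (auto simp: card_gt_0_iff)
    then have "0 < card {w \<in> P - T. (w, u) \<in> A}"
      using degU[of u] assms(6) by linarith
    then have ne: "P - T \<noteq> {}"
      by (auto simp: card_gt_0_iff)
    have "card U * (\<gamma> / 2) = (\<Sum>u\<in>U. \<gamma> / 2)"
      by simp
    also have "\<dots> \<le> (\<Sum>u\<in>U. real (card {w \<in> P - T. (w, u) \<in> A}))"
      using degU by (rule sum_mono)
    also have "\<dots> = (\<Sum>w\<in>P - T. real (card {u \<in> U. (w, u) \<in> A}))"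
      using ind by (simp flip: of_nat_sum)
    also have "\<dots> < (\<Sum>w\<in>P - T. ?x)"
      using fin(1) ne less by (intro sum_strict_mono) auto
    also have "\<dots> = card (P - T) * ?x"
      by simp
    also have "\<dots> \<le> \<alpha> * ?x"
    proof (intro mult_right_mono)
      have "card (P - T) \<le> card P"
        using fin(1) by (intro card_mono) auto
      then show "real (card (P - T)) \<le> \<alpha>"
        using P by linarith
    qed (use assms(6,7) in simp)
    also have "\<dots> = card U * (\<gamma> / 2)"
      using assms(7) by simp
    finally show False by simp
  qed
  then obtain w where w: "w \<in> P - T" "?x \<le> card {u \<in> U. (w, u) \<in> A}" ..
  show ?case
  proof (intro exI[of _ "insert w T"] exI[of _ "{u \<in> U. (w, u) \<in> A}"] conjI)
    have "(\<gamma> / (2 * \<alpha>)) ^ Suc t * card Q = \<gamma> / (2 * \<alpha>) * ((\<gamma> / (2 * \<alpha>)) ^ t * card Q)"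
      by (simp add: mult.assoc)
    also have "\<dots> \<le> ?x"
      using TU(4) assms(6,7) by (intro mult_left_mono) simp_all
    also have "\<dots> \<le> card {u \<in> U. (w, u) \<in> A}"
      by (rule w(2))
    finally show "(\<gamma> / (2 * \<alpha>)) ^ Suc t * card Q \<le> card {u \<in> U. (w, u) \<in> A}" .
    show "card (insert w T) = Suc t"
      using w(1) finT TU(2) by simp
  qed (use w(1) TU in auto)
qed

lemma (in spider_host) card_line:
  assumes "i \<noteq> i'"
  shows "card (line k i i' ` {a..b}) = Suc b - a"
proof -
  have "inj_on (line k i i') {a..b}"
    using line_eq_iff[OF assms] by (auto simp: inj_on_def)
  then show ?thesis
    by (simp add: card_image)
qed

locale path_core = spider_host V adj d K s k L F
  for V :: "'a set" and adj d K s k L F +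
  fixes i i' a b H :: nat and X :: "(nat \<times> nat \<Rightarrow> 'a) set"
  assumes ii': "i < s" "i' < s" "i \<noteq> i'" and ab: "a + 2 \<le> b" "b \<le> a + k" "b \<le> 2 * k"
    and co: "core (line k i i' ` {a..b}) {line k i i' a, line k i i' b} H X"
begin

abbreviation "li \<equiv> line k i i'"
abbreviation "D \<equiv> li ` {a..b}"
abbreviation "B \<equiv> {li a, li b}"

lemma fam: "(D, B) \<in> pieces s k"
  using ii' ab by (rule line_pieces)

lemma li_eq: "li z = li z' \<longleftrightarrow> z = z'"
  using ii'(3) by (rule line_eq_iff)

lemma cardD: "card D = Suc (b - a)"
  using card_line[OF ii'(3), of a b] ab by simp

lemma X_Emb: "\<phi> \<in> X \<Longrightarrow> \<phi> \<in> Emb D"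
  using core_bad[OF co] by blast

lemma X_Adm: "X \<subseteq> Adm D"
  using co bad_Adm unfolding core_def by blast

text \<open>Leaving out the leaf \<open>z\<close> loses nothing about the image of \<open>p\<close>
  and keeps the path connected. Of the remaining \<open>b - a\<close> vertices one is the fixed
  root, so a factor \<open>K * d\<close> is saved against counting whole paths.\<close>

lemma card_through_root:
  assumes "r \<in> D" "r \<noteq> z" "z \<in> B" and p: "p \<in> D" "p \<noteq> z"
  shows "card ((\<lambda>\<phi>. \<phi> p) ` {\<phi> \<in> X. \<phi> r = v}) \<le> (K * d) ^ (b - a - 1)"
proof -
  let ?E = "{\<chi> \<in> Emb (D - {z}). \<chi> r = v}"
  have fin: "finite (D - {z})"
    by simp
  have zD: "z \<in> D"
    using assms(3) ab by auto
  have "(\<lambda>\<phi>. \<phi> p) ` {\<phi> \<in> X. \<phi> r = v} \<subseteq> (\<lambda>\<chi>. \<chi> p) ` ?E"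
  proof (rule image_subsetI)
    fix \<phi> assume \<phi>: "\<phi> \<in> {\<phi> \<in> X. \<phi> r = v}"
    have "restrict \<phi> (D - {z}) \<in> Emb (D - {z})"
      using \<phi> X_Emb by (intro Emb_restrict[of _ D]) auto
    then have "restrict \<phi> (D - {z}) \<in> ?E"
      using \<phi> assms(1,2) by simp
    moreover have "\<phi> p = restrict \<phi> (D - {z}) p"
      using p by simp
    ultimately show "\<phi> p \<in> (\<lambda>\<chi>. \<chi> p) ` ?E"
      by (intro image_eqI[of _ _ "restrict \<phi> (D - {z})"])
  qed
  moreover have finE: "finite ?E"
    using finite_Emb[OF fin] by simp
  ultimately have "card ((\<lambda>\<phi>. \<phi> p) ` {\<phi> \<in> X. \<phi> r = v}) \<le> card ((\<lambda>\<chi>. \<chi> p) ` ?E)"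
    by (intro card_mono) auto
  also have "\<dots> \<le> card ?E"
    using finE by (rule card_image_le)
  also have "\<dots> \<le> (K * d) ^ (card (D - {z}) - 1)"
    using pieces_conn[OF fam assms(3)] assms(1,2) by (intro card_rooted[OF fin]) auto
  also have "card (D - {z}) - 1 = b - a - 1"
    using cardD zD by simp
  finally show ?thesis .
qed

text \<open>
  All endpoints lie around one vertex \<open>v\<close>: \<open>T\<close> consists of neighbours of \<open>v\<close> and \<open>U\<close> of ends of paths
  starting at \<open>v\<close>. The vertices in \<open>G\<close> replace those of \<open>U\<close> when the number of missing steps is odd; they
  are found by counting triples \<open>(w, u, x)\<close> where \<open>x\<close> precedes \<open>u\<close> on a core path from \<open>w\<close> to \<open>u\<close>.
\<close>

lemma path_initial:
  fixes E h0 t :: nat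
  defines "c \<equiv> 1 / (2 * real E * real (F (card D - 1) ^ card (pieces s k)) * real (K ^ card full))"
  assumes "V \<noteq> {}" and E: "1 \<le> E" and d1: "1 \<le> d" and many: "card V * d ^ (card D - 1) \<le> 2 * E * card X"
    and d2: "4 * real t \<le> c * real (K * d)" and d3: "real (s + t) \<le> (c / 4) ^ t * (c / 2) * real (K * d)"
    and H: "2 * real (h0 + s + t) \<le> real H * ((c / 4) ^ t * (c / 2) * (c / 2))"
  shows "\<exists>T U G. finite T \<and> card T = t \<and> finite U \<and> finite G \<and> s + t \<le> card U \<and> s + t \<le> card G \<and>
    (\<forall>w\<in>T. \<forall>u\<in>U. \<exists>\<phi>\<in>X. \<phi> (li a) = w \<and> \<phi> (li b) = u) \<and>
    (\<forall>x\<in>G. h0 \<le> card {u \<in> U. adj x u})"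
proof -
  define len where "len = b - a"
  have len: "2 \<le> len" "len \<le> k" "card D - 1 = len"
    using ab cardD by (auto simp: len_def)
  define P1 where "P1 = li (Suc a)"
  define P2 where "P2 = li (b - 1)"
  have P1: "P1 \<in> D - B" and P2: "P2 \<in> D - B"
  proof -
    have "Suc a \<in> {a..b}" "Suc a \<noteq> a" "Suc a \<noteq> b" "b - 1 \<in> {a..b}" "b - 1 \<noteq> a" "b - 1 \<noteq> b"
      using ab by auto
    then show "P1 \<in> D - B" "P2 \<in> D - B"
      unfolding P1_def P2_def using li_eq by blast+
  qed
  have inD: "li a \<in> D" "li b \<in> D"
    using ab by auto
  have aneb: "li a \<noteq> li b"
    using li_eq ab by simp
  define FF where "FF = F (card D - 1) ^ card (pieces s k)"
  have F0: "1 \<le> FF"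
    using F1 by (simp add: FF_def)
  have c_eq: "c = 1 / (2 * real E * real FF * real (K ^ card full))"
    by (simp only: c_def FF_def)
  have finX: "finite X"
    using finite_subset[OF X_Adm finite_Adm] by simp
  define \<Delta> where "\<Delta> = real (K * d)"
  have \<Delta>1: "1 \<le> \<Delta>"
    using K1 d1 by (simp add: \<Delta>_def flip: of_nat_mult)
  have c0: "0 < c"
    using E F0 K1 unfolding c_eq by (intro divide_pos_pos mult_pos_pos) simp_all
  define Xv where "Xv v = {\<phi> \<in> X. \<phi> P1 = v}" for v
  \<comment> \<open>Averaging over the second vertex of the core paths. Rooting there puts all first
    vertices into one neighbourhood, of size at most \<open>\<Delta>\<close>, and leaves at most
    \<open>\<Delta> ^ (len - 1)\<close> last vertices.\<close>
  have "\<exists>v\<in>V. d ^ len \<le> 2 * E * card (Xv v)"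
  proof (rule ccontr)
    assume "\<not> ?thesis"
    then have less: "2 * E * card (Xv v) < d ^ len" if "v \<in> V" for v
      using that by force
    have "X = (\<Union>v\<in>V. Xv v)"
      using X_Emb Emb_V P1 unfolding Xv_def by blast
    then have "card X \<le> (\<Sum>v\<in>V. card (Xv v))"
      using card_UN_le[OF finV, of Xv] by simp
    then have "2 * E * card X \<le> (\<Sum>v\<in>V. 2 * E * card (Xv v))"
      by (simp flip: sum_distrib_left)
    also have "\<dots> < (\<Sum>v\<in>V. d ^ len)"
      using less assms(2) finV by (intro sum_strict_mono) auto
    finally show False
      using many len(3) by simp
  qed
  then obtain v where v: "v \<in> V" "d ^ len \<le> 2 * E * card (Xv v)" ..
  \<comment> \<open>With \<open>v\<close> in second place, a pair of ends belongs to at most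
    \<open>FF\<close> core paths, so many paths give many pairs: \<open>A\<close> will have constant
    density among all possible pairs.\<close>
  define A where "A = (\<lambda>\<phi>. (\<phi> (li a), \<phi> (li b))) ` Xv v"
  have finA: "finite A"
    using finX by (simp add: A_def Xv_def)
  have "card (Xv v) \<le> card A * FF"
  proof -
    let ?S = "\<lambda>(w, u). {\<phi> \<in> Adm D. (\<forall>p\<in>B. \<phi> p = (if p = li a then w else u)) \<and> \<phi> P1 = v}"
    have "Xv v \<subseteq> (\<Union>z\<in>A. ?S z)"
    proof
      fix \<phi> assume \<phi>: "\<phi> \<in> Xv v"
      then have "\<phi> \<in> ?S (\<phi> (li a), \<phi> (li b))"
        using X_Adm aneb unfolding Xv_def by auto
      moreover have "(\<phi> (li a), \<phi> (li b)) \<in> A"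
        using \<phi> by (simp add: A_def)
      ultimately show "\<phi> \<in> (\<Union>z\<in>A. ?S z)"
        by (rule UN_I[rotated])
    qed
    moreover have "finite (\<Union>z\<in>A. ?S z)"
      using finA finite_Adm[of D] by (auto simp: case_prod_beta')
    ultimately have "card (Xv v) \<le> card (\<Union>z\<in>A. ?S z)"
      by (intro card_mono)
    also have "\<dots> \<le> (\<Sum>z\<in>A. card (?S z))"
      by (rule card_UN_le[OF finA])
    also have "\<dots> \<le> (\<Sum>z\<in>A. FF)"
    proof (rule sum_mono)
      fix z :: "'a \<times> 'a"
      obtain w u where z: "z = (w, u)"
        by (cases z)
      show "card (?S z) \<le> FF"
        unfolding z prod.case FF_def by (rule card_Adm_through[OF fam P1])
    qed
    finally show ?thesis by simp
  qed
  then have "2 * E * card (Xv v) \<le> 2 * E * (card A * FF)"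
    by (rule mult_le_mono2)
  from order_trans[OF v(2) this] have "d ^ len \<le> 2 * E * FF * card A"
    by (simp add: mult_ac)
  then have "real (d ^ len) \<le> real (2 * E * FF * card A)"
    by (simp only: of_nat_le_iff)
  then have Alarge: "real d ^ len \<le> 2 * real E * real FF * card A"
    by simp
  \<comment> \<open>The factor \<open>K ^ card full\<close> in \<open>c\<close> pays for passing
    from powers of \<open>d\<close> to powers of \<open>\<Delta>\<close>.\<close>
  have cA: "c * \<Delta> ^ len \<le> card A"
  proof -
    have pos: "0 < 2 * real E * real FF"
      using E F0 by simp
    have Kl: "real K ^ len \<le> real (K ^ card full)"
    proof -
      have "card full = s * k + 1"
        using card_spider s2 by simp
      moreover have "1 * k \<le> s * k"
        using s2 by (intro mult_le_mono1) simp
      ultimately have "len \<le> card full"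
        using len(2) by linarith
      then show ?thesis
        using K1 by (simp add: power_increasing)
    qed
    have Kpos: "0 < real (K ^ card full)"
      using K1 by simp
    have "c * \<Delta> ^ len = (real K ^ len / real (K ^ card full)) * (real d ^ len / (2 * real E * real FF))"
      by (simp add: c_eq \<Delta>_def power_mult_distrib)
    also have "\<dots> \<le> 1 * (real d ^ len / (2 * real E * real FF))"
      using Kl Kpos pos by (intro mult_right_mono) (simp_all add: divide_le_eq_1)
    also have "\<dots> \<le> card A"
      using Alarge pos by (simp add: divide_le_eq mult_ac)
    finally show ?thesis .
  qed
  define P where "P = {w. adj v w}"
  define Q where "Q = (\<lambda>\<phi>. \<phi> (li b)) ` Xv v"
  have finP: "finite P" and finQ: "finite Q"
    using fin_nb finX by (simp_all add: P_def Q_def Xv_def)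
  have AP: "A \<subseteq> P \<times> Q"
  proof (rule subsetI)
    fix z assume "z \<in> A"
    then obtain \<phi> where \<phi>: "\<phi> \<in> Xv v" "z = (\<phi> (li a), \<phi> (li b))"
      unfolding A_def by blast
    then have \<phi>X: "\<phi> \<in> X" "\<phi> P1 = v"
      by (simp_all add: Xv_def)
    have "adj (\<phi> (li a)) (\<phi> P1)"
      using X_Emb[OF \<phi>X(1)] inD(1) P1 unfolding P1_def by (intro Emb_adj[of _ D] line_adj) blast+
    then have "\<phi> (li a) \<in> P"
      using \<phi>X adj_sym by (simp add: P_def)
    then show "z \<in> P \<times> Q"
      using \<phi> by (simp add: Q_def)
  qed
  have cP: "card P \<le> \<Delta>"
    unfolding P_def \<Delta>_def using deg_le[OF v(1)] by (simp only: of_nat_le_iff)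
  have cQ: "card Q \<le> \<Delta> ^ (len - 1)"
  proof -
    have "card Q \<le> (K * d) ^ (b - a - 1)"
      unfolding Q_def Xv_def using P1 inD aneb by (intro card_through_root[of _ "li a"]) auto
    then have "real (card Q) \<le> real ((K * d) ^ (b - a - 1))"
      by (simp only: of_nat_le_iff)
    then show ?thesis
      by (simp add: \<Delta>_def len_def)
  qed
  have pw: "\<Delta> * \<Delta> ^ (len - 1) = \<Delta> ^ len"
    using len(1) by (simp flip: power_Suc)
  have \<Delta>0: "0 < \<Delta>"
    using \<Delta>1 by simp
  define Q' where "Q' = {u \<in> Q. c * \<Delta> / 2 \<le> card {w. (w, u) \<in> A}}"
  have cQ': "c * \<Delta> ^ (len - 1) / 2 \<le> card Q'"
    unfolding Q'_def
  proof (rule dense_degree[OF finP finQ AP cP cQ])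
    show "c * \<Delta> * \<Delta> ^ (len - 1) \<le> card A"
      using cA pw by (simp add: mult.assoc)
  qed (use \<Delta>0 c0 in auto)
  have finQ': "finite Q'"
    using finQ by (simp add: Q'_def)
  have Q'ne: "Q' \<noteq> {}"
  proof
    assume "Q' = {}"
    then show False
      using cQ' c0 \<Delta>0 by (simp add: divide_le_eq) (smt (verit) mult_pos_pos zero_less_power)
  qed
  have degQ': "c * \<Delta> / 2 \<le> card {w \<in> P. (w, u) \<in> A}" if "u \<in> Q'" for u
  proof -
    have "{w \<in> P. (w, u) \<in> A} = {w. (w, u) \<in> A}"
      using AP by blast
    then show ?thesis
      using that by (simp add: Q'_def)
  qed
  \<comment> \<open>Here the degree bound is \<open>c * \<Delta> / 2\<close> and the size bound
    \<open>\<Delta>\<close>, so each of the \<open>t\<close> rounds keeps the proportion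
    \<open>c / 4\<close>, independently of the host.\<close>
  have "\<exists>T U. T \<subseteq> P \<and> card T = t \<and> U \<subseteq> Q' \<and> (c * \<Delta> / 2 / (2 * \<Delta>)) ^ t * card Q' \<le> card U \<and> (\<forall>w\<in>T. \<forall>u\<in>U. (w, u) \<in> A)"
    using d2 c0 \<Delta>0 by (intro common_neighbours finP finQ' cP Q'ne degQ') (simp_all add: \<Delta>_def)
  then obtain T U where TU: "T \<subseteq> P" "card T = t" "U \<subseteq> Q'" "(c * \<Delta> / 2 / (2 * \<Delta>)) ^ t * card Q' \<le> card U"
    "\<forall>w\<in>T. \<forall>u\<in>U. (w, u) \<in> A"
    by (elim exE conjE)
  have finU: "finite U"
    using TU(3) finQ' finite_subset by blast
  have c4: "c * \<Delta> / 2 / (2 * \<Delta>) = c / 4"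
    using \<Delta>0 by simp
  have "(c / 4) ^ t * card Q' \<le> card U"
    using TU(4) unfolding c4 .
  moreover have "(c / 4) ^ t * (c * \<Delta> ^ (len - 1) / 2) \<le> (c / 4) ^ t * card Q'"
    using cQ' c0 by (intro mult_left_mono) simp_all
  ultimately have Ularge: "(c / 4) ^ t * (c / 2) * \<Delta> ^ (len - 1) \<le> card U"
    by (simp add: mult_ac)
  have "\<Delta> ^ 1 \<le> \<Delta> ^ (len - 1)"
    using \<Delta>1 len(1) by (intro power_increasing) simp_all
  then have "(c / 4) ^ t * (c / 2) * \<Delta> \<le> (c / 4) ^ t * (c / 2) * \<Delta> ^ (len - 1)"
    using c0 by (intro mult_left_mono) simp_all
  then have "real (s + t) \<le> card U"
    using d3 Ularge unfolding \<Delta>_def by linarith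
  then have cU: "s + t \<le> card U"
    by (simp only: of_nat_le_iff)
  define G where "G = {x \<in> V. h0 \<le> card {u \<in> U. adj x u}}"
  have finG: "finite G"
    using finV by (simp add: G_def)
  define Bx where "Bx w u = {\<psi> P2 |\<psi>. \<psi> \<in> X \<and> \<psi> (li a) = w \<and> \<psi> (li b) = u}" for w u
  define R where "R w = (\<lambda>\<psi>. \<psi> P2) ` {\<psi> \<in> X. \<psi> (li a) = w}" for w
  have finBx: "finite (Bx w u)" for w u
    using finX by (simp add: Bx_def)
  have finR: "finite (R w)" for w
    using finX by (simp add: R_def)
  have finAu: "finite {w. (w, u) \<in> A}" for u
    using AP by (intro finite_subset[OF _ finP]) auto
  have BxH: "H \<le> card (Bx w u)" if wu: "(w, u) \<in> A" for w u
  proof -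
    obtain \<phi> where "\<phi> \<in> Xv v" "(w, u) = (\<phi> (li a), \<phi> (li b))"
      using wu unfolding A_def by blast
    then have \<phi>: "\<phi> \<in> X" "\<phi> (li a) = w" "\<phi> (li b) = u"
      by (simp_all add: Xv_def)
    have "{\<psi> P2 |\<psi>. \<psi> \<in> X \<and> (\<forall>p\<in>B. \<psi> p = \<phi> p)} = Bx w u"
      using \<phi>(2,3) by (simp add: Bx_def)
    then show ?thesis
      using core_branch[OF co \<phi>(1) P2] by simp
  qed
  define Tr where "Tr = (SIGMA u:U. SIGMA w:{w. (w, u) \<in> A}. Bx w u)"
  have finS: "finite (SIGMA w:{w. (w, u) \<in> A}. Bx w u)" for u
    using finAu finBx by (intro finite_SigmaI)
  have lower: "real (card U) * (c * \<Delta> / 2) * real H \<le> card Tr"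
  proof -
    have "card Tr = (\<Sum>u\<in>U. card (SIGMA w:{w. (w, u) \<in> A}. Bx w u))"
      unfolding Tr_def using finU finS by (intro card_SigmaI) auto
    moreover have "card (SIGMA w:{w. (w, u) \<in> A}. Bx w u) = (\<Sum>w\<in>{w. (w, u) \<in> A}. card (Bx w u))" for u
      using finAu finBx by (intro card_SigmaI) auto
    ultimately have "real (card Tr) = (\<Sum>u\<in>U. real (\<Sum>w\<in>{w. (w, u) \<in> A}. card (Bx w u)))"
      by simp
    moreover have "c * \<Delta> / 2 * real H \<le> real (\<Sum>w\<in>{w. (w, u) \<in> A}. card (Bx w u))" if "u \<in> U" for u
    proof -
      have "c * \<Delta> / 2 * real H \<le> real (card {w. (w, u) \<in> A}) * real H"
        using that TU(3) by (intro mult_right_mono) (auto simp: Q'_def)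
      also have "\<dots> = real (\<Sum>w\<in>{w. (w, u) \<in> A}. H)"
        by simp
      also have "\<dots> \<le> real (\<Sum>w\<in>{w. (w, u) \<in> A}. card (Bx w u))"
        using BxH by (intro of_nat_mono sum_mono) simp
      finally show ?thesis .
    qed
    ultimately have "(\<Sum>u\<in>U. c * \<Delta> / 2 * real H) \<le> real (card Tr)"
      by (simp only: sum_mono)
    then show ?thesis
      by (simp add: mult.assoc)
  qed
  let ?T1 = "SIGMA w:P. SIGMA x:(R w - G). {u \<in> U. adj x u}"
  let ?T2 = "SIGMA x:G. {u. adj x u} \<times> P"
  have fin1: "finite (SIGMA x:(R w - G). {u \<in> U. adj x u})" for w
    using finR finU by (intro finite_SigmaI) auto
  \<comment> \<open>Outside \<open>G\<close> a vertex \<open>x\<close> has at most \<open>h0\<close>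
    neighbours in \<open>U\<close>, and for each of the at most \<open>\<Delta>\<close> vertices
    \<open>w\<close> there are at most \<open>\<Delta> ^ (len - 1)\<close> such \<open>x\<close>. A
    vertex of \<open>G\<close> lies in at most \<open>\<Delta>\<^sup>2\<close> triples, by the
    choice of one neighbour \<open>u\<close> and one \<open>w\<close> in \<open>P\<close>.\<close>
  have upper: "card Tr \<le> K * d * ((K * d) ^ (b - a - 1) * h0) + card G * (K * d * (K * d))"
  proof -
    have "Tr \<subseteq> (\<lambda>(w, x, u). (u, w, x)) ` ?T1 \<union> (\<lambda>(x, u, w). (u, w, x)) ` ?T2"
    proof
      fix z assume "z \<in> Tr"
      then obtain u w x where z: "z = (u, w, x)" "u \<in> U" "(w, u) \<in> A" "x \<in> Bx w u"
        unfolding Tr_def by blast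
      then obtain \<psi> where \<psi>: "\<psi> \<in> X" "\<psi> (li a) = w" "\<psi> (li b) = u" "x = \<psi> P2"
        unfolding Bx_def by blast
      have wP: "w \<in> P"
        using AP z(3) by blast
      have xR: "x \<in> R w"
        using \<psi> by (auto simp: R_def)
      have "leg_adj P2 (li b)"
      proof -
        have "Suc (b - 1) = b"
          using ab by simp
        then show ?thesis
          using line_adj[of k i i' "b - 1"] unfolding P2_def by (simp only:)
      qed
      then have "adj x u"
        using \<psi> P2 inD X_Emb[OF \<psi>(1)] Emb_adj[of \<psi> D P2 "li b"] by simp
      show "z \<in> (\<lambda>(w, x, u). (u, w, x)) ` ?T1 \<union> (\<lambda>(x, u, w). (u, w, x)) ` ?T2"
      proof (cases "x \<in> G")
        case True
        then have "(x, u, w) \<in> ?T2"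
          using wP \<open>adj x u\<close> by simp
        then have "z \<in> (\<lambda>(x, u, w). (u, w, x)) ` ?T2"
          using z(1) by (intro image_eqI[of _ _ "(x, u, w)"]) simp_all
        then show ?thesis ..
      next
        case False
        then have "(w, x, u) \<in> ?T1"
          using wP xR \<open>adj x u\<close> z(2) by simp
        then have "z \<in> (\<lambda>(w, x, u). (u, w, x)) ` ?T1"
          using z(1) by (intro image_eqI[of _ _ "(w, x, u)"]) simp_all
        then show ?thesis ..
      qed
    qed
    moreover have fT: "finite ?T1" "finite ?T2"
      using fin1 finP finG fin_nb by (auto intro!: finite_SigmaI)
    ultimately have "card Tr \<le> card ((\<lambda>(w, x, u). (u, w, x)) ` ?T1 \<union> (\<lambda>(x, u, w). (u, w, x)) ` ?T2)"
      by (intro card_mono) auto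
    also have "\<dots> \<le> card ?T1 + card ?T2"
      using card_Un_le[of "(\<lambda>(w, x, u). (u, w, x)) ` ?T1" "(\<lambda>(x, u, w). (u, w, x)) ` ?T2"]
        card_image_le[OF fT(1), of "\<lambda>(w, x, u). (u, w, x)"] card_image_le[OF fT(2), of "\<lambda>(x, u, w). (u, w, x)"]
      by linarith
    also have "card ?T1 \<le> K * d * ((K * d) ^ (b - a - 1) * h0)"
    proof -
      have "card ?T1 = (\<Sum>w\<in>P. card (SIGMA x:(R w - G). {u \<in> U. adj x u}))"
        using finP fin1 by (intro card_SigmaI) auto
      also have "\<dots> \<le> (\<Sum>w\<in>P. (K * d) ^ (b - a - 1) * h0)"
      proof (rule sum_mono)
        fix w
        have "card (SIGMA x:(R w - G). {u \<in> U. adj x u}) = (\<Sum>x\<in>R w - G. card {u \<in> U. adj x u})"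
          using finR finU by (intro card_SigmaI) auto
        also have "\<dots> \<le> (\<Sum>x\<in>R w - G. h0)"
        proof (rule sum_mono)
          fix x assume x: "x \<in> R w - G"
          then have "x \<in> V"
            using X_Emb Emb_V P2 unfolding R_def by blast
          then show "card {u \<in> U. adj x u} \<le> h0"
            using x by (simp add: G_def)
        qed
        also have "\<dots> = card (R w - G) * h0"
          by simp
        also have "\<dots> \<le> card (R w) * h0"
          using finR by (intro mult_le_mono1 card_mono) auto
        also have "\<dots> \<le> (K * d) ^ (b - a - 1) * h0"
        proof (rule mult_le_mono1)
          have "P2 \<in> D" "P2 \<noteq> li b" "li b \<in> B"
            using P2 by simp_all
          from card_through_root[OF inD(1) aneb this(3,1,2)] show "card (R w) \<le> (K * d) ^ (b - a - 1)"
            unfolding R_def .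
        qed
        finally show "card (SIGMA x:(R w - G). {u \<in> U. adj x u}) \<le> (K * d) ^ (b - a - 1) * h0" .
      qed
      also have "\<dots> = card P * ((K * d) ^ (b - a - 1) * h0)"
        by simp
      also have "\<dots> \<le> K * d * ((K * d) ^ (b - a - 1) * h0)"
        unfolding P_def using deg_le[OF v(1)] by (rule mult_le_mono1)
      finally show ?thesis .
    qed
    also have "card ?T2 \<le> card G * (K * d * (K * d))"
    proof -
      have "card ?T2 = (\<Sum>x\<in>G. card ({u. adj x u} \<times> P))"
        using finG finP fin_nb by (intro card_SigmaI) auto
      also have "\<dots> \<le> (\<Sum>x\<in>G. K * d * (K * d))"
      proof (rule sum_mono)
        fix x assume "x \<in> G"
        then have "x \<in> V"
          by (simp add: G_def)
        then show "card ({u. adj x u} \<times> P) \<le> K * d * (K * d)"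
          unfolding card_cartesian_product P_def using deg_le v(1) by (intro mult_le_mono)
      qed
      finally show ?thesis by simp
    qed
    finally show ?thesis by simp
  qed
  \<comment> \<open>By the choice of \<open>H\<close> there are at least
    \<open>2 * (h0 + s + t) * \<Delta> ^ len\<close> triples, and those with \<open>x\<close>
    outside \<open>G\<close> use up at most \<open>h0 * \<Delta> ^ len\<close>. The rest forces
    \<open>s + t\<close> vertices in \<open>G\<close> because \<open>2 \<le> len\<close>.\<close>
  have cG: "s + t \<le> card G"
  proof -
    let ?c' = "(c / 4) ^ t * (c / 2) * (c / 2)"
    have "real (card Tr) \<le> real (K * d * ((K * d) ^ (b - a - 1) * h0) + card G * (K * d * (K * d)))"
      using upper by (simp only: of_nat_le_iff)
    also have "\<dots> = \<Delta> * \<Delta> ^ (len - 1) * real h0 + real (card G) * \<Delta>\<^sup>2"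
      by (simp add: \<Delta>_def len_def power2_eq_square mult_ac)
    also have "\<dots> = \<Delta> ^ len * real h0 + real (card G) * \<Delta>\<^sup>2"
      unfolding pw ..
    finally have up: "real (card Tr) \<le> \<Delta> ^ len * real h0 + real (card G) * \<Delta>\<^sup>2" .
    have "?c' * \<Delta> ^ len * real H = ((c / 4) ^ t * (c / 2) * \<Delta> ^ (len - 1)) * (c * \<Delta> / 2) * real H"
      unfolding pw[symmetric] by (simp add: mult_ac)
    also have "\<dots> \<le> real (card U) * (c * \<Delta> / 2) * real H"
      using Ularge c0 \<Delta>0 by (intro mult_right_mono) simp_all
    finally have lo: "?c' * \<Delta> ^ len * real H \<le> real (card Tr)"
      using lower by linarith
    have "\<Delta> ^ len * (2 * real (h0 + s + t)) \<le> \<Delta> ^ len * (real H * ?c')"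
      using H \<Delta>0 by (intro mult_left_mono) simp_all
    then have "\<Delta> ^ len * (2 * real (h0 + s + t)) \<le> \<Delta> ^ len * real h0 + real (card G) * \<Delta>\<^sup>2"
    proof -
      have "\<Delta> ^ len * (real H * ?c') = ?c' * \<Delta> ^ len * real H"
        by (simp only: mult_ac)
      then show ?thesis
        using lo up \<open>\<Delta> ^ len * (2 * real (h0 + s + t)) \<le> \<Delta> ^ len * (real H * ?c')\<close> by linarith
    qed
    moreover have "\<Delta> ^ len * real h0 + \<Delta> ^ len * real (s + t) \<le> \<Delta> ^ len * (2 * real (h0 + s + t))"
      unfolding distrib_left[symmetric] using \<Delta>0 by (intro mult_left_mono) simp_all
    ultimately have "\<Delta> ^ len * real (s + t) \<le> real (card G) * \<Delta>\<^sup>2"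
      by linarith
    moreover have "\<Delta>\<^sup>2 * real (s + t) \<le> \<Delta> ^ len * real (s + t)"
      using \<Delta>1 len(1) by (intro mult_right_mono power_increasing) simp_all
    ultimately have "\<Delta>\<^sup>2 * real (s + t) \<le> \<Delta>\<^sup>2 * real (card G)"
      by (simp add: mult_ac)
    then have "real (s + t) \<le> real (card G)"
      using \<Delta>0 by simp
    then show ?thesis
      by (simp only: of_nat_le_iff)
  qed
  have rel: "\<forall>w\<in>T. \<forall>u\<in>U. \<exists>\<phi>\<in>X. \<phi> (li a) = w \<and> \<phi> (li b) = u"
  proof (intro ballI)
    fix w u assume "w \<in> T" "u \<in> U"
    then have "(w, u) \<in> A"
      using TU(5) by blast
    then obtain \<phi> where "\<phi> \<in> Xv v" "(w, u) = (\<phi> (li a), \<phi> (li b))"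
      unfolding A_def by blast
    then show "\<exists>\<phi>\<in>X. \<phi> (li a) = w \<and> \<phi> (li b) = u"
      by (intro bexI[of _ \<phi>]) (simp_all add: Xv_def)
  qed
  have "finite T"
    using TU(1) finP finite_subset by blast
  moreover have "\<forall>x\<in>G. h0 \<le> card {u \<in> U. adj x u}"
    by (simp add: G_def)
  ultimately show ?thesis
    using TU(2) finU finG cU cG rel by (intro exI[of _ T] exI[of _ U] exI[of _ G] conjI)
qed

end

context spider_host
begin

text \<open>Greedy once more, now over the legs of one spider: a new leg avoids \<open>Z0\<close>,
  the centre, all feet and the interiors of the earlier legs, which is what \<open>z\<close>
  counts.\<close>

lemma legs_to_spider:
  fixes x :: "nat \<Rightarrow> 'a"
  assumes xy: "\<And>i. i < s \<Longrightarrow> x i \<noteq> y" and x: "inj_on x {..<s}" and Z0: "finite Z0" "y \<notin> Z0"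
    and z: "card Z0 + 1 + s + s * k \<le> z"
    and legs: "\<And>i Z. i < s \<Longrightarrow> finite Z \<Longrightarrow> card Z \<le> z \<Longrightarrow>
      \<exists>g. g 0 = y \<and> g k = x i \<and> (\<forall>j<k. adj (g j) (g (Suc j))) \<and> inj_on g {..k} \<and> g ` {1..<k} \<inter> Z = {}"
  shows "\<exists>\<sigma>\<in>Emb full. (\<forall>i<s. \<sigma> (leg i k) = x i) \<and> \<sigma> ` (full - ends) \<inter> Z0 = {}"
proof -
  let ?Z = "Z0 \<union> {y} \<union> x ` {..<s}"
  have "\<exists>g. (\<forall>i<n. g i 0 = y \<and> g i k = x i \<and> (\<forall>j<k. adj (g i j) (g i (Suc j))) \<and> inj_on (g i) {..k} \<and>
        g i ` {1..<k} \<inter> ?Z = {}) \<and>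
      (\<forall>i<n. \<forall>i'<n. i \<noteq> i' \<longrightarrow> g i ` {1..<k} \<inter> g i' ` {1..<k} = {})" if "n \<le> s" for n
    using that
  proof (induction n)
    case 0
    then show ?case by simp
  next
    case (Suc n)
    then have "n \<le> s" by simp
    from Suc.IH[OF this] obtain g where
      g1: "\<forall>i<n. g i 0 = y \<and> g i k = x i \<and> (\<forall>j<k. adj (g i j) (g i (Suc j))) \<and> inj_on (g i) {..k} \<and>
        g i ` {1..<k} \<inter> ?Z = {}"
      and g2: "\<forall>i<n. \<forall>i'<n. i \<noteq> i' \<longrightarrow> g i ` {1..<k} \<inter> g i' ` {1..<k} = {}"
      by (elim exE conjE)
    have ns: "n < s"
      using Suc.prems by simp
    define Z1 where "Z1 = (\<Union>i<n. g i ` {1..<k})"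
    have "card Z1 \<le> (\<Sum>i<n. card (g i ` {1..<k}))"
      unfolding Z1_def by (rule card_UN_le) simp
    also have "\<dots> \<le> (\<Sum>i<n. k)"
    proof (rule sum_mono)
      fix i
      show "card (g i ` {1..<k}) \<le> k"
        using card_image_le[of "{1..<k}" "g i"] by simp
    qed
    also have "\<dots> \<le> s * k"
      using ns by simp
    finally have c1: "card Z1 \<le> s * k" .
    have "card ?Z \<le> card Z0 + 1 + s"
      using card_Un_le[of "Z0 \<union> {y}" "x ` {..<s}"] card_Un_le[of Z0 "{y}"] card_image_le[of "{..<s}" x] by simp
    then have c: "card (?Z \<union> Z1) \<le> z"
      using c1 z card_Un_le[of ?Z Z1] by linarith
    have "finite (?Z \<union> Z1)"
      using Z0 by (simp add: Z1_def)
    from legs[OF ns this c] obtain p where p: "p 0 = y" "p k = x n" "\<forall>j<k. adj (p j) (p (Suc j))" "inj_on p {..k}"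
      "p ` {1..<k} \<inter> (?Z \<union> Z1) = {}"
      by (elim exE conjE)
    have p1: "p ` {1..<k} \<inter> ?Z = {}"
      using p(5) by blast
    have p2: "p ` {1..<k} \<inter> g i ` {1..<k} = {}" if "i < n" for i
    proof -
      have "g i ` {1..<k} \<subseteq> Z1"
        unfolding Z1_def using that by blast
      then show ?thesis
        using p(5) by blast
    qed
    show ?case
    proof (intro exI[of _ "g(n := p)"] conjI allI impI)
      fix i i' assume "i < Suc n" "i' < Suc n" "i \<noteq> i'"
      then consider "i = n" "i' < n" | "i' = n" "i < n" | "i < n" "i' < n"
        by linarith
      then show "(g(n := p)) i ` {1..<k} \<inter> (g(n := p)) i' ` {1..<k} = {}"
      proof cases
        case 1
        then show ?thesis
          using p2[of i'] by simp
      next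
        case 2
        then show ?thesis
          using p2[of i] by (simp add: Int_commute)
      next
        case 3
        then show ?thesis
          using g2 \<open>i \<noteq> i'\<close> by simp
      qed
    next
      fix i assume i: "i < Suc n"
      show "(g(n := p)) i 0 = y"
        using i g1 p(1) by (cases "i = n") simp_all
      show "(g(n := p)) i k = x i"
        using i g1 p(2) by (cases "i = n") simp_all
      show "inj_on ((g(n := p)) i) {..k}"
        using i g1 p(4) by (cases "i = n") simp_all
      show "(g(n := p)) i ` {1..<k} \<inter> ?Z = {}"
      proof (cases "i = n")
        case True
        then show ?thesis using p1 by simp
      next
        case False
        then have "g i ` {1..<k} \<inter> ?Z = {}" using i g1 by simp
        then show ?thesis using False by simp
      qed
      fix j assume "j < k"
      then show "adj ((g(n := p)) i j) ((g(n := p)) i (Suc j))"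
        using i g1 p(3) by (cases "i = n") simp_all
    qed
  qed
  from this[OF order_refl] obtain g where
    g1: "\<forall>i<s. g i 0 = y \<and> g i k = x i \<and> (\<forall>j<k. adj (g i j) (g i (Suc j))) \<and> inj_on (g i) {..k} \<and>
        g i ` {1..<k} \<inter> ?Z = {}"
    and g2: "\<forall>i<s. \<forall>i'<s. i \<noteq> i' \<longrightarrow> g i ` {1..<k} \<inter> g i' ` {1..<k} = {}"
    by (elim exE conjE)
  have g0: "g i 0 = y" and gk: "g i k = x i" if "i < s" for i
    using g1 that by simp_all
  have gadj: "adj (g i j) (g i (Suc j))" if "i < s" "j < k" for i j
    using g1 that by simp
  have gint: "g i j \<notin> ?Z" if "i < s" "0 < j" "j < k" for i j
  proof -
    have "g i j \<in> g i ` {1..<k}"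
      using that by simp
    moreover have "g i ` {1..<k} \<inter> ?Z = {}"
      using g1 that(1) by simp
    ultimately show ?thesis
      by blast
  qed
  have ginj: "j = j' \<and> (j = 0 \<or> i = i')"
    if i: "i < s" "i' < s" "j \<le> k" "j' \<le> k" and eq: "g i j = g i' j'" for i j i' j'
  proof (cases "i = i'")
    case True
    have "inj_on (g i) {..k}"
      using g1 i(1) by simp
    then show ?thesis
      using True eq i(3,4) by (auto dest: inj_onD)
  next
    case False
    have yz: "y \<in> ?Z" and xz: "x i \<in> ?Z" "x i' \<in> ?Z"
      using i by auto
    have cj: "j = 0 \<or> j = k \<or> 0 < j \<and> j < k" and cj': "j' = 0 \<or> j' = k \<or> 0 < j' \<and> j' < k"
      using i(3,4) by linarith+
    consider "j = 0" "j' = 0" | "j = 0" "j' = k" | "j = k" "j' = 0" | "j = k" "j' = k"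
      | "0 < j" "j < k" "j' = 0 \<or> j' = k" | "0 < j'" "j' < k" "j = 0 \<or> j = k" | "0 < j" "j < k" "0 < j'" "j' < k"
      using cj cj' by blast
    then show ?thesis
    proof cases
      case 1
      then show ?thesis by simp
    next
      case 2
      then show ?thesis
        using eq g0[OF i(1)] gk[OF i(2)] xy[OF i(2)] by simp
    next
      case 3
      then show ?thesis
        using eq g0[OF i(2)] gk[OF i(1)] xy[OF i(1)] by simp
    next
      case 4
      then have "x i = x i'"
        using eq gk i by simp
      then show ?thesis
        using inj_onD[OF x, of i i'] i False by simp
    next
      case 5
      have "g i' j' \<in> ?Z"
        using 5(3) g0[OF i(2)] gk[OF i(2)] yz xz by (elim disjE) simp_all
      then show ?thesis
        using gint[OF i(1) 5(1,2)] eq by simp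
    next
      case 6
      have "g i j \<in> ?Z"
        using 6(3) g0[OF i(1)] gk[OF i(1)] yz xz by (elim disjE) simp_all
      then show ?thesis
        using gint[OF i(2) 6(1,2)] eq by simp
    next
      case 7
      then have "g i j \<in> g i ` {1..<k}" "g i' j' \<in> g i' ` {1..<k}"
        by simp_all
      moreover have "g i ` {1..<k} \<inter> g i' ` {1..<k} = {}"
        using g2 i False by simp
      ultimately show ?thesis
        using eq by (metis (no_types) IntI empty_iff)
    qed
  qed
  have "\<exists>\<sigma>\<in>Emb full. \<forall>i<s. \<forall>j\<le>k. \<sigma> (leg i j) = g i j"
    using g0 gadj ginj by (rule emb_of_legs)
  then obtain \<sigma> where \<sigma>: "\<sigma> \<in> Emb full" "\<forall>i<s. \<forall>j\<le>k. \<sigma> (leg i j) = g i j" ..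
  have "\<sigma> p \<notin> Z0" if p: "p \<in> full - ends" for p
  proof -
    obtain i j where ij: "i < s" "j < k" "p = leg i j"
      using p by (rule interiorE)
    have "\<sigma> p = g i j"
      using \<sigma>(2) ij by simp
    moreover have "g i j \<notin> Z0"
    proof (cases "j = 0")
      case True
      then show ?thesis
        using g0[OF ij(1)] Z0(2) by simp
    next
      case False
      then show ?thesis
        using gint[OF ij(1) _ ij(2)] by simp
    qed
    ultimately show ?thesis
      by simp
  qed
  then have "\<sigma> ` (full - ends) \<inter> Z0 = {}"
    by blast
  moreover have "\<forall>i<s. \<sigma> (leg i k) = x i"
    using \<sigma>(2) gk by simp
  ultimately show ?thesis
    using \<sigma>(1) by blast
qed

end

context path_core
begin

text \<open>Only the end \<open>li b\<close> is moved; the end \<open>li a\<close> stays at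
  \<open>y\<close>, the future centre. Zigzags make up an even deficit in length, and the edge from
  \<open>u\<close> to \<open>x\<close> supplies the missing one if the deficit is odd.\<close>

lemma path_leg:
  assumes \<phi>: "\<phi> \<in> X" "\<phi> (li a) = y" "\<phi> (li b) = u"
    and e1: "(k - (b - a)) mod 2 = 1 \<Longrightarrow> adj u x \<and> u \<notin> Z" and e0: "(k - (b - a)) mod 2 = 0 \<Longrightarrow> u = x"
    and xy: "x \<noteq> y" and Z: "finite Z" and h: "card Z + 1 + card full * (k + 2) < H" and hL: "H \<le> L (card D)"
  shows "\<exists>g. g 0 = y \<and> g k = x \<and> (\<forall>j<k. adj (g j) (g (Suc j))) \<and> inj_on g {..k} \<and> g ` {1..<k} \<inter> Z = {}"
proof -
  define l where "l = b - a"
  define e where "e = (k - l) mod 2"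
  define M where "M = 2 * ((k - l) div 2)"
  define m where "m p = (if p = li b then (k - l) div 2 else 0)" for p
  have l: "2 \<le> l" "l \<le> k" "a + l = b"
    using ab by (auto simp: l_def)
  have ele: "e \<le> 1"
    by (simp add: e_def)
  have len: "l + M + e = k"
  proof -
    have "2 * ((k - l) div 2) + (k - l) mod 2 = k - l"
      by simp
    then show ?thesis
      using l(2) unfolding M_def e_def by linarith
  qed
  have aneb: "li a \<noteq> li b"
    using li_eq ab by simp
  have aD: "li (a + j) \<in> D" if "j \<le> l" for j
    using that l(3) by simp
  have int: "li (a + j) \<in> D - B" if "0 < j" "j < l" for j
  proof -
    have "a + j \<in> {a..b}" "a + j \<noteq> a" "a + j \<noteq> b"
      using that l(3) by auto
    then show ?thesis
      using li_eq by blast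
  qed
  let ?Z' = "insert x Z"
  have finZ': "finite ?Z'"
    using Z by simp
  have cZ': "card ?Z' + card full * (k + 2) < H"
    using h card_insert_le_m1[of "Suc (card Z)" Z x] Z by (simp add: card_insert_if split: if_splits)
  have mk: "\<forall>p\<in>B. 2 * m p \<le> k"
    by (auto simp: m_def)
  from core_realize[OF fam co \<phi>(1) finZ' mk cZ' hL]
  obtain \<tau> q where \<tau>: "\<tau> \<in> Emb D" and q1: "\<forall>p\<in>B. q p 0 = \<phi> p" "\<forall>p\<in>B. q p (2 * m p) = \<tau> p"
    "\<forall>p\<in>B. walk (q p) (2 * m p)" "\<forall>p\<in>B. q p ` {1..2 * m p} \<inter> (?Z' \<union> \<phi> ` B) = {}"
    "\<forall>p\<in>B. \<forall>p'\<in>B. p \<noteq> p' \<longrightarrow> q p ` {..2 * m p} \<inter> q p' ` {..2 * m p'} = {}"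
    and dis: "\<tau> ` (D - B) \<inter> (?Z' \<union> (\<Union>p\<in>B. q p ` {..2 * m p})) = {}"
    by (elim exE conjE)
  define Q where "Q = q (li b)"
  have mb: "2 * m (li b) = M" and ma: "2 * m (li a) = 0"
    using aneb by (simp_all add: m_def M_def)
  have Q0: "Q 0 = u"
    using q1(1) \<phi>(3) by (simp add: Q_def)
  have QM: "Q M = \<tau> (li b)"
    using bspec[OF q1(2), of "li b"] unfolding mb Q_def by simp
  have wQ: "walk Q M"
    using bspec[OF q1(3), of "li b"] unfolding mb Q_def by simp
  have Qinj: "c = c'" if "c \<le> M" "c' \<le> M" "Q c = Q c'" for c c'
    using wQ that unfolding walk_def by (auto dest: inj_onD)
  have Qadj: "adj (Q c) (Q (Suc c))" if "c < M" for c
    using wQ that unfolding walk_def by blast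
  have QZ: "Q c \<notin> ?Z'" if "c \<le> M" "1 \<le> c" for c
  proof -
    have "Q ` {1..M} \<inter> (?Z' \<union> \<phi> ` B) = {}"
      using bspec[OF q1(4), of "li b"] unfolding mb Q_def by simp
    moreover have "Q c \<in> Q ` {1..M}"
      using that by simp
    ultimately show ?thesis
      by blast
  qed
  have \<tau>a: "\<tau> (li a) = y"
    using bspec[OF q1(2), of "li a"] bspec[OF q1(1), of "li a"] \<phi>(2) unfolding ma by simp
  have yQ: "Q c \<noteq> y" if "c \<le> M" for c
  proof -
    have "q (li a) ` {..2 * m (li a)} \<inter> q (li b) ` {..2 * m (li b)} = {}"
      using bspec[OF bspec[OF q1(5), of "li a"], of "li b"] aneb by simp
    moreover have "y \<in> q (li a) ` {..2 * m (li a)}"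
      using bspec[OF q1(1), of "li a"] \<phi>(2) by (intro image_eqI[of _ _ 0]) simp_all
    moreover have "Q c \<in> q (li b) ` {..2 * m (li b)}"
      unfolding mb Q_def using that by simp
    ultimately show ?thesis
      by blast
  qed
  define f where "f j = \<tau> (li (a + j))" for j
  have fQ: "f j \<noteq> Q c" if "j < l" "c \<le> M" for j c
  proof (cases "j = 0")
    case True
    then show ?thesis
      using \<tau>a yQ[OF that(2)] by (simp add: f_def)
  next
    case False
    then have "f j \<in> \<tau> ` (D - B)"
      using int[of j] that(1) unfolding f_def by blast
    moreover have "Q c \<in> (\<Union>p\<in>B. q p ` {..2 * m p})"
      using that(2) mb unfolding Q_def by blast
    ultimately show ?thesis
      using dis by (metis (no_types) IntI UnI2 empty_iff)
  qed
  have fZ: "f j \<notin> ?Z'" if "0 < j" "j < l" for j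
    using dis imageI[OF int[OF that], of \<tau>] unfolding f_def by (metis (no_types) IntI UnI1 empty_iff)
  have fx: "f j \<noteq> x" if "j < l" for j
    using fZ[of j] that \<tau>a xy by (cases "j = 0") (auto simp: f_def)
  have Qx: "Q c \<noteq> x" if "e = 1" "c \<le> M" for c
  proof (cases "c = 0")
    case True
    have "adj u x"
      using e1 that(1) by (simp add: e_def l_def)
    then show ?thesis
      using True Q0 adj_irrefl by auto
  next
    case False
    then show ?thesis
      using QZ[OF that(2)] by simp
  qed
  define g where "g = join_leg f l e x Q k"
  have gadj: "adj (g j) (g (Suc j))" if "j < k" for j
    unfolding g_def
  proof (rule join_leg_adj[OF len ele])
    show "Q M = f l"
      using QM l(3) by (simp add: f_def)
    show "adj (f j) (f (Suc j))" if "j < l" for j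
      unfolding f_def using that aD[of j] aD[of "Suc j"] line_adj[of k i i' "a + j"] by (intro Emb_adj[OF \<tau>]) simp_all
    show "adj (Q j) (Q (Suc j))" if "j < M" for j
      using Qadj[OF that] .
    show "adj (Q 0) x" if "e = 1"
      using e1 that Q0 by (simp add: e_def l_def)
  qed (rule that)
  have ginj: "inj_on g {..k}"
  proof (rule inj_onI)
    fix j j' assume "j \<in> {..k}" "j' \<in> {..k}" and eq: "g j = g j'"
    then have j: "j \<le> k" "j' \<le> k"
      by simp_all
    show "j = j'"
    proof (cases rule: join_leg_cases[OF len ele j(1), of f x Q, case_names inner walk last])
      case inner
      note 1 = inner
      show ?thesis
      proof (cases rule: join_leg_cases[OF len ele j(2), of f x Q, case_names inner walk last])
        case inner
        then have "\<tau> (li (a + j)) = \<tau> (li (a + j'))"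
          using 1 eq by (simp add: g_def f_def)
        then have "li (a + j) = li (a + j')"
          using Emb_inj[OF \<tau> aD aD, of j j'] 1(1) inner(1) by simp
        then show ?thesis
          using li_eq by simp
      next
        case (walk c)
        then show ?thesis
          using 1 eq fQ[OF 1(1) walk(2)] by (simp add: g_def)
      next
        case last
        then show ?thesis
          using 1 eq fx[OF 1(1)] by (simp add: g_def)
      qed
    next
      case (walk c)
      note 1 = walk
      show ?thesis
      proof (cases rule: join_leg_cases[OF len ele j(2), of f x Q, case_names inner walk last])
        case inner
        then show ?thesis
          using 1 eq fQ[OF inner(1) 1(2)] by (simp add: g_def)
      next
        case (walk c')
        then have "Q c = Q c'"
          using 1 eq by (simp add: g_def)
        then have "c = c'"
          by (rule Qinj[OF 1(2) walk(2)])
        then show ?thesis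
          using 1(3) walk(3) by simp
      next
        case last
        then show ?thesis
          using 1 eq Qx[OF last(1) 1(2)] by (simp add: g_def)
      qed
    next
      case last
      note 1 = last
      show ?thesis
      proof (cases rule: join_leg_cases[OF len ele j(2), of f x Q, case_names inner walk last])
        case inner
        then show ?thesis
          using 1 eq fx[OF inner(1)] by (simp add: g_def)
      next
        case (walk c')
        then show ?thesis
          using 1 eq Qx[OF 1(1) walk(2)] by (simp add: g_def)
      next
        case last
        then show ?thesis
          using 1(2) by simp
      qed
    qed
  qed
  have g0: "g 0 = y"
    using l(1) \<tau>a by (simp add: g_def join_leg_def f_def)
  have gk: "g k = x"
  proof (cases rule: join_leg_cases[OF len ele order_refl, of f x Q, case_names inner walk last])
    case inner
    then show ?thesis
      using len by simp
  next
    case (walk c)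
    then have "c = 0" "e = 0"
      by simp_all
    then show ?thesis
      using walk Q0 e0 by (simp add: g_def e_def l_def)
  next
    case last
    then show ?thesis
      by (simp add: g_def)
  qed
  have "g j \<notin> Z" if j: "0 < j" "j < k" for j
  proof (cases rule: join_leg_cases[OF len ele less_imp_le[OF j(2)], of f x Q, case_names inner walk last])
    case inner
    then show ?thesis
      using fZ[OF j(1)] by (simp add: g_def)
  next
    case (walk c)
    show ?thesis
    proof (cases "c = 0")
      case True
      then have "e = 1"
        using walk(3) j(2) ele by linarith
      then have "u \<notin> Z"
        using e1 by (simp add: e_def l_def)
      then show ?thesis
        using True walk(4) Q0 by (simp add: g_def)
    next
      case False
      then show ?thesis
        using QZ[OF walk(2)] walk(4) by (simp add: g_def)
    qed
  next
    case last
    then show ?thesis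
      using j(2) by simp
  qed
  then have "g ` {1..<k} \<inter> Z = {}"
    by fastforce
  then show ?thesis
    using g0 gk gadj ginj by (intro exI[of _ g]) simp
qed

text \<open>The vertices of \<open>T\<close> become the centres, and the feet are taken from
  \<open>G\<close> or \<open>U\<close> according to parity. As these sets have at least
  \<open>s + t\<close> elements, \<open>s\<close> feet remain outside \<open>T\<close>. The centres
  are known in advance, hence the reservations \<open>W\<close>.\<close>

lemma path_core_has_copy:
  fixes E t :: nat
  defines "c \<equiv> 1 / (2 * real E * real (F (card D - 1) ^ card (pieces s k)) * real (K ^ card full))"
    and "z \<equiv> t * (card full + 1) + 1 + s + s * k"
  assumes V: "V \<noteq> {}" and E: "1 \<le> E" and d1: "1 \<le> d" and many: "card V * d ^ (card D - 1) \<le> 2 * E * card X"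
    and d2: "4 * real t \<le> c * real (K * d)" and d3: "real (s + t) \<le> (c / 4) ^ t * (c / 2) * real (K * d)"
    and H: "2 * real (z + 1 + s + t) \<le> real H * ((c / 4) ^ t * (c / 2) * (c / 2))"
    and h: "z + 1 + card full * (k + 2) < H" and hL: "H \<le> L (card D)"
  shows "has_copy t"
proof -
  from path_initial[OF V E d1 many d2[unfolded c_def] d3[unfolded c_def] H[unfolded c_def]]
  obtain T U G where fin: "finite T" "finite U" "finite G" and cT: "card T = t" and cU: "s + t \<le> card U" and cG: "s + t \<le> card G"
    and rel: "\<forall>w\<in>T. \<forall>u\<in>U. \<exists>\<phi>\<in>X. \<phi> (li a) = w \<and> \<phi> (li b) = u"
    and G: "\<forall>x\<in>G. z + 1 \<le> card {u \<in> U. adj x u}"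
    by (elim exE conjE)
  define e where "e = (k - (b - a)) mod 2"
  define A where "A = (if e = 1 then G else U) - T"
  have finA: "finite A"
    using fin by (simp add: A_def)
  have "card (if e = 1 then G else U) - card T \<le> card A"
    unfolding A_def using fin(1) by (rule diff_card_le_card_Diff)
  then have cA: "s \<le> card A"
    using cU cG cT by (auto split: if_splits)
  obtain x where x: "bij_betw x {0..<card A} A"
    using ex_bij_betw_nat_finite[OF finA] by blast
  have xinj: "inj_on x {..<s}"
    using bij_betw_imp_inj_on[OF x] cA by (elim inj_on_subset) auto
  have xA: "x i \<in> A" if "i < s" for i
    using bij_betwE[OF x] that cA by simp
  obtain Y where "bij_betw Y {0..<card T} T"
    using ex_bij_betw_nat_finite[OF fin(1)] by blast
  then have Y: "inj_on Y {..<t}" "\<And>j. j < t \<Longrightarrow> Y j \<in> T"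
    using cT bij_betw_imp_inj_on bij_betwE by (fastforce simp: lessThan_atLeast0)+
  show ?thesis
  proof (rule has_copyI[where W = "\<lambda>j. {Y j}" and x = x])
    fix j j' assume "j < t" "j' < t" "j \<noteq> j'"
    then show "{Y j} \<inter> {Y j'} = {}"
      using inj_onD[OF Y(1), of j j'] by auto
  next
    fix j and Z0 :: "'a set" assume j: "j < t" and Z0: "finite Z0" "card Z0 \<le> t * (card full + 1)" "Z0 \<inter> {Y j} = {}"
    show "\<exists>\<sigma>\<in>Emb full. (\<forall>i<s. \<sigma> (leg i k) = x i) \<and> \<sigma> ` (full - ends) \<inter> Z0 = {}"
    proof (rule legs_to_spider[where y = "Y j" and z = z])
      fix i assume i: "i < s"
      show "x i \<noteq> Y j"
        using xA[OF i] Y(2)[OF j] by (auto simp: A_def)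
    next
      show "Y j \<notin> Z0"
        using Z0(3) by simp
      show "card Z0 + 1 + s + s * k \<le> z"
        using Z0(2) by (simp add: z_def)
    next
      fix i and Z :: "'a set" assume i: "i < s" and Z: "finite Z" "card Z \<le> z"
      have hZ: "card Z + 1 + card full * (k + 2) < H"
        using Z(2) h by linarith
      have xY: "x i \<noteq> Y j"
        using xA[OF i] Y(2)[OF j] by (auto simp: A_def)
      have "\<exists>u\<in>U. (e = 1 \<longrightarrow> adj u (x i) \<and> u \<notin> Z) \<and> (e = 0 \<longrightarrow> u = x i)"
      proof (cases "e = 1")
        case True
        then have "x i \<in> G"
          using xA[OF i] by (simp add: A_def)
        then have "card Z < card {u \<in> U. adj (x i) u}"
          using G Z(2) by fastforce
        then obtain u where "u \<in> {u \<in> U. adj (x i) u}" "u \<notin> Z"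
          using exists_not_in[OF Z(1)] by blast
        then show ?thesis
          using True adj_sym by auto
      next
        case False
        then show ?thesis
          using xA[OF i] by (intro bexI[of _ "x i"]) (simp_all add: A_def)
      qed
      then obtain u where u: "u \<in> U" "e = 1 \<longrightarrow> adj u (x i) \<and> u \<notin> Z" "e = 0 \<longrightarrow> u = x i"
        by (elim bexE conjE)
      obtain \<phi> where \<phi>: "\<phi> \<in> X" "\<phi> (li a) = Y j" "\<phi> (li b) = u"
        using bspec[OF bspec[OF rel Y(2)[OF j]] u(1)] by (elim bexE conjE)
      show "\<exists>g. g 0 = Y j \<and> g k = x i \<and> (\<forall>j<k. adj (g j) (g (Suc j))) \<and> inj_on g {..k} \<and> g ` {1..<k} \<inter> Z = {}"
        using u(2,3) unfolding e_def by (intro path_leg[OF \<phi> _ _ xY Z(1) hZ hL]) simp_all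
    qed (use xinj Z0 in simp_all)
  qed simp
qed

end

section \<open>Almost regular subgraphs\<close>

definition induced :: "'a set set \<Rightarrow> 'a set \<Rightarrow> 'a set set" where
  "induced E U = {e \<in> E. e \<subseteq> U}"

lemma finite_arg_max:
  fixes f :: "'a \<Rightarrow> real"
  assumes "finite A" "A \<noteq> {}"
  shows "\<exists>x\<in>A. \<forall>y\<in>A. f y \<le> f x"
proof -
  have "Max (f ` A) \<in> f ` A"
    using assms by (intro Max_in) auto
  then obtain x where "x \<in> A" "Max (f ` A) = f x"
    by auto
  then show ?thesis
    using assms by (intro bexI[of _ x]) (auto simp flip: \<open>Max (f ` A) = f x\<close>)
qed

text \<open>Discarding an element of least value never lowers the average.\<close>

lemma heavy_subset:
  fixes f :: "'a \<Rightarrow> nat"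
  assumes "finite A" "x \<le> card A"
  shows "\<exists>T\<subseteq>A. card T = x \<and> x * (\<Sum>v\<in>A. f v) \<le> card A * (\<Sum>v\<in>T. f v)"
  using assms
proof (induction "card A - x" arbitrary: A)
  case 0
  then show ?case
    by (intro exI[of _ A]) auto
next
  case (Suc m)
  then have A: "A \<noteq> {}" "finite A" "x < card A"
    by auto
  have "Min (f ` A) \<in> f ` A"
    using A by (intro Min_in) auto
  then obtain a where a: "a \<in> A" "Min (f ` A) = f a"
    by auto
  have min: "f a \<le> f v" if "v \<in> A" for v
    unfolding a(2)[symmetric] using A(2) that by (intro Min_le) auto
  define n where "n = card (A - {a})"
  have cA: "card A = Suc n"
    using a(1) A(2) unfolding n_def by (metis card_Suc_Diff1)
  have "m = card (A - {a}) - x" "x \<le> card (A - {a})"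
    using Suc.hyps(2) cA A(3) by (simp_all add: n_def)
  from Suc.hyps(1)[OF this(1) _ this(2)] A(2) obtain T where T: "T \<subseteq> A - {a}" "card T = x"
    "x * (\<Sum>v\<in>A - {a}. f v) \<le> n * (\<Sum>v\<in>T. f v)"
    by (auto simp: n_def)
  define F where "F = (\<Sum>v\<in>A - {a}. f v)"
  define R where "R = (\<Sum>v\<in>T. f v)"
  have sumA: "(\<Sum>v\<in>A. f v) = f a + F"
    unfolding F_def using a(1) A(2) by (rule sum.remove[rotated])
  have "x * f a \<le> R"
  proof -
    have "x * f a = (\<Sum>v\<in>T. f a)"
      using T(2) by simp
    also have "\<dots> \<le> R"
      unfolding R_def using T(1) min by (intro sum_mono) auto
    finally show ?thesis .
  qed
  then have "x * (f a + F) \<le> Suc n * R"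
    using T(3) unfolding F_def R_def by (simp add: algebra_simps)
  then show ?case
    using T(1,2) unfolding sumA cA R_def by (intro exI[of _ T]) auto
qed

locale edge_set =
  fixes V :: "'a set" and E :: "'a set set"
  assumes finV: "finite V" and edge: "e \<in> E \<Longrightarrow> e \<subseteq> V \<and> card e = 2"
begin

lemma finE: "finite E"
  using finV edge by (intro finite_subset[of E "Pow V"]) auto

lemma fin_induced: "finite (induced E U)"
  using finE by (simp add: induced_def)

lemma edge_fin: "e \<in> E \<Longrightarrow> finite e"
  using edge by (metis card.infinite zero_neq_numeral)

lemma handshake:
  assumes "U \<subseteq> V"
  shows "(\<Sum>v\<in>U. card {e \<in> induced E U. v \<in> e}) = 2 * card (induced E U)"
proof -
  have "finite U"
    using assms finV finite_subset by blast
  moreover have "card {v \<in> U. v \<in> e} = 2" if "e \<in> induced E U" for e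
  proof -
    have "{v \<in> U. v \<in> e} = e"
      using that by (auto simp: induced_def)
    then show ?thesis
      using that edge by (simp add: induced_def)
  qed
  ultimately have "(\<Sum>v\<in>U. card {e \<in> induced E U. v \<in> e}) = (\<Sum>e\<in>induced E U. 2)"
    using fin_induced by (intro sum_multicount_gen) auto
  then show ?thesis by simp
qed

lemma deg_le_card:
  assumes "U \<subseteq> V"
  shows "card {e \<in> induced E U. v \<in> e} \<le> card U"
proof -
  have finU: "finite U"
    using assms finV finite_subset by blast
  have "{e \<in> induced E U. v \<in> e} \<subseteq> (\<lambda>w. {v, w}) ` U"
  proof
    fix e assume e: "e \<in> {e \<in> induced E U. v \<in> e}"
    then have "card e = 2" "v \<in> e" "e \<subseteq> U"
      using edge by (auto simp: induced_def)
    then obtain w where "e = {v, w}"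
      by (auto simp: card_2_iff)
    then show "e \<in> (\<lambda>w. {v, w}) ` U"
      using \<open>e \<subseteq> U\<close> by auto
  qed
  then show ?thesis
    using finU by (meson card_image_le card_mono finite_imageI order_trans)
qed

text \<open>
  Take \<open>W\<close> maximising \<open>e(W) / |W|\<^bsup>1 + \<alpha>\<^esup>\<close>. If the vertices \<open>B\<close> of large degree met half of the edges, then \<open>B\<close>
  together with equally few vertices sending most edges to \<open>B\<close> would be denser than \<open>W\<close>.
  Vertices of small degree are removed afterwards.
\<close>

lemma regular_subgraph:
  fixes \<alpha> c K0 C :: real
  assumes \<alpha>: "0 < \<alpha>" and c_def: "c = (1 / 4) powr (1 / \<alpha>) / 2" and K0_def: "K0 = 4 / c"
    and C: "2 / c \<le> C" and V: "V \<noteq> {}" and many: "C * real (card V) powr (1 + \<alpha>) \<le> card E"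
  shows "\<exists>U\<subseteq>V. \<exists>d::nat. U \<noteq> {} \<and> C / 4 * real (card U) powr \<alpha> \<le> d \<and>
    (\<forall>v\<in>U. real d \<le> real (card {e \<in> induced E U. v \<in> e}) \<and> real (card {e \<in> induced E U. v \<in> e}) \<le> 4 * K0 * d)"
proof -
  define \<rho> where "\<rho> U = card (induced E U) / real (card U) powr (1 + \<alpha>)" for U
  have c: "0 < c" "c \<le> 1 / 2"
  proof -
    have "(1 / 4 :: real) powr (1 / \<alpha>) \<le> 1"
      using \<alpha> by (intro powr_le1) auto
    then show "0 < c" "c \<le> 1 / 2"
      by (simp_all add: c_def)
  qed
  \<comment> \<open>The value of \<open>c\<close> is made for this identity: by maximality of
    \<open>\<rho>\<close>, a set of at most \<open>2 * c * m\<close> vertices has at most a quarter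
    as many edges per vertex as \<open>W\<close>.\<close>
  have c\<alpha>: "(2 * c) powr \<alpha> = 1 / 4"
    using \<alpha> by (simp add: c_def powr_powr)
  have K0: "0 < K0"
    using c by (simp add: K0_def)
  have C0: "0 < C"
    using C c by (smt (verit) divide_pos_pos)
  have "\<exists>W\<in>{U. U \<subseteq> V \<and> U \<noteq> {}}. \<forall>U\<in>{U. U \<subseteq> V \<and> U \<noteq> {}}. \<rho> U \<le> \<rho> W"
    using finV V by (intro finite_arg_max) auto
  then obtain W where W: "W \<subseteq> V" "W \<noteq> {}" and max: "\<And>U. U \<subseteq> V \<Longrightarrow> U \<noteq> {} \<Longrightarrow> \<rho> U \<le> \<rho> W"
    by blast
  define m where "m = real (card W)"
  define ee where "ee = real (card (induced E W))"
  define D where "D = ee / m"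
  have finW: "finite W"
    using W finV finite_subset by blast
  have m1: "1 \<le> m"
    using W finW by (simp add: m_def Suc_le_eq card_gt_0_iff)
  have "induced E V = E"
    using edge by (auto simp: induced_def)
  moreover have "0 < real (card V) powr (1 + \<alpha>)"
    using V finV by (simp add: card_gt_0_iff)
  ultimately have "C \<le> \<rho> V"
    using many by (simp add: \<rho>_def le_divide_eq)
  also have "\<rho> V \<le> \<rho> W"
    using V by (intro max) auto
  finally have CW: "C \<le> \<rho> W" .
  have mp: "m powr (1 + \<alpha>) = m * m powr \<alpha>"
    using m1 by (simp add: powr_add)
  have mpos: "0 < m powr \<alpha>"
    using m1 by simp
  have D\<rho>: "D = \<rho> W * m powr \<alpha>"
    using m1 mpos by (simp add: D_def \<rho>_def ee_def mp flip: m_def)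
  have "1 \<le> m powr \<alpha>"
    using m1 \<alpha> by (simp add: ge_one_powr_ge_zero)
  then have "C * 1 \<le> \<rho> W * m powr \<alpha>"
    using CW C0 by (intro mult_mono) auto
  then have DC: "C \<le> D"
    using D\<rho> by simp
  have D0: "0 < D"
    using DC C0 by simp
  have eeD: "ee = D * m"
    using m1 by (simp add: D_def)
  have ee0: "0 < ee"
    using eeD D0 m1 by simp
  have hs: "(\<Sum>v\<in>W. real (card {e \<in> induced E W. v \<in> e})) = 2 * ee"
    using arg_cong[OF handshake[OF W(1)], of real] by (simp add: ee_def)
  \<comment> \<open>A simple graph gives \<open>D \<le> m\<close>, so
    \<open>2 / c \<le> C \<le> D\<close> forces \<open>2 \<le> m * c\<close>. Then rounding
    \<open>m * c\<close> down to \<open>x\<close> loses at most half.\<close>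
  have "2 * ee \<le> m * m"
  proof -
    have "(\<Sum>v\<in>W. real (card {e \<in> induced E W. v \<in> e})) \<le> (\<Sum>v\<in>W. m)"
      unfolding m_def using deg_le_card[OF W(1)] by (intro sum_mono) simp
    then show ?thesis
      using hs by (simp add: m_def)
  qed
  then have "D * m \<le> m * m"
    using eeD ee0 by linarith
  then have "D \<le> m"
    using m1 by simp
  then have mc: "2 \<le> m * c"
    using C DC c by (simp add: divide_le_eq) (smt (verit) mult_right_mono)
  define x where "x = nat \<lfloor>m * c\<rfloor>"
  have x: "real x \<le> m * c" "m * c / 2 \<le> real x" "1 \<le> x"
    using mc by (simp_all add: x_def) linarith+
  define B where "B = {v \<in> W. K0 * D < real (card {e \<in> induced E W. v \<in> e})}"
  have B: "B \<subseteq> W" "finite B"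
    using finW by (auto simp: B_def)
  \<comment> \<open>The degrees in \<open>W\<close> sum to \<open>2 * m * D\<close>, so at most
    \<open>2 * m / K0\<close> of them exceed \<open>K0 * D\<close>; this is the origin of
    \<open>K0 = 4 / c\<close>.\<close>
  have cB: "real (card B) \<le> m * c / 2"
  proof -
    have "card B * (K0 * D) = (\<Sum>v\<in>B. K0 * D)"
      by simp
    also have "\<dots> \<le> (\<Sum>v\<in>B. real (card {e \<in> induced E W. v \<in> e}))"
      by (intro sum_mono) (simp add: B_def)
    also have "\<dots> \<le> (\<Sum>v\<in>W. real (card {e \<in> induced E W. v \<in> e}))"
      using B(1) finW by (intro sum_mono2) auto
    also have "\<dots> = (2 * m) * D"
      using hs eeD by simp
    finally have "card B * K0 * D \<le> (2 * m) * D"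
      by (simp add: mult.assoc)
    then have "card B * K0 \<le> 2 * m"
      using D0 by simp
    then show ?thesis
      using c by (simp add: K0_def field_simps)
  qed
  have cBx: "card B \<le> x"
    using cB x(2) by linarith
  define A where "A = W - B"
  have finA: "finite A"
    using finW by (simp add: A_def)
  have cA: "card A = card W - card B" "card B \<le> card W"
    using B finW unfolding A_def by (auto intro: card_Diff_subset card_mono)
  have mcm: "m * c \<le> m / 2"
    using c(2) m1 by (simp add: mult_left_mono[of c "1/2" m, simplified])
  have "m - m * c / 2 \<le> real (card A)"
    using cA cB by (simp add: m_def of_nat_diff)
  then have xA: "x \<le> card A"
    using x(1) mcm m1 by linarith
  define Ev where "Ev v = {e \<in> induced E W. v \<in> e \<and> e \<inter> B \<noteq> {}}" for v
  define f where "f v = card (Ev v)" for v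
  define touch where "touch = {e \<in> induced E W. e \<inter> B \<noteq> {}}"
  have finEv: "finite (Ev v)" and fint: "finite touch" for v
    using fin_induced by (simp_all add: Ev_def touch_def)
  have touch_le: "card touch \<le> card (induced E B) + (\<Sum>v\<in>A. f v)"
  proof -
    have "touch \<subseteq> induced E B \<union> (\<Union>v\<in>A. Ev v)"
      by (auto simp: touch_def induced_def Ev_def A_def)
    then have "card touch \<le> card (induced E B \<union> (\<Union>v\<in>A. Ev v))"
      using fin_induced finA finEv by (intro card_mono) auto
    also have "\<dots> \<le> card (induced E B) + card (\<Union>v\<in>A. Ev v)"
      by (rule card_Un_le)
    also have "card (\<Union>v\<in>A. Ev v) \<le> (\<Sum>v\<in>A. f v)"
      unfolding f_def by (rule card_UN_le[OF finA])
    finally show ?thesis by simp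
  qed
  obtain T where T: "T \<subseteq> A" "card T = x" "x * (\<Sum>v\<in>A. f v) \<le> card A * (\<Sum>v\<in>T. f v)"
    using heavy_subset[OF finA xA, of f] by blast
  have finT: "finite T"
    using T(1) finA finite_subset by blast
  \<comment> \<open>An edge from a vertex of \<open>A\<close> into \<open>B\<close> has its other
    end in \<open>B\<close>, so the sets \<open>Ev v\<close> for different \<open>v\<close> are
    disjoint and the sum of \<open>f\<close> over \<open>T\<close> counts no edge twice.\<close>
  have pair: "e = {v, b}" if "e \<in> Ev v" "b \<in> e \<inter> B" "v \<in> A" for e v b
  proof -
    have e: "card e = 2" "finite e" "v \<in> e" "b \<in> e" "v \<noteq> b"
      using that edge edge_fin by (auto simp: Ev_def induced_def A_def)
    then have "card {v, b} = card e"
      by simp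
    then show ?thesis
      using e card_subset_eq[of e "{v, b}"] by auto
  qed
  have lower: "card (induced E B) + (\<Sum>v\<in>T. f v) \<le> card (induced E (B \<union> T))"
  proof -
    have dis: "Ev v \<inter> Ev v' = {}" if "v \<in> T" "v' \<in> T" "v \<noteq> v'" for v v'
    proof (rule ccontr)
      assume "Ev v \<inter> Ev v' \<noteq> {}"
      then obtain e where e: "e \<in> Ev v" "e \<in> Ev v'"
        by blast
      then obtain b where b: "b \<in> e \<inter> B"
        by (auto simp: Ev_def)
      have "e = {v, b}" "e = {v', b}"
        using pair e b that T(1) by blast+
      moreover have "v \<noteq> b"
        using b that T(1) by (auto simp: A_def)
      ultimately show False
        using that(3) by (auto simp: doubleton_eq_iff)
    qed
    have "(\<Sum>v\<in>T. f v) = card (\<Union>v\<in>T. Ev v)"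
      unfolding f_def using finT finEv dis by (intro card_UN_disjoint[symmetric]) auto
    moreover have "induced E B \<inter> (\<Union>v\<in>T. Ev v) = {}"
      using T(1) by (auto simp: induced_def Ev_def A_def)
    ultimately have "card (induced E B) + (\<Sum>v\<in>T. f v) = card (induced E B \<union> (\<Union>v\<in>T. Ev v))"
      using fin_induced finT finEv by (simp add: card_Un_disjoint)
    also have "\<dots> \<le> card (induced E (B \<union> T))"
    proof (intro card_mono fin_induced Un_least)
      show "induced E B \<subseteq> induced E (B \<union> T)"
        by (auto simp: induced_def)
      show "(\<Union>v\<in>T. Ev v) \<subseteq> induced E (B \<union> T)"
      proof
        fix e assume "e \<in> (\<Union>v\<in>T. Ev v)"
        then obtain v where v: "v \<in> T" "e \<in> Ev v"
          by blast
        then obtain b where b: "b \<in> e \<inter> B"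
          by (auto simp: Ev_def)
        then have "e = {v, b}"
          using pair v T(1) by blast
        then show "e \<in> induced E (B \<union> T)"
          using v b by (auto simp: induced_def Ev_def)
      qed
    qed
    finally show ?thesis .
  qed
  \<comment> \<open>By \<open>heavy_subset\<close>, \<open>B \<union> T\<close> keeps at least the
    share \<open>x / m\<close> of the edges meeting \<open>B\<close>. Were these more than half of
    all \<open>D * m\<close> edges, it would span more than \<open>x * D / 2\<close> edges, while
    maximality allows its at most \<open>2 * x\<close> vertices no more than that.\<close>
  have touch_small: "real (card touch) \<le> ee / 2"
  proof (rule ccontr)
    assume "\<not> ?thesis"
    then have big: "ee / 2 < real (card touch)"
      by simp
    have xm: "real x \<le> real (card A)" "real (card A) \<le> m" "0 < real (card A)" "0 < real x"
      using xA cA x(3) by (auto simp: m_def)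
    let ?sA = "real (\<Sum>v\<in>A. f v)" and ?sT = "real (\<Sum>v\<in>T. f v)"
    have "real (x * (\<Sum>v\<in>A. f v)) \<le> real (card A * (\<Sum>v\<in>T. f v))"
      using T(3) by (simp only: of_nat_le_iff)
    then have xs: "real x * ?sA \<le> real (card A) * ?sT"
      by simp
    have "real x * ee / 2 < real x * real (card touch)"
      using big xm(4) by simp
    also have "\<dots> \<le> real x * (real (card (induced E B)) + ?sA)"
      using touch_le xm(4) by (intro mult_left_mono) (simp_all flip: of_nat_add add: of_nat_le_iff del: of_nat_sum)
    also have "\<dots> \<le> real (card A) * real (card (induced E B)) + real (card A) * ?sT"
      unfolding distrib_left using xs xm(1) by (intro add_mono mult_right_mono) simp_all
    also have "\<dots> = real (card A) * real (card (induced E B) + (\<Sum>v\<in>T. f v))"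
      by (simp add: distrib_left)
    also have "\<dots> \<le> m * real (card (induced E (B \<union> T)))"
      using lower xm by (intro mult_mono) (simp_all only: of_nat_le_iff of_nat_0_le_iff)
    finally have 1: "real x * ee / 2 < m * real (card (induced E (B \<union> T)))" .
    have BT: "B \<union> T \<subseteq> V" "B \<union> T \<noteq> {}"
      using B T W x(3) by (auto simp: A_def)
    have "card (B \<union> T) \<le> card B + card T"
      by (rule card_Un_le)
    then have c2: "real (card (B \<union> T)) \<le> 2 * real x"
      using cBx T(2) by simp
    have BTpos: "0 < real (card (B \<union> T)) powr (1 + \<alpha>)"
      using BT(2) B(2) finT by (simp add: card_gt_0_iff)
    have "real (card (induced E (B \<union> T))) = \<rho> (B \<union> T) * real (card (B \<union> T)) powr (1 + \<alpha>)"
      using BTpos by (simp add: \<rho>_def)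
    also have "\<dots> \<le> \<rho> W * (2 * real x) powr (1 + \<alpha>)"
      using max[OF BT] BTpos c2 \<alpha> CW C0 by (intro mult_mono powr_mono2) auto
    also have "(2 * real x) powr (1 + \<alpha>) = 2 * real x * (2 * real x) powr \<alpha>"
      using xm(4) by (simp add: powr_add)
    also have "(2 * real x) powr \<alpha> \<le> (m * (2 * c)) powr \<alpha>"
      using x(1) \<alpha> by (intro powr_mono2) auto
    also have "(m * (2 * c)) powr \<alpha> = m powr \<alpha> * (1 / 4)"
      using m1 c c\<alpha> by (simp add: powr_mult)
    finally have "real (card (induced E (B \<union> T))) \<le> \<rho> W * (2 * real x * (m powr \<alpha> * (1 / 4)))"
      using CW C0 by (simp add: mult_left_mono)
    also have "\<dots> = real x * D / 2"
      by (simp add: D\<rho>)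
    finally have "m * real (card (induced E (B \<union> T))) \<le> m * (real x * D / 2)"
      using m1 by (intro mult_left_mono) simp_all
    also have "\<dots> = real x * ee / 2"
      by (simp add: eeD)
    finally show False
      using 1 by simp
  qed
  define W1 where "W1 = W - B"
  have "card (induced E W) \<le> card (induced E W1 \<union> touch)"
    using fin_induced fint by (intro card_mono) (auto simp: induced_def touch_def W1_def)
  also have "\<dots> \<le> card (induced E W1) + card touch"
    by (rule card_Un_le)
  finally have e1: "ee / 2 \<le> real (card (induced E W1))"
    using touch_small unfolding ee_def by linarith
  \<comment> \<open>Maximising edges minus \<open>D / 4\<close> per vertex removes all low degrees
    at once: a vertex of degree below \<open>D / 4\<close> could be dropped with profit. The maximum
    is positive because \<open>W1\<close> keeps half of the \<open>D * m\<close> edges, so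
    \<open>U\<close> is nonempty.\<close>
  define val where "val U = real (card (induced E U)) - D / 4 * real (card U)" for U
  have "\<exists>U\<in>Pow W1. \<forall>U'\<in>Pow W1. val U' \<le> val U"
    using finW by (intro finite_arg_max) (auto simp: W1_def)
  then obtain U where U: "U \<subseteq> W1" and Umax: "\<And>U'. U' \<subseteq> W1 \<Longrightarrow> val U' \<le> val U"
    by blast
  have finU: "finite U"
    using U finW finite_subset unfolding W1_def by blast
  have "0 < val W1"
  proof -
    have "card W1 \<le> card W"
      using finW by (intro card_mono) (auto simp: W1_def)
    then have "D / 4 * real (card W1) \<le> D / 4 * m"
      using D0 by (intro mult_left_mono) (simp_all add: m_def)
    moreover have "D / 4 * m < ee / 2"
      using eeD ee0 by simp
    ultimately show ?thesis
      using e1 unfolding val_def by linarith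
  qed
  then have val: "0 < val U"
    using Umax[of W1] by simp
  have Une: "U \<noteq> {}"
  proof
    assume "U = {}"
    moreover have "induced E {} = {}"
      using edge[of "{}"] by (auto simp: induced_def)
    ultimately show False
      using val by (simp add: val_def)
  qed
  have min: "D / 4 \<le> real (card {e \<in> induced E U. v \<in> e})" if v: "v \<in> U" for v
  proof -
    have "induced E U = induced E (U - {v}) \<union> {e \<in> induced E U. v \<in> e}"
      by (auto simp: induced_def)
    then have "card (induced E U) \<le> card (induced E (U - {v})) + card {e \<in> induced E U. v \<in> e}"
      using card_Un_le[of "induced E (U - {v})" "{e \<in> induced E U. v \<in> e}"] by simp
    moreover have "val (U - {v}) \<le> val U"
      using U by (intro Umax) auto
    moreover have "real (card (U - {v})) = real (card U) - 1"
    proof -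
      have "card U = Suc (card (U - {v}))"
        using card_Suc_Diff1[OF finU v] by simp
      then show ?thesis
        by simp
    qed
    moreover from this have "D / 4 * real (card (U - {v})) = D / 4 * real (card U) - D / 4"
      by (simp add: right_diff_distrib)
    ultimately show ?thesis
      unfolding val_def by linarith
  qed
  have mx: "real (card {e \<in> induced E U. v \<in> e}) \<le> K0 * D" if v: "v \<in> U" for v
  proof -
    have "card {e \<in> induced E U. v \<in> e} \<le> card {e \<in> induced E W. v \<in> e}"
    proof (rule card_mono)
      show "finite {e \<in> induced E W. v \<in> e}"
        by (simp add: fin_induced)
    qed (use U in \<open>auto simp: induced_def W1_def\<close>)
    moreover have "\<not> K0 * D < real (card {e \<in> induced E W. v \<in> e})"
      using v U by (auto simp: W1_def B_def)
    ultimately show ?thesis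
      by linarith
  qed
  \<comment> \<open>Degrees are integers, so the lower bound \<open>D / 4\<close> may be rounded up;
    the upper bound \<open>K0 * D\<close> is then at most \<open>4 * K0 * d\<close>.\<close>
  define d where "d = nat \<lceil>D / 4\<rceil>"
  have dD: "D / 4 \<le> real d"
    using D0 unfolding d_def by linarith
  have "card U \<le> card W"
    using U finW by (intro card_mono) (auto simp: W1_def)
  then have "real (card U) powr \<alpha> \<le> m powr \<alpha>"
    using \<alpha> by (intro powr_mono2) (auto simp: m_def)
  then have "C / 4 * real (card U) powr \<alpha> \<le> \<rho> W / 4 * m powr \<alpha>"
    using CW C0 by (intro mult_mono) auto
  also have "\<dots> = D / 4"
    by (simp add: D\<rho>)
  finally have dl: "C / 4 * real (card U) powr \<alpha> \<le> real d"
    using dD by linarith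
  have "d \<le> card {e \<in> induced E U. v \<in> e}" if "v \<in> U" for v
    using min[OF that] unfolding d_def by linarith
  moreover have "real (card {e \<in> induced E U. v \<in> e}) \<le> 4 * K0 * d" if "v \<in> U" for v
  proof -
    have "K0 * D \<le> K0 * (4 * real d)"
      using dD K0 by (intro mult_left_mono) simp_all
    then show ?thesis
      using mx[OF that] by simp
  qed
  moreover have "U \<subseteq> V"
    using U W(1) by (auto simp: W1_def)
  ultimately show ?thesis
    using Une dl by (intro exI[of _ U] conjI exI[of _ d]) simp_all
qed

end

section \<open>The extremal number\<close>

context host_family
begin

text \<open>Restricted witnesses stay admissible and disjoint. The use is for a spider with two legs
  of length one: were it rich, so would be the path of length two through its centre.\<close>

lemma rich_sub:
  assumes fam: "(D, B) \<in> Fam" and fam': "(D', B') \<in> Fam" and sub: "D' \<subset> D" "B' \<subseteq> B" "D' - B' \<subseteq> D - B"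
    and L: "L (card D') \<le> L (card D)" and ri: "rich D B x"
  shows "rich D' B' x"
proof -
  have finD: "finite D" and finD': "finite D'"
    using fam_fin fam fam' by blast+
  from iffD1[OF rich_iff[OF finD] ri] obtain \<Phi> where \<Phi>: "finite \<Phi>" "card \<Phi> = L (card D)"
    "\<Phi> \<subseteq> {\<phi> \<in> Adm D. \<forall>b\<in>B. \<phi> b = x b}"
    and dj: "\<forall>\<phi>\<in>\<Phi>. \<forall>\<psi>\<in>\<Phi>. \<phi> \<noteq> \<psi> \<longrightarrow> \<phi> ` (D - B) \<inter> \<psi> ` (D - B) = {}"
    by (elim exE conjE)
  obtain \<Phi>1 where \<Phi>1: "\<Phi>1 \<subseteq> \<Phi>" "card \<Phi>1 = L (card D')" "finite \<Phi>1"
    using obtain_subset_with_card_n[of "L (card D')" \<Phi>] L \<Phi>(2) by metis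
  obtain p where p: "p \<in> D' - B'"
    using fam_sub[OF fam'] by blast
  let ?r = "\<lambda>\<phi>. restrict \<phi> D'"
  have img: "?r \<phi> ` (D' - B') \<subseteq> \<phi> ` (D - B)" for \<phi>
    using sub(3) by auto
  have inj: "inj_on ?r \<Phi>1"
  proof (rule inj_onI, rule ccontr)
    fix \<phi> \<psi> assume a: "\<phi> \<in> \<Phi>1" "\<psi> \<in> \<Phi>1" "?r \<phi> = ?r \<psi>" "\<phi> \<noteq> \<psi>"
    have "\<phi> ` (D - B) \<inter> \<psi> ` (D - B) = {}"
      using dj a \<Phi>1(1) by blast
    moreover have "?r \<phi> p \<in> \<phi> ` (D - B)" "?r \<psi> p \<in> \<psi> ` (D - B)"
      by (rule subsetD[OF img imageI[OF p]])+
    ultimately show False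
      using a(3) by (metis (no_types) IntI empty_iff)
  qed
  show ?thesis
    unfolding rich_iff[OF finD']
  proof (intro exI[of _ "?r ` \<Phi>1"] conjI ballI impI)
    show "finite (?r ` \<Phi>1)"
      using \<Phi>1(3) by simp
    show "card (?r ` \<Phi>1) = L (card D')"
      using inj \<Phi>1(2) by (simp add: card_image)
    show "?r ` \<Phi>1 \<subseteq> {\<phi> \<in> Adm D'. \<forall>b\<in>B'. \<phi> b = x b}"
    proof (rule image_subsetI)
      fix \<phi> assume "\<phi> \<in> \<Phi>1"
      then have \<phi>: "\<phi> \<in> Adm D" "\<forall>b\<in>B. \<phi> b = x b"
        using \<Phi>1(1) \<Phi>(3) by auto
      have "?r \<phi> \<in> Adm D'"
        using Adm_restrict_Good[OF \<phi>(1) sub(1)] Good_Adm by blast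
      moreover have "\<forall>b\<in>B'. ?r \<phi> b = x b"
        using \<phi>(2) sub(2) fam_sub[OF fam'] by auto
      ultimately show "?r \<phi> \<in> {\<phi> \<in> Adm D'. \<forall>b\<in>B'. \<phi> b = x b}"
        by simp
    qed
  next
    fix \<phi>' \<psi>' assume a: "\<phi>' \<in> ?r ` \<Phi>1" "\<psi>' \<in> ?r ` \<Phi>1" "\<phi>' \<noteq> \<psi>'"
    then obtain \<phi> \<psi> where b: "\<phi> \<in> \<Phi>1" "\<psi> \<in> \<Phi>1" "\<phi>' = ?r \<phi>" "\<psi>' = ?r \<psi>"
      by blast
    then have "\<phi> \<noteq> \<psi>"
      using a(3) by auto
    then have "\<phi> ` (D - B) \<inter> \<psi> ` (D - B) = {}"
      using dj subsetD[OF \<Phi>1(1) b(1)] subsetD[OF \<Phi>1(1) b(2)] by simp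
    then show "\<phi>' ` (D' - B') \<inter> \<psi>' ` (D' - B') = {}"
      using Int_mono[OF img[of \<phi>] img[of \<psi>]] unfolding b(3,4) by simp
  qed
qed

end

text \<open>Bernoulli's inequality. It replaces the \<open>d - card full\<close> free choices for
  each spider vertex by \<open>d\<close> at the cost of a factor 2.\<close>

lemma half_power:
  fixes d N m :: nat
  assumes "2 * m * N \<le> d"
  shows "d ^ m \<le> 2 * (d - N) ^ m"
proof (cases "m = 0 \<or> d = 0")
  case True
  then show ?thesis
    using assms by (cases "m = 0") auto
next
  case False
  then have d0: "0 < real d" and "N \<le> d"
  proof -
    show "0 < real d"
      using False by simp
    have "1 * N \<le> 2 * m * N"
      using False by (intro mult_le_mono1) simp
    then show "N \<le> d"
      using assms by linarith
  qed
  have mN: "real m * (real N / real d) \<le> 1 / 2"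
  proof -
    have "real (2 * m * N) \<le> real d"
      using assms by (simp only: of_nat_le_iff)
    then show ?thesis
      using d0 by (simp add: field_simps)
  qed
  have "-1 \<le> - (real N / real d)"
    using \<open>N \<le> d\<close> d0 by simp
  from Bernoulli_inequality[OF this, of m]
  have "1 / 2 \<le> (1 - real N / real d) ^ m"
    using mN by simp
  then have "real d ^ m * (1 / 2) \<le> real d ^ m * (1 - real N / real d) ^ m"
    using d0 by (intro mult_left_mono) simp_all
  also have "\<dots> = (real d - real N) ^ m"
    using d0 by (simp add: right_diff_distrib flip: power_mult_distrib)
  also have "\<dots> = real ((d - N) ^ m)"
    using \<open>N \<le> d\<close> by (simp add: of_nat_diff)
  finally have "real (d ^ m) \<le> real (2 * (d - N) ^ m)"
    by simp
  then show ?thesis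
    by (simp only: of_nat_le_iff)
qed

section \<open>Combining the spider case and the path case\<close>

context spider_host
begin

lemma pieces_top: "(full, ends) \<in> pieces s k"
  using k2 by (intro spider_pieces) simp

lemma short_cross_line:
  assumes "i < s" "i' < s" "i \<noteq> i'"
  shows "line k i i' ` {k - 1..k + 1} = {leg i' 1, (0, 0), leg i 1}"
    "line k i i' (k - 1) = leg i' 1" "line k i i' (k + 1) = leg i 1"
proof -
  have "{k - 1..k + 1} = {k - 1, k, k + 1}"
    using k2 by auto
  moreover show "line k i i' (k - 1) = leg i' 1" "line k i i' (k + 1) = leg i 1"
  proof -
    have "\<not> k \<le> k - 1" "k - (k - 1) = 1"
      using k2 by linarith+
    then show "line k i i' (k - 1) = leg i' 1" "line k i i' (k + 1) = leg i 1"
      by (simp_all add: line_def)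
  qed
  moreover have "line k i i' k = (0, 0)"
    by (simp add: line_def)
  ultimately show "line k i i' ` {k - 1..k + 1} = {leg i' 1, (0, 0), leg i 1}"
    by simp
qed

text \<open>The shape of the piece found by \<open>exists_bad\<close> decides between the two core
  arguments. Its size is not known in advance, so \<open>cond\<close> ranges over all sizes. For
  spiders it remains to show that at most one leg has length one, and this has to come from
  minimality.\<close>

lemma copy_of_large:
  fixes E t z :: nat and H :: "nat \<Rightarrow> nat" and c :: "nat \<Rightarrow> real"
  defines "E \<equiv> 4 * card (pieces s k) * K ^ card full"
    and "z \<equiv> t * (card full + 1) + 1 + s + s * k"
    and "c \<equiv> \<lambda>m. 1 / (2 * real E * real (F (m - 1) ^ card (pieces s k)) * real (K ^ card full))"
  assumes V: "V \<noteq> {}" and Lmono: "mono L"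
    and large: "4 * (card V ^ s * F (card full)) < card V * d ^ (s * k)"
    and d0: "2 * (s * k) * card full \<le> d" and d1: "1 \<le> d"
    and cond: "\<And>m. 1 \<le> m \<Longrightarrow> m \<le> card full \<Longrightarrow>
      4 * card full * H m * K ^ card full * E \<le> d \<and> 4 * H m * F (m - 1) ^ card (pieces s k) \<le> L m \<and>
      t * (card full + 1) + card full + card full * (k + 2) < H m \<and> z + 1 + card full * (k + 2) < H m \<and>
      2 * real (z + 1 + s + t) \<le> real (H m) * ((c m / 4) ^ t * (c m / 2) * (c m / 2)) \<and>
      4 * real t \<le> c m * real (K * d) \<and> real (s + t) \<le> (c m / 4) ^ t * (c m / 2) * real (K * d)"
  shows "has_copy t"
proof -
  have cf: "card full = s * k + 1"
    using card_spider s2 by simp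
  have q: "1 \<le> card (pieces s k)"
    using pieces_top fin_fam by (auto simp: Suc_le_eq card_gt_0_iff)
  have E1: "1 \<le> E"
    using q K1 by (simp add: E_def)
  have HL: "H m \<le> L m" if "1 \<le> m" "m \<le> card full" for m
  proof -
    have "1 \<le> F (m - 1) ^ card (pieces s k)"
      using F1 by simp
    then have "H m * 1 \<le> 4 * H m * F (m - 1) ^ card (pieces s k)"
      by (intro mult_le_mono) simp_all
    then show ?thesis
      using cond[OF that] by linarith
  qed
  have "card V * d ^ (s * k) \<le> card V * (2 * (d - card full) ^ (s * k))"
    using half_power[OF d0] by (rule mult_le_mono2)
  also have "\<dots> = 2 * (card V * (d - card full) ^ (\<Sum>i<s. k))"
    by simp
  also have "\<dots> \<le> 2 * card (Emb full)"
    using card_Emb_spider_ge[of "\<lambda>_. k"] by simp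
  finally have total: "card V * d ^ (card full - 1) \<le> 2 * card (Emb full)"
    using cf by simp
  have ce: "card ends = s"
    using k2 by (intro card_feet) simp
  have "4 * (card V ^ card ends * F (card full)) < card V * d ^ (card full - 1)"
    using large cf ce by simp
  from exists_bad[OF pieces_top K1 total this] obtain D B where
    fam: "(D, B) \<in> pieces s k" and many: "card V * d ^ (card D - 1) \<le> E * card (bad D B)"
    unfolding E_def by blast
  have finD: "finite D" and Dsub: "B \<subseteq> D" "D \<subseteq> full"
    using fam_fin[OF fam] fam_sub[OF fam] by blast+
  have path: "has_copy t"
    if ii': "i < s" "i' < s" "i \<noteq> i'" and ab: "a + 2 \<le> b" "b \<le> a + k" "b \<le> 2 * k"
      and D: "D = line k i i' ` {a..b}" "B = {line k i i' a, line k i i' b}" for i i' a b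
  proof -
    have cD: "card D = Suc (b - a)"
      unfolding D using card_line[OF ii'(3)] ab by simp
    have mD: "1 \<le> card D" "card D \<le> card full" "2 \<le> card D"
      using cD ab card_mono[OF finite_spider Dsub(2)] by simp_all
    note cnd = cond[OF mD(1,2)]
    from bad_core[OF fam mD(3) K1 E1 many, of "H (card D)"] cnd
    obtain X where X: "core D B (H (card D)) X" "card V * d ^ (card D - 1) \<le> 2 * E * card X"
      by blast
    interpret path_core V adj d K s k L F i i' a b "H (card D)" X
      using ii' ab X(1) unfolding D by unfold_locales
    show ?thesis
      using path_core_has_copy[of E t] V E1 d1 X(2) cnd HL[OF mD(1,2)] unfolding c_def z_def D[symmetric]
      by blast
  qed
  from fam show ?thesis
  proof (cases rule: pieces_cases)
    case (line i i' a b)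
    then show ?thesis
      by (intro path)
  next
    case (spider l)
    have l1: "\<forall>i<s. 1 \<le> l i"
      using spider(3) by blast
    show ?thesis
    proof (cases "\<exists>i i'. i < s \<and> i' < s \<and> l i = 1 \<and> l i' = 1 \<and> i \<noteq> i'")
      case True
      then obtain i i' where i: "i < s" "i' < s" "l i = 1" "l i' = 1" "i \<noteq> i'"
        by blast
      define D' where "D' = line k i i' ` {k - 1..k + 1}"
      define B' where "B' = {line k i i' (k - 1), line k i i' (k + 1)}"
      have D': "D' = {leg i' 1, (0, 0), leg i 1}" "B' = {leg i' 1, leg i 1}"
        using short_cross_line[OF i(1,2,5)] by (simp_all add: D'_def B'_def)
      have bnd: "k - 1 + 2 \<le> k + 1" "k + 1 \<le> k - 1 + k" "k + 1 \<le> 2 * k"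
        using k2 by simp_all
      have fam': "(D', B') \<in> pieces s k"
        unfolding D'_def B'_def by (intro line_pieces i bnd)
      have B'B: "B' \<subseteq> B"
        unfolding D' spider(2) using feetI[OF i(1), of l] feetI[OF i(2), of l] i by simp
      have c: "leg 0 0 \<in> D" "leg 0 0 \<notin> B"
        unfolding spider(1,2) using s2 leg_in_feet[OF l1, of 0 0] l1 by (auto simp: leg_in_spider simp del: leg_0 dest: spec[of _ 0])
      have D'D: "D' \<subseteq> D"
        unfolding D'(1) using c B'B Dsub(1) unfolding D'(2) by auto
      \<comment> \<open>If the two short legs are the whole spider, it is itself the path of length
        two and is treated as a path. Otherwise that path is a proper piece, rich by
        \<open>rich_sub\<close>, and no admissible embedding contains such a piece.\<close>
      show ?thesis
      proof (cases "D' = D")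
        case True
        have "B \<subseteq> B'"
        proof
          fix p assume "p \<in> B"
          then have "p \<in> D'" "p \<noteq> leg 0 0"
            using True Dsub(1) c by blast+
          then show "p \<in> B'"
            unfolding D' by auto
        qed
        then have "B = B'"
          using B'B by blast
        then show ?thesis
          using True unfolding D'_def B'_def by (intro path[OF i(1,2,5) bnd]) auto
      next
        case False
        then have psub: "D' \<subset> D"
          using D'D by blast
        have "0 < E * card (bad D B)"
          using many V finV d1 by (metis card_gt_0_iff less_le_trans mult_pos_pos zero_less_power less_one not_le)
        then obtain \<phi> where "\<phi> \<in> bad D B"
          by fastforce
        then have \<phi>: "\<phi> \<in> Adm D" "rich D B \<phi>"
          by (simp_all add: bad_def)
        have "L (card D') \<le> L (card D)"
          using psubset_card_mono[OF finD psub] by (intro monoD[OF Lmono]) simp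
        moreover have "D' - B' \<subseteq> D - B"
          using c unfolding D' by auto
        ultimately have "rich D' B' \<phi>"
          using rich_sub[OF fam fam' psub B'B] \<phi>(2) by blast
        then show ?thesis
          using \<phi>(1) fam' psub unfolding Adm_def by blast
      qed
    next
      case False
      have mD: "1 \<le> card D" "card D \<le> card full" "2 \<le> card D"
      proof -
        have "{leg 0 (l 0), leg 1 (l 1)} \<subseteq> D"
          unfolding spider(1) using s2 by (auto intro!: leg_spiderI)
        moreover have "card {leg 0 (l 0), leg 1 (l 1)} = 2"
        proof -
          have "1 \<le> l 0" "1 \<le> l 1"
            using l1 s2 by simp_all
          then show ?thesis
            by (auto simp: leg_eq_iff card_insert_if)
        qed
        ultimately show "2 \<le> card D"
          using card_mono[OF finD] by metis
        then show "1 \<le> card D" "card D \<le> card full"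
          using card_mono[OF finite_spider Dsub(2)] by simp_all
      qed
      note cnd = cond[OF mD(1,2)]
      from bad_core[OF fam mD(3) K1 E1 many, of "H (card D)"] cnd
      obtain X where X: "core D B (H (card D)) X" "card V * d ^ (card D - 1) \<le> 2 * E * card X"
        by blast
      have "X \<noteq> {}"
      proof
        assume "X = {}"
        then have "card V * d ^ (card D - 1) = 0"
          using X(2) by simp
        then show False
          using V finV d1 by simp
      qed
      then show ?thesis
        using False X(1) cnd HL[OF mD(1,2)] spider(3) unfolding spider(1,2)
        by (intro spider_core_has_copy[of l "H (card (spider s l))" X t]) blast+
    qed
  qed
qed

end

text \<open>\<open>L m\<close> must dominate a term in \<open>F (m - 1)\<close> and
  \<open>F m\<close> a term in \<open>L m\<close>, so one recursion on pairs produces both; adding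
  the previous values makes them monotone. \<open>Hf\<close> takes the value
  \<open>F (m - 1)\<close> as argument because the core parameter needed depends on it through the
  density \<open>c\<close>.\<close>

lemma exists_bound_functions:
  fixes Hf :: "nat \<Rightarrow> nat" and N q :: nat
  shows "\<exists>F L :: nat \<Rightarrow> nat. (\<forall>m. 1 \<le> F m) \<and> mono F \<and> mono L \<and>
    (\<forall>m\<ge>1. 4 * Hf (F (m - 1)) * F (m - 1) ^ q \<le> L m \<and> L m * N * N * F (m - 1) ^ q \<le> F m)"
proof -
  define step where "step p = (let l' = snd p + 4 * Hf (fst p) * fst p ^ q in (fst p + l' * N * N * fst p ^ q, l'))"
    for p :: "nat \<times> nat"
  define P where "P m = (step ^^ m) (1, 0)" for m
  define F where "F m = fst (P m)" for m
  define L where "L m = snd (P m)" for m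
  have PS: "P (Suc m) = step (P m)" for m
    by (simp add: P_def)
  have L: "L (Suc m) = L m + 4 * Hf (F m) * F m ^ q" for m
    unfolding L_def F_def PS by (simp add: step_def Let_def)
  have F: "F (Suc m) = F m + L (Suc m) * N * N * F m ^ q" for m
    unfolding L_def F_def PS by (simp add: step_def Let_def)
  have mF: "mono F" and mL: "mono L"
    by (simp_all add: mono_iff_le_Suc F L)
  have F0: "F 0 = 1"
    by (simp add: F_def P_def)
  have "1 \<le> F m" for m
    using monoD[OF mF, of 0 m] F0 by simp
  moreover have "4 * Hf (F (m - 1)) * F (m - 1) ^ q \<le> L m \<and> L m * N * N * F (m - 1) ^ q \<le> F m" if "1 \<le> m" for m
    using that L[of "m - 1"] F[of "m - 1"] by simp
  ultimately show ?thesis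
    using mF mL by blast
qed

section \<open>Constants independent of the host\<close>

lemma eventually_ge_real: "eventually (\<lambda>d. x \<le> real d) sequentially"
  using filterlim_real_sequentially unfolding filterlim_at_top by blast

text \<open>The content of \<open>has_copy\<close> outside the locale, so that the constants can be
  quantified before the host.\<close>

definition spider_copies :: "'a set \<Rightarrow> ('a \<Rightarrow> 'a \<Rightarrow> bool) \<Rightarrow> nat \<Rightarrow> nat \<Rightarrow> nat \<Rightarrow> bool" where
  "spider_copies V adj s t k \<longleftrightarrow>
    (\<exists>x \<sigma>. (\<forall>j<t. inj_on (\<sigma> j) (spider s (\<lambda>_. k)) \<and> \<sigma> j ` spider s (\<lambda>_. k) \<subseteq> V \<and>
        (\<forall>i<s. \<forall>m<k. adj (\<sigma> j (leg i m)) (\<sigma> j (leg i (Suc m)))) \<and> (\<forall>i<s. \<sigma> j (leg i k) = x i)) \<and>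
     (\<forall>j<t. \<forall>j'<t. j \<noteq> j' \<longrightarrow> \<sigma> j ` (spider s (\<lambda>_. k) - feet s (\<lambda>_. k)) \<inter>
        \<sigma> j' ` (spider s (\<lambda>_. k) - feet s (\<lambda>_. k)) = {}))"

lemma spiders_in_regular_graph:
  fixes s t k K :: nat
  assumes s2: "2 \<le> s" and k2: "2 \<le> k" and K1: "1 \<le> K"
  shows "\<exists>M::nat. \<forall>(V :: 'a set) adj d. host V adj d K \<longrightarrow> V \<noteq> {} \<longrightarrow> M * card V ^ (s - 1) \<le> d ^ (s * k) \<longrightarrow>
    spider_copies V adj s t k"
proof -
  define N where "N = card (spider s (\<lambda>_. k))"
  define q where "q = card (pieces s k)"
  define E where "E = 4 * q * K ^ N"
  define z where "z = t * (N + 1) + 1 + s + s * k"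
  define h where "h = t * (N + 1) + N + N * (k + 2) + (z + 1 + N * (k + 2)) + 1"
  define cf where "cf f = 1 / (2 * real E * real (f ^ q) * real (K ^ N))" for f :: nat
  \<comment> \<open>The summand \<open>h\<close> covers every avoidance budget of both cases; the
    quotient is the demand of \<open>path_initial\<close>, whose density depends on the value
    \<open>f\<close> of \<open>F (m - 1)\<close>.\<close>
  define Hf where "Hf f = h + nat \<lceil>2 * real (z + 1 + s + t) / ((cf f / 4) ^ t * (cf f / 2) * (cf f / 2))\<rceil>" for f
  have N: "N = s * k + 1"
    unfolding N_def using card_spider s2 by simp
  obtain F L :: "nat \<Rightarrow> nat" where F1: "\<forall>m. 1 \<le> F m" and mF: "mono F" and mL: "mono L"
    and FL: "\<forall>m\<ge>1. 4 * Hf (F (m - 1)) * F (m - 1) ^ q \<le> L m \<and> L m * N * N * F (m - 1) ^ q \<le> F m"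
    using exists_bound_functions[of Hf q N] by (elim exE conjE)
  have "finite (pieces s k)"
  proof (rule finite_subset)
    show "pieces s k \<subseteq> Pow (spider s (\<lambda>_. k)) \<times> Pow (spider s (\<lambda>_. k))"
      using pieces_sub[OF _ s2] by fast
  qed (simp add: finite_spider)
  moreover have "(spider s (\<lambda>_. k), feet s (\<lambda>_. k)) \<in> pieces s k"
    using k2 by (intro spider_pieces) simp
  ultimately have q1: "1 \<le> q"
    unfolding q_def by (auto simp: Suc_le_eq card_gt_0_iff)
  have E1: "1 \<le> E"
    using q1 K1 by (simp add: E_def)
  define c where "c m = cf (F (m - 1))" for m
  have c0: "0 < c m" for m
  proof -
    have "0 < real E" "0 < real (F (m - 1) ^ q)" "0 < real (K ^ N)"
      using E1 K1 F1 by (simp_all add: Suc_le_eq)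
    then show ?thesis
      unfolding c_def cf_def by (intro divide_pos_pos mult_pos_pos) simp_all
  qed
  define H where "H m = Hf (F (m - 1))" for m
  have Hbig: "2 * real (z + 1 + s + t) \<le> real (H m) * ((c m / 4) ^ t * (c m / 2) * (c m / 2))" for m
  proof -
    have pos: "0 < (c m / 4) ^ t * (c m / 2) * (c m / 2)"
      using c0[of m] by simp
    have "2 * real (z + 1 + s + t) / ((c m / 4) ^ t * (c m / 2) * (c m / 2)) \<le> real (H m)"
      unfolding H_def Hf_def c_def[symmetric] by linarith
    then show ?thesis
      using pos by (simp add: pos_divide_le_eq)
  qed
  \<comment> \<open>Only sizes up to \<open>N\<close> occur, so a single threshold for
    \<open>d\<close> serves all of them.\<close>
  have "\<forall>m\<in>{..N}. eventually (\<lambda>d. real (4 * N * H m * K ^ N * E) \<le> real d \<and> 4 * real t / (c m * K) \<le> real d \<and>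
      real (s + t) / ((c m / 4) ^ t * (c m / 2) * K) \<le> real d) sequentially"
    by (intro ballI eventually_conj eventually_ge_real)
  then have "eventually (\<lambda>d. \<forall>m\<in>{..N}. real (4 * N * H m * K ^ N * E) \<le> real d \<and> 4 * real t / (c m * K) \<le> real d \<and>
      real (s + t) / ((c m / 4) ^ t * (c m / 2) * K) \<le> real d) sequentially"
    by (intro eventually_ball_finite) simp_all
  then obtain d0 where d0: "\<And>d m. d0 \<le> d \<Longrightarrow> m \<le> N \<Longrightarrow> real (4 * N * H m * K ^ N * E) \<le> real d \<and>
      4 * real t / (c m * K) \<le> real d \<and> real (s + t) / ((c m / 4) ^ t * (c m / 2) * K) \<le> real d"
    unfolding eventually_sequentially by fastforce
  define d1 where "d1 = d0 + 2 * (s * k) * N + 1"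
  \<comment> \<open>\<open>4 * F N + 1\<close> makes the number of spiders beat the bound on good
    ones. The summand \<open>d1 ^ (s * k)\<close> forces \<open>d1 \<le> d\<close>, since
    \<open>card V\<close> is at least 1, so hosts of small degree do not arise.\<close>
  define M where "M = 4 * F N + 1 + d1 ^ (s * k)"
  show ?thesis
  proof (intro exI[of _ M] allI impI)
    fix V :: "'a set" and adj d
    assume host: "host V adj d K" and V: "V \<noteq> {}" and M: "M * card V ^ (s - 1) \<le> d ^ (s * k)"
    interpret host V adj d K
      by (rule host)
    interpret spider_host V adj d K s k L F
    proof unfold_locales
      show "1 \<le> F m" for m
        using F1 by simp
      show "L m * card (spider s (\<lambda>_. k)) * card (spider s (\<lambda>_. k)) * F (m - 1) ^ card (pieces s k) \<le> F m" if "1 \<le> m" for m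
        using FL that unfolding N_def q_def by blast
    qed (rule s2 k2 K1 mF)+
    have n1: "1 \<le> card V"
      using V finV by (simp add: Suc_le_eq card_gt_0_iff)
    have d1d: "d1 \<le> d"
    proof (rule ccontr)
      assume "\<not> ?thesis"
      then have "d ^ (s * k) < d1 ^ (s * k)"
        using s2 k2 by (intro power_strict_mono) auto
      also have "\<dots> \<le> M * 1"
        by (simp add: M_def)
      also have "\<dots> \<le> M * card V ^ (s - 1)"
        using n1 by (intro mult_le_mono2) simp
      finally show False
        using M by simp
    qed
    have large: "4 * (card V ^ s * F N) < card V * d ^ (s * k)"
    proof -
      have cs: "card V * card V ^ (s - 1) = card V ^ s"
        using s2 by (simp flip: power_Suc)
      have "4 * F N < M"
        by (simp add: M_def)
      then have "4 * F N * card V ^ s < M * card V ^ s"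
        using n1 by (intro mult_strict_right_mono) simp_all
      also have "\<dots> = card V * (M * card V ^ (s - 1))"
        unfolding cs[symmetric] by (simp add: mult_ac)
      also have "\<dots> \<le> card V * d ^ (s * k)"
        using M by (rule mult_le_mono2)
      finally show ?thesis
        by (simp add: mult_ac)
    qed
    have cnd: "4 * N * H m * K ^ N * E \<le> d \<and> 4 * H m * F (m - 1) ^ q \<le> L m \<and>
      t * (N + 1) + N + N * (k + 2) < H m \<and> z + 1 + N * (k + 2) < H m \<and>
      2 * real (z + 1 + s + t) \<le> real (H m) * ((c m / 4) ^ t * (c m / 2) * (c m / 2)) \<and>
      4 * real t \<le> c m * real (K * d) \<and> real (s + t) \<le> (c m / 4) ^ t * (c m / 2) * real (K * d)"
      if m: "1 \<le> m" "m \<le> N" for m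
    proof (intro conjI)
      have "d0 \<le> d"
        using d1d by (simp add: d1_def)
      note dd = d0[OF this m(2)]
      show "4 * N * H m * K ^ N * E \<le> d"
        using dd by (simp only: of_nat_le_iff)
      show "4 * H m * F (m - 1) ^ q \<le> L m"
        using FL m(1) by (simp add: H_def)
      show "t * (N + 1) + N + N * (k + 2) < H m" "z + 1 + N * (k + 2) < H m"
        by (simp_all add: H_def Hf_def h_def)
      show "2 * real (z + 1 + s + t) \<le> real (H m) * ((c m / 4) ^ t * (c m / 2) * (c m / 2))"
        by (rule Hbig)
      have K0: "0 < real K"
        using K1 by simp
      have "0 < c m * real K"
        using c0[of m] K0 by simp
      then show "4 * real t \<le> c m * real (K * d)"
        using dd by (simp add: pos_divide_le_eq mult_ac)
      have "0 < (c m / 4) ^ t * (c m / 2) * real K"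
        using c0[of m] K0 by simp
      then have "real (s + t) \<le> real d * ((c m / 4) ^ t * (c m / 2) * real K)"
        using dd by (simp only: pos_divide_le_eq)
      then show "real (s + t) \<le> (c m / 4) ^ t * (c m / 2) * real (K * d)"
        by (simp add: mult_ac)
    qed
    have "has_copy t"
    proof (rule copy_of_large[where H = H])
      show "4 * (card V ^ s * F (card full)) < card V * d ^ (s * k)"
        using large by (simp add: N_def)
      show "2 * (s * k) * card full \<le> d" "1 \<le> d"
        using d1d by (simp_all add: d1_def N_def)
    qed (use V mL cnd[unfolded N_def q_def E_def z_def c_def cf_def] in \<open>assumption | blast\<close>)+
    then obtain x \<sigma> where x: "\<forall>j<t. \<sigma> j \<in> Emb full \<and> (\<forall>i<s. \<sigma> j (leg i k) = x i)"
      "\<forall>j<t. \<forall>j'<t. j \<noteq> j' \<longrightarrow> \<sigma> j ` (full - ends) \<inter> \<sigma> j' ` (full - ends) = {}"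
      unfolding has_copy_def by (elim exE conjE)
    show "spider_copies V adj s t k"
      unfolding spider_copies_def
    proof (intro exI[of _ x] exI[of _ \<sigma>] conjI allI impI)
      fix j assume "j < t"
      then have \<sigma>: "\<sigma> j \<in> Emb full" "\<forall>i<s. \<sigma> j (leg i k) = x i"
        using x(1) by blast+
      show "inj_on (\<sigma> j) full"
        using \<sigma>(1) by (rule Emb_inj_on)
      show "\<sigma> j ` full \<subseteq> V"
        using Emb_V[OF \<sigma>(1)] by blast
      show "adj (\<sigma> j (leg i m)) (\<sigma> j (leg i (Suc m)))" if "i < s" "m < k" for i m
        using that by (intro Emb_adj[OF \<sigma>(1)] leg_spiderI) simp_all
      show "\<sigma> j (leg i k) = x i" if "i < s" for i
        using \<sigma>(2) that by blast
    next
      fix j j' assume "j < t" "j' < t" "j \<noteq> j'"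
      then show "\<sigma> j ` (full - ends) \<inter> \<sigma> j' ` (full - ends) = {}"
        using x(2) by blast
    qed
  qed
qed

section \<open>Assembling the subdivision from spiders\<close>

lemma contains_subdivided_complete_bipartite:
  fixes x :: "nat \<Rightarrow> 'a" and \<sigma> :: "nat \<Rightarrow> nat \<times> nat \<Rightarrow> 'a" and G :: "'a graph"
  assumes k: "1 \<le> k" and s: "1 \<le> s" and t: "1 \<le> t"
    and inj: "\<And>j. j < t \<Longrightarrow> inj_on (\<sigma> j) (spider s (\<lambda>_. k))"
    and img: "\<And>j. j < t \<Longrightarrow> \<sigma> j ` spider s (\<lambda>_. k) \<subseteq> verts G"
    and adj: "\<And>j i m. j < t \<Longrightarrow> i < s \<Longrightarrow> m < k \<Longrightarrow> {\<sigma> j (leg i m), \<sigma> j (leg i (Suc m))} \<in> edges G"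
    and x: "\<And>j i. j < t \<Longrightarrow> i < s \<Longrightarrow> \<sigma> j (leg i k) = x i"
    and dis: "\<And>j j'. j < t \<Longrightarrow> j' < t \<Longrightarrow> j \<noteq> j' \<Longrightarrow>
      \<sigma> j ` (spider s (\<lambda>_. k) - feet s (\<lambda>_. k)) \<inter> \<sigma> j' ` (spider s (\<lambda>_. k) - feet s (\<lambda>_. k)) = {}"
  shows "contains_copy G (subdivide k (complete_bipartite s t))"
proof -
  let ?S = "spider s (\<lambda>_. k)" and ?B = "feet s (\<lambda>_. k)"
  let ?H = "subdivide k (complete_bipartite s t)"
  have k1: "\<forall>i<s. 1 \<le> k"
    using k by simp
  \<comment> \<open>The path replacing \<open>{i, s + j}\<close> is numbered from its minimum
    \<open>i\<close>, that is from the foot, whereas \<open>leg\<close> counts from the centre;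
    hence \<open>k - m\<close>.\<close>
  define f where "f v = (case v of Branch i \<Rightarrow> if i < s then x i else \<sigma> (i - s) (0, 0)
      | Inner e m \<Rightarrow> \<sigma> (Max e - s) (leg (Min e) (k - m)))" for v
  \<comment> \<open>Recovers the subdivision vertex from a spider and an interior position, so
    injectivity of \<open>f\<close> reduces to injectivity and disjointness of the spiders.\<close>
  define dec where "dec j p = (if snd p = 0 then Branch (s + j) else Inner {fst p, s + j} (k - snd p))"
    for j and p :: "nat \<times> nat"
  have mm: "Min {i, s + j} = i" "Max {i, s + j} = s + j" if "i < s" for i j
    using that by auto
  have verts: "(\<exists>i<s. v = Branch i \<and> f v = x i) \<or> (\<exists>j<t. \<exists>p\<in>?S - ?B. f v = \<sigma> j p \<and> v = dec j p)"
    if v: "v \<in> verts ?H" for v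
  proof -
    consider i where "v = Branch i" "i < s" | j where "v = Branch (s + j)" "j < t"
      | i j m where "v = Inner {i, s + j} m" "i < s" "j < t" "0 < m" "m < k"
    proof -
      from v consider i where "v = Branch i" "i < s + t"
        | e m where "v = Inner e m" "e \<in> edges (complete_bipartite s t)" "0 < m" "m < k"
      proof -
        have "verts (complete_bipartite s t) = {..<s + t}"
          by (simp add: complete_bipartite_def)
        then have "v \<in> Branch ` {..<s + t} \<union> {Inner e m | e m. e \<in> edges (complete_bipartite s t) \<and> 0 < m \<and> m < k}"
          using v unfolding subdivide_def fst_conv by simp
        then show thesis
          using that by blast
      qed
      then show thesis
      proof cases
        case 1
        show thesis
        proof (cases "i < s")
          case True
          then show thesis using 1 that(1) by blast
        next
          case False
          then show thesis using 1 that(2)[of "i - s"] by simp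
        qed
      next
        case 2
        then obtain i j where "e = {i, j}" "i < s" "s \<le> j" "j < s + t"
          by (auto simp: complete_bipartite_def)
        then show thesis
          using 2 that(3)[of i "j - s" m] by simp
      qed
    qed
    then show ?thesis
    proof cases
      case 1
      then show ?thesis
        by (simp add: f_def)
    next
      case 2
      have "leg 0 0 \<in> ?S - ?B"
        using s k leg_in_feet[OF k1, of 0 0] leg_spiderI[of 0 s 0 "\<lambda>_. k"] by simp
      then have "(0, 0) \<in> ?S - ?B"
        by simp
      moreover have "f v = \<sigma> j (0, 0)" "v = dec j (0, 0)"
        using 2 by (simp_all add: f_def dec_def)
      ultimately show ?thesis
        using 2(2) by blast
    next
      case 3
      have "leg i (k - m) \<in> ?S - ?B"
        using 3 leg_in_feet[OF k1, of i "k - m"] leg_spiderI[of i s "k - m" "\<lambda>_. k"] by simp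
      moreover have "f v = \<sigma> j (leg i (k - m))"
        using 3 mm[of i j] by (simp add: f_def)
      moreover have "v = dec j (leg i (k - m))"
        using 3 by (simp add: dec_def leg_def)
      ultimately show ?thesis
        using 3(3) by blast
    qed
  qed
  have foot: "leg i k \<in> ?S" "leg i k \<in> ?B" if "i < s" for i
    using that leg_spiderI[of i s k "\<lambda>_. k"] feetI[of i s "\<lambda>_. k"] by simp_all
  have xp: "x i \<noteq> \<sigma> j p" if "i < s" "j < t" "p \<in> ?S - ?B" for i j p
  proof -
    have "leg i k \<noteq> p"
      using foot[OF that(1)] that(3) by blast
    then have "\<sigma> j (leg i k) \<noteq> \<sigma> j p"
      using inj_onD[OF inj[OF that(2)], of "leg i k" p] foot[OF that(1)] that(3) by blast
    then show ?thesis
      using x[OF that(2,1)] by simp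
  qed
  have xx: "i = i'" if "i < s" "i' < s" "x i = x i'" for i i'
  proof -
    have "\<sigma> 0 (leg i k) = \<sigma> 0 (leg i' k)"
      using x[of 0] that t by simp
    then have "leg i k = leg i' k"
      using inj_onD[OF inj[of 0]] foot that t by simp
    then show ?thesis
      using k by (simp add: leg_eq_iff)
  qed
  have "inj_on f (verts ?H)"
  proof (rule inj_onI)
    fix v w assume v: "v \<in> verts ?H" and w: "w \<in> verts ?H" and eq: "f v = f w"
    from verts[OF v] verts[OF w] show "v = w"
    proof (elim disjE exE bexE conjE)
      fix i i' assume "i < s" "v = Branch i" "f v = x i" "i' < s" "w = Branch i'" "f w = x i'"
      then show ?thesis
        using xx eq by simp
    next
      fix i j p assume "i < s" "f v = x i" "j < t" "p \<in> ?S - ?B" "f w = \<sigma> j p"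
      then show ?thesis
        using xp[of i j p] eq by simp
    next
      fix i j p assume "i < s" "f w = x i" "j < t" "p \<in> ?S - ?B" "f v = \<sigma> j p"
      then show ?thesis
        using xp[of i j p] eq by simp
    next
      fix j p j' p' assume a: "j < t" "p \<in> ?S - ?B" "f v = \<sigma> j p" "v = dec j p"
        "j' < t" "p' \<in> ?S - ?B" "f w = \<sigma> j' p'" "w = dec j' p'"
      have e: "\<sigma> j p = \<sigma> j' p'"
        using a eq by simp
      have "j = j'"
      proof (rule ccontr)
        assume "j \<noteq> j'"
        from dis[OF a(1,5) this] show False
          using e imageI[OF a(2), of "\<sigma> j"] imageI[OF a(6), of "\<sigma> j'"] by (metis (no_types) IntI empty_iff)
      qed
      moreover have "p = p'"
        using inj_onD[OF inj[OF a(1)], of p p'] e a(2,6) calculation by blast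
      ultimately show ?thesis
        using a by simp
    qed
  qed
  moreover have "f ` verts ?H \<subseteq> verts G"
  proof (rule image_subsetI)
    fix v assume "v \<in> verts ?H"
    from verts[OF this] show "f v \<in> verts G"
    proof (elim disjE exE bexE conjE)
      fix i assume "i < s" "f v = x i"
      then have "f v = \<sigma> 0 (leg i k)"
        using x[of 0 i] t by simp
      then show ?thesis
        using img[of 0] foot[OF \<open>i < s\<close>] t by auto
    next
      fix j p assume "j < t" "p \<in> ?S - ?B" "f v = \<sigma> j p"
      then show ?thesis
        using img[of j] by auto
    qed
  qed
  moreover have "f ` e' \<in> edges G" if e': "e' \<in> edges ?H" for e'
  proof -
    obtain e m where e: "e \<in> edges (complete_bipartite s t)" "m < k"
      "e' = {path_vertex k e m, path_vertex k e (Suc m)}"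
      using e' by (auto simp: subdivide_def)
    then obtain i j' where ij': "e = {i, j'}" "i < s" "s \<le> j'" "j' < s + t"
      by (auto simp: complete_bipartite_def)
    define j where "j = j' - s"
    have ij: "e = {i, s + j}" "i < s" "j < t"
      using ij' by (auto simp: j_def)
    have pv: "f (path_vertex k e m) = \<sigma> j (leg i (k - m))" if "m \<le> k" for m
      using that ij mm[of i j] x[OF ij(3,2)] k by (simp add: path_vertex_def f_def)
    have "k - m = Suc (k - Suc m)"
      using e(2) by simp
    then have "f ` e' = {\<sigma> j (leg i (k - Suc m)), \<sigma> j (leg i (Suc (k - Suc m)))}"
      using e(2,3) pv[of m] pv[of "Suc m"] by (simp add: insert_commute)
    then show ?thesis
      using adj[OF ij(3,2), of "k - Suc m"] e(2) by simp
  qed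
  ultimately show ?thesis
    unfolding contains_copy_def by blast
qed

theorem theorem1p4:
  fixes s t k :: nat
  assumes "s \<ge> 2" and "t \<ge> 2" and "k \<ge> 2"
  shows "\<exists>C::real. C > 0 \<and>
    (\<forall>n::nat. real (ex n (subdivide k (complete_bipartite s t)))
       \<le> C * real n powr (1 + (real s - 1) / (real s * real k)))"
proof -
  let ?H = "subdivide k (complete_bipartite s t)"
  define \<alpha> where "\<alpha> = (real s - 1) / (real s * real k)"
  have \<alpha>: "0 < \<alpha>"
    using assms by (simp add: \<alpha>_def)
  define c where "c = (1 / 4 :: real) powr (1 / \<alpha>) / 2"
  define K0 where "K0 = 4 / c"
  have c: "0 < c"
    by (simp add: c_def)
  define K where "K = nat \<lceil>4 * K0\<rceil>"
  have K0: "0 < K0"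
    using c by (simp add: K0_def)
  have K1: "1 \<le> K" and K: "4 * K0 \<le> real K"
    using K0 unfolding K_def by linarith+
  obtain M :: nat where M: "\<And>(V :: nat set) adj d. host V adj d K \<Longrightarrow> V \<noteq> {} \<Longrightarrow> M * card V ^ (s - 1) \<le> d ^ (s * k) \<Longrightarrow>
    spider_copies V adj s t k"
    using spiders_in_regular_graph[OF assms(1,3) K1, where t = t and ?'a = nat] by (elim exE) blast
  \<comment> \<open>The summand \<open>2 / c\<close> is what \<open>regular_subgraph\<close> asks
    for; the other one makes \<open>C / 4\<close> at least \<open>M + 1\<close>, and then
    \<open>(C / 4) ^ (s * k)\<close> is at least \<open>M\<close>.\<close>
  define C where "C = 2 / c + 4 * (real M + 1)"
  have C0: "0 < C" and C1: "2 / c \<le> C" and C4: "real M + 1 \<le> C / 4"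
    using c by (simp_all add: C_def add_pos_pos)
  have "real (ex n ?H) \<le> C * real n powr (1 + \<alpha>)" for n
  proof (rule ccontr)
    assume neg: "\<not> ?thesis"
    have "{0, s} \<in> edges (complete_bipartite s t)"
      unfolding complete_bipartite_def snd_conv using assms
      by (intro CollectI exI[of _ 0] exI[of _ s]) simp
    then have "{path_vertex k {0, s} 0, path_vertex k {0, s} (Suc 0)} \<in> edges ?H"
      unfolding subdivide_def snd_conv using assms(3)
      by (intro CollectI exI[of _ "{0, s}"] exI[of _ 0]) simp
    then have "edges ?H \<noteq> {}"
      by blast
    from ex_attained[OF this, of n] obtain G :: "nat graph" where G: "simple_graph G" "card (verts G) = n"
      "\<not> contains_copy G ?H" "card (edges G) = ex n ?H"
      by blast
    interpret edge_set "verts G" "edges G"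
      using G(1) by unfold_locales (auto simp: simple_graph_def)
    have ne: "verts G \<noteq> {}"
    proof
      assume "verts G = {}"
      then have "edges G = {}"
        using edge by fastforce
      then show False
        using neg G(4) C0 by simp
    qed
    have many: "C * real (card (verts G)) powr (1 + \<alpha>) \<le> card (edges G)"
      using neg G(2,4) by simp
    from regular_subgraph[OF \<alpha> c_def K0_def C1 ne many] obtain U d where U: "U \<subseteq> verts G" "U \<noteq> {}"
      and d: "C / 4 * real (card U) powr \<alpha> \<le> real d"
      and deg: "\<forall>v\<in>U. real d \<le> real (card {e \<in> induced (edges G) U. v \<in> e}) \<and>
        real (card {e \<in> induced (edges G) U. v \<in> e}) \<le> 4 * K0 * real d"
      by (elim exE conjE)
    define adj where "adj u v \<longleftrightarrow> {u, v} \<in> induced (edges G) U" for u v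
    have adj_U: "u \<in> U \<and> v \<in> U" "u \<noteq> v" "{u, v} \<in> edges G" if "adj u v" for u v
      using that edge[of "{u, v}"] by (auto simp: adj_def induced_def)
    have finU: "finite U"
      using U(1) finV finite_subset by blast
    have nb: "card {w. adj v w} = card {e \<in> induced (edges G) U. v \<in> e}" for v
    proof -
      have "{e \<in> induced (edges G) U. v \<in> e} = (\<lambda>w. {v, w}) ` {w. adj v w}"
      proof
        show "{e \<in> induced (edges G) U. v \<in> e} \<subseteq> (\<lambda>w. {v, w}) ` {w. adj v w}"
        proof
          fix e assume e: "e \<in> {e \<in> induced (edges G) U. v \<in> e}"
          then have "card e = 2" "v \<in> e"
            using edge by (auto simp: induced_def)
          then obtain w where "e = {v, w}"
            by (auto simp: card_2_iff)
          then show "e \<in> (\<lambda>w. {v, w}) ` {w. adj v w}"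
            using e by (auto simp: adj_def)
        qed
      qed (auto simp: adj_def)
      moreover have "inj_on (\<lambda>w. {v, w}) {w. adj v w}"
        by (auto simp: inj_on_def doubleton_eq_iff)
      ultimately show ?thesis
        by (simp add: card_image)
    qed
    have host: "host U adj d K"
    proof
      show "finite U"
        by (rule finU)
      show "x \<in> U \<and> y \<in> U" if "adj x y" for x y
        using adj_U(1)[OF that] .
      show "adj y x" if "adj x y" for x y
        using that by (simp add: adj_def insert_commute)
      show "\<not> adj x x" for x
        using adj_U(2) by blast
      show "d \<le> card {w. adj v w}" if "v \<in> U" for v
        using deg that nb by simp
      show "card {w. adj v w} \<le> K * d" if "v \<in> U" for v
      proof -
        have "real (card {w. adj v w}) \<le> 4 * K0 * real d"
          using deg that nb by simp
        also have "\<dots> \<le> real K * real d"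
          using K by (intro mult_right_mono) simp_all
        finally have "real (card {w. adj v w}) \<le> real (K * d)"
          by simp
        then show ?thesis
          by (simp only: of_nat_le_iff)
      qed
    qed
    \<comment> \<open>Raising the degree bound to the power \<open>s * k\<close> turns the exponent
      \<open>\<alpha>\<close> into \<open>s - 1\<close>; this is what determines the exponent in the
      theorem.\<close>
    have "M * card U ^ (s - 1) \<le> d ^ (s * k)"
    proof -
      have cU: "0 < real (card U)"
        using U(2) finU by (simp add: card_gt_0_iff)
      have sk: "1 \<le> s * k"
        using assms by simp
      have C41: "1 \<le> C / 4"
        using C4 by simp
      have "real M \<le> (C / 4) ^ 1"
        using C4 by simp
      also have "\<dots> \<le> (C / 4) ^ (s * k)"
        using C41 sk by (rule power_increasing[rotated])
      finally have MC: "real M \<le> (C / 4) ^ (s * k)" .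
      have "(real (card U) powr \<alpha>) ^ (s * k) = real (card U) powr (\<alpha> * real (s * k))"
        using cU by (simp add: powr_powr flip: powr_realpow)
      also have "\<alpha> * real (s * k) = real (s - 1)"
        using assms by (simp add: \<alpha>_def of_nat_diff)
      also have "real (card U) powr real (s - 1) = real (card U) ^ (s - 1)"
        using cU by (rule powr_realpow)
      finally have Upow: "(real (card U) powr \<alpha>) ^ (s * k) = real (card U) ^ (s - 1)" .
      have "real (M * card U ^ (s - 1)) = real M * real (card U) ^ (s - 1)"
        by simp
      also have "\<dots> \<le> (C / 4) ^ (s * k) * real (card U) ^ (s - 1)"
        using MC by (intro mult_right_mono) simp_all
      also have "\<dots> = (C / 4 * real (card U) powr \<alpha>) ^ (s * k)"
        by (simp only: Upow power_mult_distrib)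
      also have "\<dots> \<le> real d ^ (s * k)"
        using d C0 by (intro power_mono) simp_all
      finally have "real (M * card U ^ (s - 1)) \<le> real (d ^ (s * k))"
        by simp
      then show ?thesis
        by (simp only: of_nat_le_iff)
    qed
    from M[OF host U(2) this] obtain x \<sigma> where
      \<sigma>: "\<forall>j<t. inj_on (\<sigma> j) (spider s (\<lambda>_. k)) \<and> \<sigma> j ` spider s (\<lambda>_. k) \<subseteq> U \<and>
        (\<forall>i<s. \<forall>m<k. adj (\<sigma> j (leg i m)) (\<sigma> j (leg i (Suc m)))) \<and> (\<forall>i<s. \<sigma> j (leg i k) = x i)"
      and dis: "\<forall>j<t. \<forall>j'<t. j \<noteq> j' \<longrightarrow> \<sigma> j ` (spider s (\<lambda>_. k) - feet s (\<lambda>_. k)) \<inter>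
        \<sigma> j' ` (spider s (\<lambda>_. k) - feet s (\<lambda>_. k)) = {}"
      unfolding spider_copies_def by (elim exE conjE)
    have "contains_copy G ?H"
    proof (rule contains_subdivided_complete_bipartite[where \<sigma> = \<sigma> and x = x])
      fix j assume "j < t"
      then have j: "inj_on (\<sigma> j) (spider s (\<lambda>_. k))" "\<sigma> j ` spider s (\<lambda>_. k) \<subseteq> U"
        "\<forall>i<s. \<forall>m<k. adj (\<sigma> j (leg i m)) (\<sigma> j (leg i (Suc m)))" "\<forall>i<s. \<sigma> j (leg i k) = x i"
        using \<sigma> by blast+
      show "inj_on (\<sigma> j) (spider s (\<lambda>_. k))"
        by (rule j(1))
      show "\<sigma> j ` spider s (\<lambda>_. k) \<subseteq> verts G"
        using j(2) U(1) by (rule subset_trans)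
      show "{\<sigma> j (leg i m), \<sigma> j (leg i (Suc m))} \<in> edges G" if "i < s" "m < k" for i m
        using j(3) that adj_U(3) by blast
      show "\<sigma> j (leg i k) = x i" if "i < s" for i
        using j(4) that by blast
    next
      fix j j' assume "j < t" "j' < t" "j \<noteq> j'"
      then show "\<sigma> j ` (spider s (\<lambda>_. k) - feet s (\<lambda>_. k)) \<inter> \<sigma> j' ` (spider s (\<lambda>_. k) - feet s (\<lambda>_. k)) = {}"
        using dis by blast
    qed (use assms in simp_all)
    then show False
      using G(3) by simp
  qed
  then show ?thesis
    using C0 unfolding \<alpha>_def by blast
qed

end
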